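(* Let $\mathcal{U}^{F,n}_{D,Q,\mathcal{P}}=(\mathcal{U}^{A}_{D,Q,\mathcal{P}},\mathcal{U}^{R}_{D,Q,\mathcal{P}})$ be a Chudnovsky$^2$ multiplication algorithm such that $D$ is an effective divisor, $D-Q$ is a non-special divisor of degree $g-1$, and the cardinality of $\mathcal{P}$ equals $\dim \mathcal{L}(2D)$ (which is $2n+g-1$). Then one can choose a basis of $\mathcal{L}(2D)$ of the form $\mathcal{B}_{2D}=\mathcal{B}_D\cup\mathcal{B}_D^c$, where $\mathcal{B}_D=\{f_1,\dots,f_n\}$ is a basis of $\mathcal{L}(D)$ and $\mathcal{B}_D^c=\{f_{n+1},\dots,f_{2n+g-1}\}$ is a basis of a complement of $\mathcal{L}(D)$ in $\mathcal{L}(2D)$. Moreover, with a basis $\mathcal{B}_Q$ of the residue class field $F_Q$ over $\mathbb{F}_q$ fixed and with the canonical basis $\mathcal{B}_c$ of $\mathbb{F}_q^{2n+g-1}$ fixed, for every $\sigma\in GL_{\mathbb{F}_q}(2n+g-1)$ we have $$\mathcal{U}^{F,n}_{\sigma(D),Q,\mathcal{P}}=\mathcal{U}^{F,n}_{D,Q,\mathcal{P}},$$ where $\sigma(D)$ denotes replacing the basis $\mathcal{B}_{2D}$ of $\mathcal{L}(2D)$ by the basis $\sigma(\mathcal{B}_{2D})$. In particular, the numbers $N_z(C\,T_{2D}^{-1})$ and $N_1(C\,T_{2D}^{-1})$ are constant under this action of $GL_{\mathbb{F}_q}(2n+g-1)$.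
   Context: Setting. $q$ is a prime power, $n\ge 1$ an integer, $F/\mathbb{F}_q$ an algebraic function field of genus $g$, $Q$ a place of $F/\mathbb{F}_q$ of degree $n$ with valuation ring $\mathcal{O}_Q$ and residue class field $F_Q=\mathcal{O}_Q/Q\cong\mathbb{F}_{q^n}$, $D$ a divisor of $F/\mathbb{F}_q$, and $\mathcal{P}=\{P_1,\dots,P_N\}$ an ordered set of distinct places of degree one. $\mathcal{L}(D)$ denotes the Riemann–Roch space of $D$. It is assumed that the support of $D$ contains none of $Q,P_1,\dots,P_N$, that the evaluation map $Ev_Q:\mathcal{L}(D)\to F_Q$, $f\mapsto f(Q)$, is surjective, and that $Ev_{\mathcal{P}}:\mathcal{L}(2D)\to\mathbb{F}_q^N$, $f\mapsto(f(P_1),\dots,f(P_N))$, is injective. Let $E_Q:\mathcal{O}_Q\to F_Q$ be the canonical projection (note $\mathcal{L}(D)\subseteq\mathcal{O}_Q$ and $\mathcal{L}(2D)\subseteq\mathcal{O}_Q$) and let $E_{\mathcal{P}}$ denote evaluation at $P_1,\dots,P_N$ (extending $Ev_{\mathcal{P}}$). The Chudnovsky$^2$ multiplication algorithm computes $xy=\mathcal{U}^R(\mathcal{U}^A(x)\odot\mathcal{U}^A(y))$ for $x,y\in F_Q$, where $\odot$ is the coordinatewise product, $\mathcal{U}^{A}_{D,Q,\mathcal{P}}:=E_{\mathcal{P}}\circ Ev_Q^{-1}$ and $\mathcal{U}^{R}_{D,Q,\mathcal{P}}:=E_Q\circ Ev_{\mathcal{P}}^{-1}$ (inverse taken on the image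 of $Ev_{\mathcal{P}}$). Under the hypotheses of the statement $Ev_Q$ and $Ev_{\mathcal{P}}$ are isomorphisms, $\mathcal{L}(D)\subseteq\mathcal{L}(2D)$, $\dim\mathcal{L}(D)=n$ and $N=\dim\mathcal{L}(2D)=2n+g-1$. The algorithm is considered with chosen bases: $\mathcal{B}_Q$ of $F_Q$, $\mathcal{B}_{2D}$ of $\mathcal{L}(2D)$, and $\mathcal{B}_c$ of $\mathbb{F}_q^N$. The maps $\mathcal{U}^A$ and $\mathcal{U}^R$ are represented by the products of the matrices (in these bases) of the maps composing them: $\mathcal{U}^A$ is $Ev_Q^{-1}$ viewed as a map $F_Q\to\mathcal{L}(D)\subseteq\mathcal{L}(2D)$, followed by $Ev_{\mathcal{P}}:\mathcal{L}(2D)\to\mathbb{F}_q^N$; $\mathcal{U}^R$ is $Ev_{\mathcal{P}}^{-1}:\mathbb{F}_q^N\to\mathcal{L}(2D)$ followed by $E_Q|_{\mathcal{L}(2D)}$. Two algorithms are equal if the resulting matrices of their $\mathcal{U}^A$ parts coincide and the resulting matrices of their $\mathcal{U}^R$ parts coincide. $T_{2D}$ is the matrix of $Ev_{\mathcal{P}}:\mathcal{L}(2D)\to\mathbb{F}_q^N$ in the bases $\mathcal{B}_{2D}$, $\mathcal{B}_c$; $C$ is the matrix of $E_Q|_{\mathcal{L}(2D)}:\mathcal{L}(2D)\to F_Q$ in the bases $\mathcal{B}_{2D}$, $\mathcal{B}_Q$; thus $C\,T_{2D}^{-1}$ is the matrix of $\mathcal{U}^R$. For a matrix $M$ over $\mathbb{F}_q$,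 $N_z(M)$ (resp. $N_1(M)$) is the number of entries of $M$ equal to $0$ (resp. $1$). For $\sigma=(\sigma_{ij})$ in the linear group, $\sigma$ acts on an ordered basis $(f_j)$ by $\sigma(f)_j=\sum_i\sigma_{ij}f_i$. *)

theory Defs
  imports
    "HOL-Algebra.Algebra"
    "HOL-Library.Poly_Mapping"
    "HOL-Number_Theory.Prime_Powers"
    "Jordan_Normal_Form.Matrix"
begin

section \<open>Ordered bases, coordinates and matrices over a subfield\<close>

definition is_basis :: "('a, 'b) ring_scheme \<Rightarrow> 'a set \<Rightarrow> 'a set \<Rightarrow> 'a list \<Rightarrow> bool"
  where "is_basis R K E Us \<longleftrightarrow> ring.independent R K Us \<and> ring.Span R K Us = E"

definition is_complement :: "('a, 'b) ring_scheme \<Rightarrow> 'a set \<Rightarrow> 'a set \<Rightarrow> 'a set \<Rightarrow> bool"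
  where "is_complement R U W V \<longleftrightarrow> U \<inter> W = {\<zero>\<^bsub>R\<^esub>} \<and> U <+>\<^bsub>R\<^esub> W = V"

text \<open>The scalars are kept in the fixed set \<open>K\<close> and act on \<open>R\<close> through \<open>e\<close>. This lets
  coordinates of elements of a residue field be taken in the constant field itself instead of
  in its image in the residue field.\<close>

definition coordinates ::
    "('r, 'b) ring_scheme \<Rightarrow> 'a set \<Rightarrow> ('a \<Rightarrow> 'r) \<Rightarrow> 'r list \<Rightarrow> 'r \<Rightarrow> 'a list"
  where "coordinates R K e Us v =
    (THE cs. length cs = length Us \<and> set cs \<subseteq> K \<and> ring.combine R (map e cs) Us = v)"

text \<open>Column \<open>j\<close> of the matrix holds the coordinates, with respect to the basis of the target,
  of the image of the \<open>j\<close>-th vector of the ordered basis \<open>Us\<close> of the source.\<close>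

definition matrix_of :: "('v \<Rightarrow> 'w) \<Rightarrow> 'v list \<Rightarrow> nat \<Rightarrow> ('w \<Rightarrow> 'a list) \<Rightarrow> 'a mat"
  where "matrix_of \<phi> Us r crd = mat r (length Us) (\<lambda>(i, j). crd (\<phi> (Us ! j)) ! i)"

definition mat_mult :: "('a, 'b) ring_scheme \<Rightarrow> 'a mat \<Rightarrow> 'a mat \<Rightarrow> 'a mat"
  where "mat_mult R A B = mat (dim_row A) (dim_col B)
    (\<lambda>(i, j). \<Oplus>\<^bsub>R\<^esub>k\<in>{..<dim_col A}. A $$ (i, k) \<otimes>\<^bsub>R\<^esub> B $$ (k, j))"

definition sq_mat_monoid :: "('a, 'b) ring_scheme \<Rightarrow> 'a set \<Rightarrow> nat \<Rightarrow> 'a mat monoid"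
  where "sq_mat_monoid R K m =
    \<lparr>carrier = {A \<in> carrier_mat m m. elements_mat A \<subseteq> K},
     monoid.mult = mat_mult R,
     monoid.one = mat m m (\<lambda>(i, j). if i = j then \<one>\<^bsub>R\<^esub> else \<zero>\<^bsub>R\<^esub>)\<rparr>"

definition GL :: "('a, 'b) ring_scheme \<Rightarrow> 'a set \<Rightarrow> nat \<Rightarrow> 'a mat set"
  where "GL R K m = Units (sq_mat_monoid R K m)"

definition mat_inv :: "('a, 'b) ring_scheme \<Rightarrow> 'a set \<Rightarrow> 'a mat \<Rightarrow> 'a mat"
  where "mat_inv R K A = inv\<^bsub>sq_mat_monoid R K (dim_row A)\<^esub> A"

definition act_basis :: "('a, 'b) ring_scheme \<Rightarrow> 'a mat \<Rightarrow> 'a list \<Rightarrow> 'a list"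
  where "act_basis R \<sigma> Us =
    map (\<lambda>j. \<Oplus>\<^bsub>R\<^esub>i\<in>{..<length Us}. \<sigma> $$ (i, j) \<otimes>\<^bsub>R\<^esub> Us ! i) [0..<length Us]"

definition count_entries :: "'a \<Rightarrow> 'a mat \<Rightarrow> nat"
  where "count_entries c A = card {(i, j). i < dim_row A \<and> j < dim_col A \<and> A $$ (i, j) = c}"

definition N\<^sub>z :: "('a, 'b) ring_scheme \<Rightarrow> 'a mat \<Rightarrow> nat"
  where "N\<^sub>z R A = count_entries \<zero>\<^bsub>R\<^esub> A"

definition N\<^sub>1 :: "('a, 'b) ring_scheme \<Rightarrow> 'a mat \<Rightarrow> nat"
  where "N\<^sub>1 R A = count_entries \<one>\<^bsub>R\<^esub> A"


section \<open>Algebraic function fields\<close>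

definition function_field :: "('a, 'b) ring_scheme \<Rightarrow> 'a set \<Rightarrow> bool"
  where "function_field F K \<longleftrightarrow> field F \<and> subfield K F \<and>
    (\<exists>x\<in>carrier F. ring.transcendental F K x \<and>
       ring.finite_dimension F (generate_field F (insert x K)) (carrier F))"

context
  fixes F :: "('a, 'b) ring_scheme" (structure) and K :: "'a set"
begin

definition valuation_ring :: "'a set \<Rightarrow> bool"
  where "valuation_ring V \<longleftrightarrow> subring V F \<and> K \<subset> V \<and> V \<subset> carrier F \<and>
    (\<forall>z\<in>carrier F - {\<zero>}. z \<in> V \<or> inv z \<in> V)"

definition places :: "'a set set"
  where "places = {P. \<exists>V. valuation_ring V \<and> maximalideal P (F\<lparr>carrier := V\<rparr>)}"

text \<open>A place is contained in exactly one valuation ring as its maximal ideal.\<close>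

definition place_ring :: "'a set \<Rightarrow> ('a, 'b) ring_scheme"
  where "place_ring P =
    F\<lparr>carrier := (THE V. valuation_ring V \<and> maximalideal P (F\<lparr>carrier := V\<rparr>))\<rparr>"

definition prime_element :: "'a set \<Rightarrow> 'a \<Rightarrow> bool"
  where "prime_element P t \<longleftrightarrow> t \<in> carrier (place_ring P) \<and> P = PIdl\<^bsub>place_ring P\<^esub> t"

text \<open>The discrete valuation on nonzero elements: \<open>v\<^sub>P (t\<^sup>m u) = m\<close> for a prime element \<open>t\<close>
  and a unit \<open>u\<close> of the valuation ring.\<close>

definition valuation :: "'a set \<Rightarrow> 'a \<Rightarrow> int"
  where "valuation P z =
    (THE m. \<exists>t u. prime_element P t \<and> u \<in> Units (place_ring P) \<and> z = (t [^] (m::int)) \<otimes> u)"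

definition residue_field :: "'a set \<Rightarrow> 'a set ring"
  where "residue_field P = place_ring P Quot P"

definition residue :: "'a set \<Rightarrow> 'a \<Rightarrow> 'a set"
  where "residue P f = P +>\<^bsub>place_ring P\<^esub> f"

definition place_degree :: "'a set \<Rightarrow> nat"
  where "place_degree P =
    ring.dim (residue_field P) (residue P ` K) (carrier (residue_field P))"

text \<open>Evaluation at a place of degree one, whose residue field is identified with \<open>K\<close>.\<close>

definition eval_at :: "'a set \<Rightarrow> 'a \<Rightarrow> 'a"
  where "eval_at P f = (THE c. c \<in> K \<and> residue P c = residue P f)"

definition eval_tuple :: "'a set list \<Rightarrow> 'a \<Rightarrow> 'a list"
  where "eval_tuple Ps f = map (\<lambda>P. eval_at P f) Ps"

definition is_divisor :: "('a set \<Rightarrow>\<^sub>0 int) \<Rightarrow> bool"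
  where "is_divisor A \<longleftrightarrow> Poly_Mapping.keys A \<subseteq> places"

definition effective :: "('a set \<Rightarrow>\<^sub>0 int) \<Rightarrow> bool"
  where "effective A \<longleftrightarrow> (\<forall>P. 0 \<le> Poly_Mapping.lookup A P)"

definition div_degree :: "('a set \<Rightarrow>\<^sub>0 int) \<Rightarrow> int"
  where "div_degree A =
    (\<Sum>P\<in>Poly_Mapping.keys A. Poly_Mapping.lookup A P * int (place_degree P))"

definition RR :: "('a set \<Rightarrow>\<^sub>0 int) \<Rightarrow> 'a set"
  where "RR A = {f \<in> carrier F.
    f \<noteq> \<zero> \<longrightarrow> (\<forall>P\<in>places. valuation P f \<ge> - Poly_Mapping.lookup A P)}"

definition RR_dim :: "('a set \<Rightarrow>\<^sub>0 int) \<Rightarrow> nat"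
  where "RR_dim A = ring.dim F K (RR A)"

text \<open>\<open>g\<close> is the maximum of \<open>deg A - dim L(A) + 1\<close> over all divisors \<open>A\<close>.\<close>

definition has_genus :: "nat \<Rightarrow> bool"
  where "has_genus g \<longleftrightarrow>
    (\<exists>A. is_divisor A \<and> int g = div_degree A - int (RR_dim A) + 1) \<and>
    (\<forall>A. is_divisor A \<longrightarrow> div_degree A - int (RR_dim A) + 1 \<le> int g)"

definition specialty_index :: "nat \<Rightarrow> ('a set \<Rightarrow>\<^sub>0 int) \<Rightarrow> int"
  where "specialty_index g A = int (RR_dim A) - div_degree A + int g - 1"

definition nonspecial :: "nat \<Rightarrow> ('a set \<Rightarrow>\<^sub>0 int) \<Rightarrow> bool"
  where "nonspecial g A \<longleftrightarrow> specialty_index g A = 0"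


section \<open>Matrices of the multiplication algorithm\<close>

text \<open>\<open>BQ\<close> is an ordered basis of the residue field of \<open>Q\<close> and \<open>B\<close> an ordered basis of
  \<open>L(2D)\<close>. Elements of \<open>K\<^sup>N\<close> are lists of length \<open>N\<close>; in the canonical basis such a list is
  its own coordinate list.\<close>

definition canonical_basis :: "nat \<Rightarrow> 'a list list"
  where "canonical_basis N = map (\<lambda>j. map (\<lambda>i. if i = j then \<one> else \<zero>) [0..<N]) [0..<N]"

definition is_residue_basis :: "'a set \<Rightarrow> 'a set list \<Rightarrow> bool"
  where "is_residue_basis Q BQ \<longleftrightarrow>
    is_basis (residue_field Q) (residue Q ` K) (carrier (residue_field Q)) BQ"

definition T_mat :: "'a set list \<Rightarrow> 'a list \<Rightarrow> 'a mat"
  where "T_mat Ps B = matrix_of (eval_tuple Ps) B (length Ps) (\<lambda>v. v)"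

definition C_mat :: "'a set \<Rightarrow> 'a set list \<Rightarrow> 'a list \<Rightarrow> 'a mat"
  where "C_mat Q BQ B =
    matrix_of (residue Q) B (length BQ) (coordinates (residue_field Q) K (residue Q) BQ)"

definition EvQ_inv_mat :: "'a set \<Rightarrow> ('a set \<Rightarrow>\<^sub>0 int) \<Rightarrow> 'a set list \<Rightarrow> 'a list \<Rightarrow> 'a mat"
  where "EvQ_inv_mat Q D BQ B =
    matrix_of (inv_into (RR D) (residue Q)) BQ (length B) (coordinates F K (\<lambda>c. c) B)"

definition EvP_inv_mat :: "('a set \<Rightarrow>\<^sub>0 int) \<Rightarrow> 'a set list \<Rightarrow> 'a list \<Rightarrow> 'a mat"
  where "EvP_inv_mat D Ps B =
    matrix_of (inv_into (RR (frag_cmul 2 D)) (eval_tuple Ps)) (canonical_basis (length Ps))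
      (length B) (coordinates F K (\<lambda>c. c) B)"

definition UA_mat ::
    "'a set \<Rightarrow> ('a set \<Rightarrow>\<^sub>0 int) \<Rightarrow> 'a set list \<Rightarrow> 'a set list \<Rightarrow> 'a list \<Rightarrow> 'a mat"
  where "UA_mat Q D Ps BQ B = mat_mult F (T_mat Ps B) (EvQ_inv_mat Q D BQ B)"

definition UR_mat ::
    "'a set \<Rightarrow> ('a set \<Rightarrow>\<^sub>0 int) \<Rightarrow> 'a set list \<Rightarrow> 'a set list \<Rightarrow> 'a list \<Rightarrow> 'a mat"
  where "UR_mat Q D Ps BQ B = mat_mult F (C_mat Q BQ B) (EvP_inv_mat D Ps B)"

definition chudnovsky_algorithm ::
    "'a set \<Rightarrow> ('a set \<Rightarrow>\<^sub>0 int) \<Rightarrow> 'a set list \<Rightarrow> 'a set list \<Rightarrow> 'a list \<Rightarrow> 'a mat \<times> 'a mat"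
  where "chudnovsky_algorithm Q D Ps BQ B = (UA_mat Q D Ps BQ B, UR_mat Q D Ps BQ B)"

definition CT_inv :: "'a set \<Rightarrow> 'a set list \<Rightarrow> 'a set list \<Rightarrow> 'a list \<Rightarrow> 'a mat"
  where "CT_inv Q Ps BQ B = mat_mult F (C_mat Q BQ B) (mat_inv F K (T_mat Ps B))"

definition adapted_basis :: "('a set \<Rightarrow>\<^sub>0 int) \<Rightarrow> 'a list \<Rightarrow> 'a list \<Rightarrow> bool"
  where "adapted_basis D BD BDc \<longleftrightarrow>
    is_basis F K (RR D) BD \<and>
    (\<exists>W. is_complement F (RR D) W (RR (frag_cmul 2 D)) \<and> is_basis F K W BDc) \<and>
    is_basis F K (RR (frag_cmul 2 D)) (BD @ BDc)"

end

end

theory Submission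
  imports Defs
begin

text \<open>The matrices of \<open>U\<^sup>A\<close> and \<open>U\<^sup>R\<close> are products in which a basis of \<open>L(2D)\<close> occurs twice, once on the
  target side and once on the source side, and the two occurrences cancel. Concretely, if \<open>\<phi>\<close> is a
  linear functional on \<open>L(2D)\<close> and \<open>B\<close> any basis, then the sum of \<open>\<phi>(B\<^sub>k)\<close> times the \<open>k\<close>-th
  coordinate of \<open>v\<close> is \<open>\<phi>(v)\<close> (\<open>functional_product\<close>). With \<open>\<phi>\<close> the evaluation at a place,
  respectively a coordinate of the residue at \<open>Q\<close>, this shows that the entries of both matrices are
  expressions without \<open>B\<close> (\<open>UA_mat_eq\<close>, \<open>UR_mat_eq\<close>). The matrix of \<open>Ev\<^sub>P\<^sup>-\<^sup>1\<close> is the inverse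
  of \<open>T\<close> (\<open>mat_inv_T\<close>), so \<open>C T\<^sup>-\<^sup>1\<close> is the matrix of \<open>U\<^sup>R\<close> and its numbers of zeros and ones are
  constant. What remains of the action of \<open>\<sigma>\<close> is that it maps bases to bases
  (\<open>act_basis_is_basis\<close>).

  These arguments need \<open>dim L(D) = n\<close> and \<open>dim L(2D) = 2n + g - 1\<close>. Since \<open>K\<close> is finite and \<open>Ev\<^sub>P\<close>
  embeds \<open>L(2D)\<close> into \<open>K\<^sup>N\<close>, all spaces involved are finite and dimensions are logarithms of
  cardinalities. The space \<open>L(D - Q)\<close> vanishes, so \<open>Ev\<^sub>Q\<close> is bijective on \<open>L(D)\<close>. The lower
  bound for \<open>dim L(2D)\<close> is the definition of the genus. The upper bound holds because adding a place
  of degree \<open>d\<close> to a divisor multiplies the number of elements of the Riemann-Roch space by at most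
  \<open>q\<^sup>d\<close> (\<open>card_RR_step\<close>): up to elements of the smaller space, a function is determined by its
  coefficient at the largest admitted pole order.

  That step rests on two facts about a place of a function field: its valuation is discrete and its
  residue field is finite. Both follow from a single finiteness statement. Let \<open>V\<close> be the valuation
  ring, \<open>z\<close> an element such that the function field is finite over \<open>K(z)\<close>, and \<open>s\<close> one of \<open>z\<close> and
  its inverse that lies in \<open>V\<close>. Choose a nonzero polynomial \<open>p\<close> of least degree for which \<open>x = p(s)\<close> is in
  the maximal ideal. Nonzero polynomials of smaller degree take unit values at \<open>s\<close>, so they serve as
  scalars for a dimension argument modulo \<open>x\<close>, and \<open>V/xV\<close> is finite (\<open>finite_cover_exists\<close>).
  Finitely many ideals lie between \<open>xV\<close> and \<open>V\<close>, which makes the maximal ideal principal, and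
  the pigeonhole principle for the powers of its generator gives discreteness
  (\<open>uniformizer_exists\<close>).\<close>

section \<open>Valuation rings of a field\<close>

context field
begin

lemma nonzero_inv [simp]:
  assumes "x \<in> carrier R" "x \<noteq> \<zero>"
  shows "inv x \<in> carrier R" "inv x \<noteq> \<zero>" "x \<otimes> inv x = \<one>" "inv x \<otimes> x = \<one>" "inv (inv x) = x"
proof -
  have U: "x \<in> Units R" using assms field_Units by blast
  show "inv x \<in> carrier R" "x \<otimes> inv x = \<one>" "inv x \<otimes> x = \<one>" "inv (inv x) = x" using U by simp_all
  then show "inv x \<noteq> \<zero>" using assms by force
qed

lemma inv_mult_field:
  assumes "x \<in> carrier R" "x \<noteq> \<zero>" "y \<in> carrier R" "y \<noteq> \<zero>"
  shows "inv (x \<otimes> y) = inv x \<otimes> inv y"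
proof -
  have "(x \<otimes> y) \<otimes> (inv x \<otimes> inv y) = (x \<otimes> inv x) \<otimes> (y \<otimes> inv y)"
    using assms nonzero_inv(1)[of x] nonzero_inv(1)[of y] by algebra
  also have "\<dots> = \<one>" using assms by simp
  finally show ?thesis using assms comm_inv_char by (metis m_closed nonzero_inv(1))
qed

lemma mult_eq_iff_inv:
  assumes "x \<in> carrier R" "y \<in> carrier R" "y \<noteq> \<zero>" "z \<in> carrier R"
  shows "x = y \<otimes> z \<longleftrightarrow> x \<otimes> inv y = z"
proof
  assume "x = y \<otimes> z"
  then have "x \<otimes> inv y = z \<otimes> (y \<otimes> inv y)"
    using assms nonzero_inv(1)[of y] by algebra
  then show "x \<otimes> inv y = z" using assms by simp
next
  assume "x \<otimes> inv y = z"
  moreover have "y \<otimes> (x \<otimes> inv y) = x \<otimes> (y \<otimes> inv y)"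
    using assms(1,2) nonzero_inv(1)[OF assms(2,3)] by algebra
  ultimately show "x = y \<otimes> z" using assms by simp
qed

end

locale valuation_subring = field F for F (structure) +
  fixes V :: "'a set"
  assumes subring: "subring V F"
    and proper: "V \<subset> carrier F"
    and total: "\<And>x. x \<in> carrier F \<Longrightarrow> x \<noteq> \<zero> \<Longrightarrow> x \<in> V \<or> inv x \<in> V"
begin

lemmas V_closed [simp] = subringE(2,3,5-7)[OF subring]

lemma V_carrier [simp]: "x \<in> V \<Longrightarrow> x \<in> carrier F"
  using proper by auto

lemma V_minus [simp]: "x \<in> V \<Longrightarrow> y \<in> V \<Longrightarrow> x \<ominus> y \<in> V"
  by (simp add: a_minus_def)

text \<open>The set of nonunits, which turns out to be the maximal ideal. The zero element is listed
  separately because \<open>inv \<zero>\<close> is unspecified.\<close>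

definition M :: "'a set"
  where "M = {x \<in> V. x = \<zero> \<or> inv x \<notin> V}"

lemma M_V: "x \<in> M \<Longrightarrow> x \<in> V"
  by (simp add: M_def)

lemma M_carrier: "x \<in> M \<Longrightarrow> x \<in> carrier F"
  by (simp add: M_V)

lemma zero_M [simp]: "\<zero> \<in> M"
  by (simp add: M_def)

lemma one_M [simp]: "\<one> \<notin> M"
  by (simp add: M_def)

lemma unit_inv: "u \<in> V \<Longrightarrow> u \<notin> M \<Longrightarrow> inv u \<in> V" "u \<in> V \<Longrightarrow> u \<notin> M \<Longrightarrow> u \<noteq> \<zero>"
  by (auto simp: M_def)

lemma unit_inv_notin_M: 
  assumes "u \<in> V" "u \<notin> M"
  shows "inv u \<notin> M"
proof
  assume "inv u \<in> M"
  moreover have "u \<noteq> \<zero>" using unit_inv(2)[OF assms] .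
  then have "inv (inv u) = u" "inv u \<noteq> \<zero>" using nonzero_inv[OF V_carrier[OF assms(1)]] by blast+
  ultimately show False using assms(1) unfolding M_def by auto
qed

lemma M_mult:
  assumes "x \<in> M" "y \<in> V"
  shows "x \<otimes> y \<in> M" "y \<otimes> x \<in> M"
proof -
  have V: "x \<in> V" using assms M_V by simp
  show *: "x \<otimes> y \<in> M"
  proof (cases "x = \<zero> \<or> y = \<zero>")
    case True then show ?thesis using V assms by auto
  next
    case False
    then have nz: "x \<noteq> \<zero>" "y \<noteq> \<zero>" "x \<in> carrier F" "y \<in> carrier F" using assms V by auto
    have False if "inv (x \<otimes> y) \<in> V"
    proof -
      have "y \<otimes> inv (x \<otimes> y) = inv x \<otimes> (y \<otimes> inv y)"
        using nz m_lcomm[of y "inv x" "inv y"] by (simp add: inv_mult_field)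
      then have "y \<otimes> inv (x \<otimes> y) = inv x" using nz by simp
      then have "inv x \<in> V" using that assms V_closed(4) by metis
      then show False using assms nz by (simp add: M_def)
    qed
    then show ?thesis using assms V by (simp add: M_def) blast
  qed
  show "y \<otimes> x \<in> M" using * assms V by (simp add: m_comm[of y x])
qed

lemma M_uminus: "x \<in> M \<Longrightarrow> \<ominus> x \<in> M"
  using M_mult(1)[of x "\<ominus> \<one>"] by (simp add: r_minus M_V)

text \<open>The ideals of a valuation ring form a chain: the quotient of two nonzero elements or
  its inverse lies in the ring, and if the quotient does not, its inverse is a nonunit.\<close>

lemma divides_total:
  assumes "x \<in> carrier F" "y \<in> carrier F" "y \<noteq> \<zero>" "x \<noteq> \<zero>"
  shows "(\<exists>v\<in>V. x = y \<otimes> v) \<or> (\<exists>v\<in>M. y = x \<otimes> v)"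
proof (cases "x \<otimes> inv y \<in> V")
  case True
  then show ?thesis using mult_eq_iff_inv[OF assms(1-3), of "x \<otimes> inv y"] V_carrier by blast
next
  case False
  have c: "x \<otimes> inv y \<in> carrier F" using assms by simp
  have nz: "x \<otimes> inv y \<noteq> \<zero>" using assms by (simp add: integral_iff)
  then have "inv (x \<otimes> inv y) \<in> V" using total[OF c] False by blast
  moreover have "inv (x \<otimes> inv y) = y \<otimes> inv x" using assms by (simp add: inv_mult_field m_comm)
  moreover have "inv (inv (x \<otimes> inv y)) = x \<otimes> inv y" using nz c by simp
  ultimately have "y \<otimes> inv x \<in> M" using False by (simp add: M_def)
  then show ?thesis using mult_eq_iff_inv[OF assms(2,1,4), of "y \<otimes> inv x"] M_carrier by blast
qed

text \<open>Of two nonunits one divides the other, so their sum is a multiple of a nonunit.\<close>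

lemma M_add:
  assumes "x \<in> M" "y \<in> M"
  shows "x \<oplus> y \<in> M"
proof (cases "x = \<zero> \<or> y = \<zero>")
  case True then show ?thesis using assms by (auto simp: M_V)
next
  case False
  have *: "a \<oplus> b \<in> M" if "a \<in> M" "b \<in> M" "v \<in> V" "a = b \<otimes> v" for a b v
  proof -
    have "a \<oplus> b = b \<otimes> (v \<oplus> \<one>)" using that by (simp add: r_distr M_V)
    then show ?thesis using that by (simp add: M_mult)
  qed
  have "(\<exists>v\<in>V. x = y \<otimes> v) \<or> (\<exists>v\<in>M. y = x \<otimes> v)"
    using divides_total[of x y] assms False by (simp add: M_V)
  then show ?thesis
  proof
    assume "\<exists>v\<in>V. x = y \<otimes> v"
    then show ?thesis using *[OF assms] by blast
  next
    assume "\<exists>v\<in>M. y = x \<otimes> v"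
    then have "y \<oplus> x \<in> M" using *[OF assms(2,1)] M_V by blast
    then show ?thesis using a_comm[of x y] assms by (simp add: M_V)
  qed
qed

lemma M_minus: "x \<in> M \<Longrightarrow> y \<in> M \<Longrightarrow> x \<ominus> y \<in> M"
  by (simp add: a_minus_def M_add M_uminus)

lemma mult_notin_M: "x \<in> V \<Longrightarrow> y \<in> V \<Longrightarrow> x \<notin> M \<Longrightarrow> y \<notin> M \<Longrightarrow> x \<otimes> y \<notin> M"
proof
  assume *: "x \<in> V" "y \<in> V" "x \<notin> M" "y \<notin> M" "x \<otimes> y \<in> M"
  then have "inv x \<otimes> (x \<otimes> y) \<in> M" using unit_inv M_mult by simp
  moreover have "inv x \<otimes> (x \<otimes> y) = y"
    using * unit_inv(2)[of x] by (simp add: m_assoc[symmetric])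
  ultimately show False using * by simp
qed

lemma add_notin_M: "x \<in> M \<Longrightarrow> y \<in> V \<Longrightarrow> y \<notin> M \<Longrightarrow> x \<oplus> y \<notin> M"
proof
  assume *: "x \<in> M" "y \<in> V" "y \<notin> M" "x \<oplus> y \<in> M"
  then have "(x \<oplus> y) \<ominus> x \<in> M" by (simp add: M_minus)
  moreover have "(x \<oplus> y) \<ominus> x = y" using M_carrier[of x] V_carrier[of y] * by algebra
  ultimately show False using * by simp
qed

lemma pow_notin_M: "x \<in> V \<Longrightarrow> x \<notin> M \<Longrightarrow> x [^] (k::nat) \<in> V - M"
  by (induction k) (simp_all add: mult_notin_M)

lemma pow_V [simp]: "x \<in> V \<Longrightarrow> x [^] (k::nat) \<in> V"
  by (induction k) simp_all

abbreviation VR where "VR \<equiv> F\<lparr>carrier := V\<rparr>"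

lemma VR_cring: "cring VR"
  by (rule subcring_iff[THEN iffD1]) (use proper subcringI'[OF subring] in auto)

lemma VR_a_inv:
  assumes "x \<in> V"
  shows "\<ominus>\<^bsub>VR\<^esub> x = \<ominus> x"
proof -
  interpret VR: cring VR by (rule VR_cring)
  show ?thesis using assms VR.minus_equality[of "\<ominus> x" x] by (simp add: l_neg)
qed

lemma VR_minus: "y \<in> V \<Longrightarrow> x \<ominus>\<^bsub>VR\<^esub> y = x \<ominus> y"
  by (simp add: a_minus_def VR_a_inv)

lemma VR_Units: "Units VR = V - M"
proof (intro subset_antisym subsetI)
  fix u assume "u \<in> Units VR"
  then obtain w where w: "u \<in> V" "w \<in> V" "u \<otimes> w = \<one>" by (auto simp: Units_def)
  then have "u \<notin> M" using one_M M_mult(1)[of u w] by auto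
  then show "u \<in> V - M" using w by simp
next
  fix u assume u: "u \<in> V - M"
  then have "inv u \<in> V" "u \<otimes> inv u = \<one>" "inv u \<otimes> u = \<one>" using unit_inv[of u] by simp_all
  then show "u \<in> Units VR" using u by (auto simp: Units_def)
qed

lemma M_ideal: "ideal M VR"
proof -
  interpret VR: cring VR by (rule VR_cring)
  show ?thesis
  proof (rule idealI)
    show "ring VR" using VR.ring_axioms .
    show "subgroup M (add_monoid VR)"
      by (rule VR.add.subgroupI)
        (use VR_a_inv M_V in \<open>auto simp: a_inv_def[symmetric] M_uminus M_add intro: zero_M\<close>)
  qed (use M_mult in auto)
qed

text \<open>An element of the ring outside \<open>M\<close> is invertible, so no proper ideal contains it: every maximal
  ideal lies in \<open>M\<close>, which is itself a proper ideal.\<close>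

lemma maximalideal_eq_M:
  assumes "maximalideal P VR"
  shows "P = M"
proof -
  interpret P: maximalideal P VR by fact
  have PV: "P \<subseteq> V" using P.Icarr by auto
  have one: "\<one> \<notin> P" using P.one_imp_carrier P.I_notcarr by auto
  have PM: "P \<subseteq> M"
  proof
    fix p assume p: "p \<in> P"
    show "p \<in> M"
    proof (rule ccontr)
      assume "p \<notin> M"
      then have *: "inv p \<in> V" "p \<noteq> \<zero>" "p \<in> carrier F" using unit_inv p PV by auto
      have "p \<otimes> inv p \<in> P" using P.I_r_closed[of p "inv p"] p * by simp
      then show False using one * by simp
    qed
  qed
  have "M = P \<or> M = V" using P.I_maximal[OF M_ideal] PM M_V by auto
  moreover have "M \<noteq> V" using one_M V_closed(2) by metis
  ultimately show ?thesis by simp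
qed

text \<open>The ring can be recovered from its maximal ideal, so a place determines its ring.\<close>

lemma V_from_M: "V = {x \<in> carrier F. x = \<zero> \<or> inv x \<notin> M}"
proof (intro subset_antisym subsetI)
  fix x assume x: "x \<in> V"
  then have "x \<in> carrier F" by simp
  moreover have "inv x \<notin> M" if "x \<noteq> \<zero>"
    using that x nonzero_inv[of x] by (simp add: M_def)
  ultimately show "x \<in> {x \<in> carrier F. x = \<zero> \<or> inv x \<notin> M}" by blast
next
  fix x assume "x \<in> {x \<in> carrier F. x = \<zero> \<or> inv x \<notin> M}"
  then have x: "x \<in> carrier F" "x \<noteq> \<zero> \<Longrightarrow> inv x \<notin> M" by auto
  show "x \<in> V"
  proof (rule ccontr)
    assume "x \<notin> V"
    then have "x \<noteq> \<zero>" "inv x \<in> V" using total[OF x(1)] V_closed(1) by metis+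
    moreover have "inv (inv x) = x" using x(1) \<open>x \<noteq> \<zero>\<close> by simp
    ultimately have "inv x \<in> M" using \<open>x \<notin> V\<close> by (simp add: M_def)
    then show False using x(2) \<open>x \<noteq> \<zero>\<close> by simp
  qed
qed

end

section \<open>Linear relations over a subring\<close>

text \<open>For a field containing the subring \<open>A\<close> this bounds its degree over the fraction field of \<open>A\<close>.
  Stating it with coefficients in \<open>A\<close> itself keeps denominators out of all later arguments.\<close>

definition (in ring) rank_le :: "'a set \<Rightarrow> nat \<Rightarrow> bool"
  where "rank_le A d \<longleftrightarrow> (\<forall>Us. set Us \<subseteq> carrier R \<longrightarrow> d < length Us \<longrightarrow>
    (\<exists>Ks. length Ks = length Us \<and> set Ks \<subseteq> A \<and> \<not> set Ks \<subseteq> {\<zero>} \<and> combine Ks Us = \<zero>))"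

context field
begin

lemma l_cancel_field:
  "x \<in> carrier R \<Longrightarrow> x \<noteq> \<zero> \<Longrightarrow> y \<in> carrier R \<Longrightarrow> z \<in> carrier R \<Longrightarrow> x \<otimes> y = x \<otimes> z \<Longrightarrow> y = z"
  using m_lcancel by simp

lemma pow_nonzero [simp]: "x \<in> carrier R \<Longrightarrow> x \<noteq> \<zero> \<Longrightarrow> x [^] (k::nat) \<noteq> \<zero>"
  by (induction k) (auto simp: integral_iff)

lemma eval_in_subring:
  assumes "subring A R" "set as \<subseteq> A" "y \<in> A"
  shows "eval as y \<in> A"
  using assms(2)
proof (induction as)
  case Nil
  then show ?case using subringE(2)[OF assms(1)] by simp
next
  case (Cons a as)
  have "y [^] k \<in> A" for k :: nat
    by (induction k) (use subringE(3,6)[OF assms(1)] assms(3) in auto)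
  then show ?case using Cons subringE(6,7)[OF assms(1)] by auto
qed

text \<open>Cancel powers of \<open>y\<close> from a polynomial relation until its constant term is nonzero; that
  constant term is then a multiple of \<open>y\<close>.\<close>

lemma root_divides_const_term:
  assumes A: "subring A R" and y: "y \<in> carrier R" "y \<noteq> \<zero>"
    and "set as \<subseteq> A" "\<not> set as \<subseteq> {\<zero>}" "eval as y = \<zero>"
  shows "\<exists>b\<in>A. b \<noteq> \<zero> \<and> (\<exists>cs. set cs \<subseteq> A \<and> b = y \<otimes> eval cs y)"
  using assms(4-)
proof (induction as rule: rev_induct)
  case Nil
  then show ?case by simp
next
  case (snoc b as)
  note AE = subringE[OF A]
  have sub: "set as \<subseteq> carrier R" "b \<in> carrier R" "b \<in> A" "set as \<subseteq> A" using snoc.prems AE(1) by auto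
  have ec: "eval as y \<in> carrier R" using eval_in_carrier[OF sub(1) y(1)] .
  have ev: "eval as y \<otimes> y \<oplus> b = \<zero>" using snoc.prems eval_append_aux[OF sub(1,2) y(1)] by simp
  show ?case
  proof (cases "b = \<zero>")
    case True
    then have "eval as y \<otimes> y = \<zero>" using ev ec y by simp
    then have "eval as y = \<zero>" using ec y by (simp add: integral_iff)
    moreover have "\<not> set as \<subseteq> {\<zero>}" using snoc.prems True by auto
    ultimately show ?thesis using snoc.IH sub by simp
  next
    case False
    have 1: "set (map (\<lambda>a. \<ominus> \<one> \<otimes> a) as) \<subseteq> A" using sub(4) AE(3,5,6) by auto
    have "b \<oplus> eval as y \<otimes> y = \<zero>" using ev ec y sub(2) by (simp add: a_comm)
    then have "b = \<ominus> (eval as y \<otimes> y)" using ec y sub(2) by (simp add: minus_equality)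
    also have "\<dots> = y \<otimes> (\<ominus> \<one> \<otimes> eval as y)" using ec y by algebra
    also have "\<ominus> \<one> \<otimes> eval as y = eval (map (\<lambda>a. \<ominus> \<one> \<otimes> a) as) y"
      using sub(1)
    proof (induction as)
      case (Cons a as)
      have c: "a \<in> carrier R" "eval as y \<in> carrier R" "y [^] length as \<in> carrier R"
        using Cons.prems y by (auto intro: eval_in_carrier)
      have "\<ominus> \<one> \<otimes> (a \<otimes> y [^] length as \<oplus> eval as y) =
        \<ominus> \<one> \<otimes> a \<otimes> y [^] length as \<oplus> \<ominus> \<one> \<otimes> eval as y"
        using c by algebra
      then show ?case using Cons by simp
    qed simp
    finally show ?thesis using False sub(3) 1 by metis
  qed
qed

text \<open>Enough consecutive powers of \<open>y\<close> satisfy a linear relation over \<open>A\<close>, and its constant term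
  is a multiple of \<open>y\<close>. When \<open>A\<close> lies in a valuation ring, a nonunit \<open>y\<close> thus yields a nonzero nonunit in \<open>A\<close>.\<close>

lemma rank_le_integral_multiple:
  assumes A: "subring A R" and "rank_le A d" and y: "y \<in> carrier R" "y \<noteq> \<zero>"
  shows "\<exists>b\<in>A. b \<noteq> \<zero> \<and> (\<exists>cs. set cs \<subseteq> A \<and> b = y \<otimes> eval cs y)"
proof -
  have "set (exp_base y (Suc d)) \<subseteq> carrier R" "length (exp_base y (Suc d)) = Suc d"
    using exp_base_closed[OF y(1)] by blast (simp add: exp_base_def)
  then obtain Ks where Ks: "length Ks = Suc d" "set Ks \<subseteq> A" "\<not> set Ks \<subseteq> {\<zero>}"
      "combine Ks (exp_base y (Suc d)) = \<zero>"
    using assms(2) unfolding rank_le_def by (metis lessI)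
  then have "eval Ks y = \<zero>" using combine_eq_eval[of Ks y] by simp
  then show ?thesis using root_divides_const_term[OF A y Ks(2,3)] by simp
qed

text \<open>The elements with a denominator in \<open>A\<close> are closed under the field operations.\<close>

lemma generate_field_fraction:
  assumes A: "subring A R" and "H \<subseteq> A" and "h \<in> generate_field R H"
  shows "h \<in> carrier R \<and> (\<exists>b\<in>A. b \<noteq> \<zero> \<and> h \<otimes> b \<in> A)"
  using assms(3)
proof induction
  note AE = subringE[OF A]
  {
    case one
    show ?case using AE(3) by (intro conjI bexI[of _ \<one>]) auto
  next
    case (incl h)
    then show ?case using AE assms(2) by (intro conjI bexI[of _ \<one>]) auto
  next
    case (a_inv h)
    then obtain b where b: "b \<in> A" "b \<noteq> \<zero>" "h \<otimes> b \<in> A" "h \<in> carrier R" by blast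
    then have "\<ominus> h \<otimes> b = \<ominus> (h \<otimes> b)" using AE(1) by (auto simp: l_minus)
    then show ?case using b AE(5) by (metis a_inv_closed)
  next
    case (m_inv h)
    then obtain b where b: "b \<in> A" "b \<noteq> \<zero>" "h \<otimes> b \<in> A" "h \<in> carrier R" by blast
    then have "b \<in> carrier R" using AE(1) by auto
    then have "h \<otimes> b \<noteq> \<zero>" "inv h \<otimes> (h \<otimes> b) = b" "inv h \<in> carrier R"
      using b m_inv.hyps by (auto simp: integral_iff m_assoc[symmetric])
    then show ?case using b by metis
  next
    case (eng_add g h)
    then obtain b c where b: "b \<in> A" "b \<noteq> \<zero>" "g \<otimes> b \<in> A" "g \<in> carrier R"
      and c: "c \<in> A" "c \<noteq> \<zero>" "h \<otimes> c \<in> A" "h \<in> carrier R" by blast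
    have cc: "b \<in> carrier R" "c \<in> carrier R" using b c AE(1) by auto
    have "(g \<oplus> h) \<otimes> (b \<otimes> c) = (g \<otimes> b) \<otimes> c \<oplus> (h \<otimes> c) \<otimes> b" using b c cc by algebra
    moreover have "b \<otimes> c \<noteq> \<zero>" using b c cc by (simp add: integral_iff)
    ultimately show ?case using b c AE(6,7) by (metis a_closed)
  next
    case (eng_mult g h)
    then obtain b c where b: "b \<in> A" "b \<noteq> \<zero>" "g \<otimes> b \<in> A" "g \<in> carrier R"
      and c: "c \<in> A" "c \<noteq> \<zero>" "h \<otimes> c \<in> A" "h \<in> carrier R" by blast
    have cc: "b \<in> carrier R" "c \<in> carrier R" using b c AE(1) by auto
    have "(g \<otimes> h) \<otimes> (b \<otimes> c) = (g \<otimes> b) \<otimes> (h \<otimes> c)" using b c cc by algebra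
    moreover have "b \<otimes> c \<noteq> \<zero>" using b c cc by (simp add: integral_iff)
    ultimately show ?case using b c AE(6) by (metis m_closed)
  }
qed

lemma common_denominator:
  assumes A: "subring A R"
    and "\<And>h. h \<in> set hs \<Longrightarrow> h \<in> carrier R \<and> (\<exists>b\<in>A. b \<noteq> \<zero> \<and> h \<otimes> b \<in> A)"
  shows "\<exists>c\<in>A. c \<noteq> \<zero> \<and> (\<forall>h\<in>set hs. c \<otimes> h \<in> A)"
  using assms(2)
proof (induction hs)
  case Nil
  then show ?case using subringE(3)[OF A] by (auto intro!: bexI[of _ \<one>])
next
  case (Cons h hs)
  note AE = subringE[OF A]
  obtain c where c: "c \<in> A" "c \<noteq> \<zero>" "\<And>h. h \<in> set hs \<Longrightarrow> c \<otimes> h \<in> A" using Cons by auto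
  obtain b where b: "b \<in> A" "b \<noteq> \<zero>" "h \<otimes> b \<in> A" "h \<in> carrier R" using Cons.prems by force
  have cc: "b \<in> carrier R" "c \<in> carrier R" using b c AE(1) by auto
  have "(b \<otimes> c) \<otimes> h = c \<otimes> (h \<otimes> b)" using b cc by algebra
  moreover have "(b \<otimes> c) \<otimes> g = b \<otimes> (c \<otimes> g)" if "g \<in> set hs" for g
    using Cons.prems[of g] that cc by (simp add: m_assoc)
  moreover have "b \<otimes> c \<noteq> \<zero>" using b c cc by (simp add: integral_iff)
  moreover have "b \<otimes> c \<in> A" using AE(6) b c by simp
  ultimately show ?case using AE(6) b c by (intro bexI[of _ "b \<otimes> c"]) auto
qed

text \<open>A linear relation over the generated field becomes one over \<open>A\<close> after multiplication by a
  common denominator of its coefficients.\<close>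

lemma finite_dimension_imp_rank_le:
  assumes A: "subring A R" and H: "H \<subseteq> A"
    and fd: "finite_dimension (generate_field R H) (carrier R)"
  shows "\<exists>d. rank_le A d"
proof -
  have HR: "H \<subseteq> carrier R" using H subringE(1)[OF A] by simp
  note sf = generate_field_is_subfield[OF HR]
  obtain d where d: "dimension d (generate_field R H) (carrier R)" using fd by auto
  have "rank_le A d"
    unfolding rank_le_def
  proof (intro allI impI)
    fix Us assume Us: "set Us \<subseteq> carrier R" "d < length Us"
    have "dependent (generate_field R H) Us"
      using independent_length_le_dimension[OF sf d] Us by force
    then obtain Ks where Ks: "length Ks = length Us" "combine Ks Us = \<zero>"
        "set Ks \<subseteq> generate_field R H" "set Ks \<noteq> {\<zero>}"
      using dependent_imp_non_trivial_combine[OF sf Us(1)] by metis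
    obtain c where c: "c \<in> A" "c \<noteq> \<zero>" "\<And>h. h \<in> set Ks \<Longrightarrow> c \<otimes> h \<in> A"
      using common_denominator[OF A, of Ks] generate_field_fraction[OF A H] Ks(3) by blast
    have cc: "c \<in> carrier R" using c subringE(1)[OF A] by auto
    have KR: "set Ks \<subseteq> carrier R" using Ks(3) generate_field_incl[OF HR] by simp
    obtain k where k: "k \<in> set Ks" "k \<noteq> \<zero>"
      using Ks(1,4) Us(2) by (cases Ks) auto
    then have "c \<otimes> k \<noteq> \<zero>" using c cc KR by (auto simp: integral_iff)
    then have "\<not> set (map ((\<otimes>) c) Ks) \<subseteq> {\<zero>}" using k by auto
    moreover have "combine (map ((\<otimes>) c) Ks) Us = \<zero>"
      using combine_r_distr[OF KR Us(1) cc] Ks(2) cc by simp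
    ultimately show "\<exists>Ks. length Ks = length Us \<and> set Ks \<subseteq> A \<and> \<not> set Ks \<subseteq> {\<zero>} \<and> combine Ks Us = \<zero>"
      using Ks(1) c(3) by (intro exI[of _ "map ((\<otimes>) c) Ks"]) auto
  qed
  then show ?thesis by blast
qed

text \<open>A valuation ring contains \<open>s\<close> or its inverse, and either can serve as the generator of the same field.\<close>

lemma generate_field_inv_generator:
  assumes "insert s K \<subseteq> carrier R" "s \<noteq> \<zero>"
  shows "generate_field R (insert (inv s) K) = generate_field R (insert s K)"
proof -
  have *: "generate_field R (insert (inv t) K) \<subseteq> generate_field R (insert t K)"
    if "insert t K \<subseteq> carrier R" "t \<noteq> \<zero>" for t
  proof (rule generate_field_min_subfield1)
    show "insert (inv t) K \<subseteq> carrier R" using that by simp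
    show "subfield (generate_field R (insert t K)) R" by (rule generate_field_is_subfield[OF that(1)])
    show "insert (inv t) K \<subseteq> generate_field R (insert t K)"
      using that by (auto intro: generate_field.intros)
  qed
  show ?thesis using *[of s] *[of "inv s"] assms nonzero_inv[of s] by auto
qed

end

section \<open>Finiteness of the quotient by an element\<close>

lemma (in ring) combine_map_split:
  assumes "x \<in> carrier R" "length bs = length Us" "set Us \<subseteq> carrier R"
    and "\<And>b. b \<in> set bs \<Longrightarrow> g b \<in> carrier R \<and> c b \<in> carrier R \<and> b = x \<otimes> g b \<oplus> c b"
  shows "combine bs Us = x \<otimes> combine (map g bs) Us \<oplus> combine (map c bs) Us"
  using assms(2-)
proof (induction bs Us rule: list_induct2)
  case Nil
  then show ?case using assms(1) by simp
next
  case (Cons b bs u Us)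
  have *: "set (map g bs) \<subseteq> carrier R" "set (map c bs) \<subseteq> carrier R" using Cons.prems by auto
  have cc: "g b \<in> carrier R" "c b \<in> carrier R" "u \<in> carrier R"
    "combine (map g bs) Us \<in> carrier R" "combine (map c bs) Us \<in> carrier R"
    using Cons.prems combine_in_carrier[OF *(1)] combine_in_carrier[OF *(2)] by auto
  have "combine (b # bs) (u # Us) =
      (x \<otimes> g b \<oplus> c b) \<otimes> u \<oplus> (x \<otimes> combine (map g bs) Us \<oplus> combine (map c bs) Us)"
    using Cons by simp
  also have "\<dots> = x \<otimes> (g b \<otimes> u \<oplus> combine (map g bs) Us) \<oplus> (c b \<otimes> u \<oplus> combine (map c bs) Us)"
    using cc assms(1) by algebra
  finally show ?case by simp
qed

context valuation_subring
begin

lemma combine_in_V: "set cs \<subseteq> V \<Longrightarrow> set Us \<subseteq> V \<Longrightarrow> combine cs Us \<in> V"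
proof (induction cs Us rule: combine.induct)
  case (1 k Ks u Us)
  then show ?case by auto
qed auto

lemma divides_const_term_in_V:
  assumes "subring A F" "A \<subseteq> V" "rank_le A d" "y \<in> V" "y \<noteq> \<zero>"
  shows "\<exists>b\<in>A. b \<noteq> \<zero> \<and> (\<exists>v\<in>V. b = y \<otimes> v)"
proof -
  obtain b cs where b: "b \<in> A" "b \<noteq> \<zero>" "set cs \<subseteq> A" "b = y \<otimes> eval cs y"
    using rank_le_integral_multiple[OF assms(1,3) V_carrier[OF assms(4)] assms(5)] by blast
  then have "eval cs y \<in> V" using eval_in_subring[OF subring _ assms(4), of cs] assms(2) by auto
  then show ?thesis using b by blast
qed

lemma M_nontrivial: "\<exists>y\<in>M. y \<noteq> \<zero>"
proof -
  obtain z where z: "z \<in> carrier F" "z \<notin> V" using proper by blast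
  then have nz: "z \<noteq> \<zero>" by auto
  then have "inv z \<in> V" using total z by blast
  then have "inv z \<in> M" using z nz nonzero_inv[OF z(1) nz] by (simp add: M_def)
  then show ?thesis using nonzero_inv(2)[OF z(1) nz] by blast
qed

text \<open>Isolates what the dimension argument modulo \<open>x\<close> needs to know about \<open>A\<close>. In the intended case \<open>A\<close> is a
  polynomial ring \<open>K[s]\<close>, \<open>x\<close> is the value of the polynomial of least degree that lies in the maximal
  ideal, and the representatives are the values of the polynomials of smaller degree.\<close>

definition residue_system :: "'a set \<Rightarrow> 'a \<Rightarrow> 'a set \<Rightarrow> bool"
  where "residue_system A x T \<longleftrightarrow> x \<in> M \<and> x \<in> A \<and> x \<noteq> \<zero> \<and> finite T \<and> T \<subseteq> A \<and> \<zero> \<in> T \<and>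
    (\<forall>r\<in>T. r \<in> M \<longrightarrow> r = \<zero>) \<and>
    (\<forall>a\<in>A. \<exists>b\<in>A. \<exists>r\<in>T. a = x \<otimes> b \<oplus> r) \<and>
    (\<forall>a\<in>A. a \<noteq> \<zero> \<longrightarrow> (\<exists>k::nat. \<exists>u\<in>V - M. a = x [^] k \<otimes> u))"

text \<open>Some nonzero element of \<open>A\<close> is a nonunit, because every nonzero nonunit has a nonzero multiple
  in \<open>A\<close>. Choose \<open>p \<noteq> []\<close> of least length such that \<open>p(s)\<close> is a nonunit. Division with remainder by \<open>p\<close>
  yields remainders that are units by minimality, and dividing repeatedly extracts the largest power
  of \<open>p(s)\<close> from a given element. The value \<open>p(s)\<close> cannot vanish, since then all of \<open>A\<close> would
  consist of remainders and contain no nonzero nonunit.\<close>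

lemma residue_system_exists:
  assumes K: "subfield K F" "finite K" "K \<subseteq> V" and s: "s \<in> V"
    and A: "A = (\<lambda>p. eval p s) ` carrier (K[X])" and "rank_le A d"
  shows "subring A F" "A \<subseteq> V" "\<exists>x T. residue_system A x T"
proof -
  note KR = subfieldE(1)[OF K(1)]
  note sF = V_carrier[OF s]
  have A_simple: "A = simple_extension K s"
    using simple_extension_as_eval_img[OF subfieldE(3)[OF K(1)] sF] A by simp
  show Asub: "subring A F"
    unfolding A_simple by (rule simple_extension_is_subring[OF KR sF])
  have polyK: "set p \<subseteq> K" if "p \<in> carrier (K[X])" for p
    using that polynomial_incl unfolding univ_poly_carrier[symmetric] by blast
  show AV: "A \<subseteq> V"
    using A polyK eval_in_subring[OF subring _ s] K(3) by blast
  interpret UP: domain "K[X]" by (rule univ_poly_is_domain[OF KR])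
  note hom = ring_hom_memE[OF eval_is_hom[OF KR sF]]
  have zA: "\<exists>b\<in>A. b \<noteq> \<zero> \<and> b \<in> M"
  proof -
    obtain y where y: "y \<in> M" "y \<noteq> \<zero>" using M_nontrivial by blast
    obtain b v where "b \<in> A" "b \<noteq> \<zero>" "v \<in> V" "b = y \<otimes> v"
      using divides_const_term_in_V[OF Asub AV assms(6) M_V[OF y(1)] y(2)] by blast
    then show ?thesis using M_mult(1)[OF y(1)] by blast
  qed
  define S where "S = {p \<in> carrier (K[X]). p \<noteq> [] \<and> eval p s \<in> M}"
  have "\<exists>p. p \<in> S"
  proof -
    obtain b where b: "b \<in> A" "b \<noteq> \<zero>" "b \<in> M" using zA by blast
    then obtain p where "p \<in> carrier (K[X])" "b = eval p s" using A by blast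
    moreover have "p \<noteq> []" using calculation b by auto
    ultimately show ?thesis using b unfolding S_def by blast
  qed
  then obtain p where p: "p \<in> S" and pmin: "\<And>p'. p' \<in> S \<Longrightarrow> length p \<le> length p'"
    using ex_has_least_nat[of "\<lambda>p. p \<in> S" _ length] by blast
  have pc: "p \<in> carrier (K[X])" "p \<noteq> []" "eval p s \<in> M" using p by (auto simp: S_def)
  define x where "x = eval p s"
  define L where "L = {r \<in> carrier (K[X]). length r < length p}"
  define T where "T = (\<lambda>r. eval r s) ` L"
  have T_unit: "eval r s \<notin> M" if "r \<in> L" "r \<noteq> []" for r
    using that pmin[of r] by (auto simp: L_def S_def)
  have div: "\<exists>q r. q \<in> carrier (K[X]) \<and> r \<in> L \<and> eval f s = x \<otimes> eval q s \<oplus> eval r s \<and>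
      f = p \<otimes>\<^bsub>K[X]\<^esub> q \<oplus>\<^bsub>K[X]\<^esub> r" if f: "f \<in> carrier (K[X])" for f
  proof -
    obtain q r where q: "q \<in> carrier (K[X])" "r \<in> carrier (K[X])"
        "f = p \<otimes>\<^bsub>K[X]\<^esub> q \<oplus>\<^bsub>K[X]\<^esub> r" "r = [] \<or> degree r < degree p"
      using subfield_long_division_theorem_shell[OF K(1) f, of p] pc
      by (auto simp: univ_poly_zero)
    have "length r < length p" using q(4) pc(2) by (cases r; cases p) auto
    then have "r \<in> L" using q(2) by (simp add: L_def)
    moreover have "eval f s = x \<otimes> eval q s \<oplus> eval r s"
      using hom(2)[OF pc(1) q(1)] hom(3)[OF UP.m_closed[OF pc(1) q(1)] q(2)] q(3) by (simp add: x_def)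
    ultimately show ?thesis using q by blast
  qed
  have xM: "x \<in> M" using pc by (simp add: x_def)
  have AT: "a \<in> A \<Longrightarrow> \<exists>b\<in>A. \<exists>r\<in>T. a = x \<otimes> b \<oplus> r" for a
    using div unfolding A T_def by blast
  have x0: "x \<noteq> \<zero>"
  proof
    assume "x = \<zero>"
    obtain b where b: "b \<in> A" "b \<noteq> \<zero>" "b \<in> M" using zA by blast
    then obtain f where f: "f \<in> carrier (K[X])" "b = eval f s" using A by blast
    obtain q r where "q \<in> carrier (K[X])" "r \<in> L" "eval f s = x \<otimes> eval q s \<oplus> eval r s"
      using div[OF f(1)] by blast
    then have r: "r \<in> L" "b = eval r s"
      using \<open>x = \<zero>\<close> f hom(1) by (auto simp: L_def)
    then show False using T_unit[of r] b by (cases "r = []") auto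
  qed
  \<comment> \<open>\<open>p\<close> is not constant, since nonzero constants are units; this makes the degree drop below.\<close>
  have deg: "length p \<ge> 2"
  proof (rule ccontr)
    assume "\<not> length p \<ge> 2"
    then obtain c where c: "p = [c]" using pc(2) by (cases p; cases "tl p") auto
    then have "c \<in> K" using polyK[OF pc(1)] by simp
    then have cF: "c \<in> carrier F" "c = x" using subringE(1)[OF KR] c by (auto simp: x_def)
    then have "inv c \<in> K" using subfield_m_inv(1)[OF K(1), of c] x0 \<open>c \<in> K\<close> by simp
    then have "inv x \<in> V" using cF K(3) by auto
    then show False using xM x0 by (simp add: M_def)
  qed
  have factor: "\<exists>k::nat. \<exists>u\<in>V - M. eval f s = x [^] k \<otimes> u"
    if "f \<in> carrier (K[X])" "eval f s \<noteq> \<zero>" for f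
    using that
  proof (induction "length f" arbitrary: f rule: less_induct)
    case less
    obtain q r where q: "q \<in> carrier (K[X])" "r \<in> L" "eval f s = x \<otimes> eval q s \<oplus> eval r s"
        "f = p \<otimes>\<^bsub>K[X]\<^esub> q \<oplus>\<^bsub>K[X]\<^esub> r"
      using div[OF less.prems(1)] by blast
    have qV: "eval q s \<in> V" using q(1) AV A by blast
    have rV: "eval r s \<in> V" using q(2) AV A by (auto simp: L_def)
    show ?case
    proof (cases "r = []")
      case False
      have "x \<otimes> eval q s \<in> M" using M_mult(1)[OF xM qV] .
      then have "eval f s \<notin> M" using add_notin_M[OF _ rV T_unit[OF q(2) False]] q(3) by simp
      moreover have "eval f s \<in> V" using less.prems AV A by blast
      ultimately show ?thesis by (intro exI[of _ 0] bexI[of _ "eval f s"]) auto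
    next
      case True
      have f: "eval f s = x \<otimes> eval q s" using q(3) True qV M_carrier[OF xM] by simp
      then have "eval q s \<noteq> \<zero>" using less.prems M_carrier[OF xM] by auto
      then have "q \<noteq> []" by auto
      have "f = p \<otimes>\<^bsub>K[X]\<^esub> q"
        using q(4) True UP.r_zero[OF UP.m_closed[OF pc(1) q(1)]] by (simp add: univ_poly_zero)
      then have "f = poly_mult p q" by (simp add: univ_poly_mult)
      then have "degree f = degree p + degree q"
        using poly_mult_degree_eq[OF KR, of p q] pc q(1) \<open>q \<noteq> []\<close> by (simp add: univ_poly_carrier)
      then have "length q < length f" using deg \<open>q \<noteq> []\<close> by (cases q) auto
      then obtain k :: nat and u where ku: "u \<in> V - M" "eval q s = x [^] k \<otimes> u"
        using less.hyps[OF _ q(1) \<open>eval q s \<noteq> \<zero>\<close>] by blast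
      then have "eval f s = x [^] Suc k \<otimes> u"
        using f M_carrier[OF xM] by (simp add: m_ac)
      then show ?thesis using ku by blast
    qed
  qed
  have "finite L"
  proof (rule finite_subset)
    show "L \<subseteq> {r. set r \<subseteq> K \<and> length r \<le> length p}" using polyK by (auto simp: L_def)
    show "finite {r. set r \<subseteq> K \<and> length r \<le> length p}" by (rule finite_lists_length_le[OF K(2)])
  qed
  then have "finite T" by (simp add: T_def)
  moreover have "T \<subseteq> A" using A by (auto simp: T_def L_def)
  moreover have "\<zero> \<in> T"
  proof -
    have "[] \<in> L" using pc(2) by (auto simp: L_def univ_poly_zero_closed)
    then show ?thesis unfolding T_def by force
  qed
  moreover have "r = \<zero>" if "r \<in> T" "r \<in> M" for r
    using that T_unit unfolding T_def by force
  moreover have "x \<in> A" using A pc by (auto simp: x_def)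
  moreover have "\<exists>k::nat. \<exists>u\<in>V - M. a = x [^] k \<otimes> u" if "a \<in> A" "a \<noteq> \<zero>" for a
    using factor that A by blast
  ultimately have "residue_system A x T"
    using xM x0 AT unfolding residue_system_def by blast
  then show "\<exists>x T. residue_system A x T" by blast
qed

end

context valuation_subring
begin

text \<open>The coefficients are restricted to representatives \<open>T\<close> as in a residue system: these are finite
  in number, and a nonzero one is a unit.\<close>

definition free_mod :: "'a \<Rightarrow> 'a set \<Rightarrow> 'a list \<Rightarrow> bool"
  where "free_mod x T Us \<longleftrightarrow> set Us \<subseteq> V \<and>
    (\<forall>cs. set cs \<subseteq> T \<longrightarrow> length cs = length Us \<longrightarrow> (\<exists>v\<in>V. combine cs Us = x \<otimes> v) \<longrightarrow> set cs \<subseteq> {\<zero>})"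

text \<open>As long as all coefficients of a relation are nonunits, they are all divisible by \<open>x\<close> within
  \<open>A\<close> and the relation can be divided by \<open>x\<close>. The power of \<open>x\<close> in one fixed nonzero coefficient
  bounds the number of such steps.\<close>

lemma primitive_relation:
  assumes "residue_system A x T" "A \<subseteq> V" "set Us \<subseteq> V"
    and "length as = length Us" "set as \<subseteq> A" "combine as Us = \<zero>"
    and "a \<in> set as" "a = x [^] (k::nat) \<otimes> u" "u \<in> V - M"
  shows "\<exists>bs. length bs = length Us \<and> set bs \<subseteq> A \<and> combine bs Us = \<zero> \<and> \<not> set bs \<subseteq> M"
  using assms(4-)
proof (induction k arbitrary: as a)
  case 0
  then have "a \<notin> M" by simp
  then show ?case using 0 by blast
next
  case (Suc k)
  have x: "x \<in> M" "x \<noteq> \<zero>" "x \<in> carrier F" and T: "\<And>r. r \<in> T \<Longrightarrow> r \<in> M \<Longrightarrow> r = \<zero>" "T \<subseteq> A"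
    and div: "\<And>a. a \<in> A \<Longrightarrow> \<exists>b\<in>A. \<exists>r\<in>T. a = x \<otimes> b \<oplus> r"
    using assms(1) M_carrier unfolding residue_system_def by blast+
  show ?case
  proof (cases "set as \<subseteq> M")
    case False
    then show ?thesis using Suc.prems by blast
  next
    case True
    have "\<exists>b\<in>A. c = x \<otimes> b" if c: "c \<in> set as" for c
    proof -
      obtain b r where b: "b \<in> A" "r \<in> T" "c = x \<otimes> b \<oplus> r" using div c Suc.prems(2) by blast
      have bV: "b \<in> V" "r \<in> V" using b T assms(2) by auto
      have xb: "x \<otimes> b \<in> M" using M_mult(1)[OF x(1) bV(1)] .
      have "r \<in> M" using add_notin_M[OF xb bV(2)] b(3) c True by auto
      then have "r = \<zero>" using T b by blast
      then show ?thesis using b M_carrier[OF xb] by auto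
    qed
    then obtain g where g: "\<And>c. c \<in> set as \<Longrightarrow> g c \<in> A \<and> c = x \<otimes> g c" by metis
    have gF: "g c \<in> carrier F" if "c \<in> set as" for c using g[OF that] assms(2) by auto
    have UF: "set Us \<subseteq> carrier F" using assms(3) by auto
    have gsF: "set (map g as) \<subseteq> carrier F" using gF by auto
    have "as = map ((\<otimes>) x) (map g as)" using g by (induction as) auto
    then have "x \<otimes> combine (map g as) Us = \<zero>"
      using combine_r_distr[OF gsF UF x(3)] Suc.prems(3) by metis
    then have comb: "combine (map g as) Us = \<zero>"
      using combine_in_carrier[OF gsF UF] x by (simp add: integral_iff)
    have "x \<otimes> g a = x \<otimes> (x [^] k \<otimes> u)"
      using g[OF Suc.prems(4)] Suc.prems(5,6) x(3) by (simp add: m_ac)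
    then have "g a = x [^] k \<otimes> u"
      using l_cancel_field[OF x(3,2) gF[OF Suc.prems(4)]] Suc.prems(6) x(3) by simp
    moreover have "length (map g as) = length Us" "set (map g as) \<subseteq> A" "g a \<in> set (map g as)"
      using Suc.prems(1,4) g by auto
    ultimately show ?thesis using Suc.IH comb Suc.prems(6) by blast
  qed
qed

text \<open>A longer list satisfies a relation over \<open>A\<close>, which may be chosen with a unit among its
  coefficients. Reducing these modulo \<open>x\<close> gives a nontrivial relation with coefficients in \<open>T\<close>.\<close>

lemma free_mod_length:
  assumes rs: "residue_system A x T" and A: "A \<subseteq> V" "rank_le A d" and fr: "free_mod x T Us"
  shows "length Us \<le> d"
proof (rule ccontr)
  assume "\<not> length Us \<le> d"
  have x: "x \<in> M" "x \<noteq> \<zero>" "x \<in> carrier F" and T: "T \<subseteq> A"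
    and div: "\<And>a. a \<in> A \<Longrightarrow> \<exists>b\<in>A. \<exists>r\<in>T. a = x \<otimes> b \<oplus> r"
    and fac: "\<And>a. a \<in> A \<Longrightarrow> a \<noteq> \<zero> \<Longrightarrow> \<exists>k::nat. \<exists>u\<in>V - M. a = x [^] k \<otimes> u"
    using rs M_carrier unfolding residue_system_def by blast+
  have U: "set Us \<subseteq> V" using fr by (simp add: free_mod_def)
  then have UF: "set Us \<subseteq> carrier F" by auto
  obtain as where as: "length as = length Us" "set as \<subseteq> A" "\<not> set as \<subseteq> {\<zero>}" "combine as Us = \<zero>"
    using A(2) UF \<open>\<not> length Us \<le> d\<close> unfolding rank_le_def by (metis not_le)
  then obtain a where a: "a \<in> set as" "a \<noteq> \<zero>" by blast
  obtain k :: nat and u where "u \<in> V - M" "a = x [^] k \<otimes> u" using fac a as(2) by blast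
  then obtain bs where bs: "length bs = length Us" "set bs \<subseteq> A" "combine bs Us = \<zero>" "\<not> set bs \<subseteq> M"
    using primitive_relation[OF rs A(1) U as(1,2,4) a(1)] by blast
  have "\<forall>b\<in>set bs. \<exists>p. fst p \<in> A \<and> snd p \<in> T \<and> b = x \<otimes> fst p \<oplus> snd p"
    using div bs(2) by (metis fst_conv snd_conv subsetD)
  then obtain p where p: "\<And>b. b \<in> set bs \<Longrightarrow> fst (p b) \<in> A \<and> snd (p b) \<in> T \<and> b = x \<otimes> fst (p b) \<oplus> snd (p b)"
    by metis
  define g c where "g = fst \<circ> p" and "c = snd \<circ> p"
  have gc: "g b \<in> A" "c b \<in> T" "b = x \<otimes> g b \<oplus> c b" if "b \<in> set bs" for b
    using p[OF that] by (auto simp: g_def c_def)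
  have gcV: "g b \<in> V" "c b \<in> V" if "b \<in> set bs" for b using gc[OF that] T A by auto
  have "combine bs Us = x \<otimes> combine (map g bs) Us \<oplus> combine (map c bs) Us"
  proof (rule combine_map_split[OF x(3) bs(1) UF])
    fix b assume b: "b \<in> set bs"
    show "g b \<in> carrier F \<and> c b \<in> carrier F \<and> b = x \<otimes> g b \<oplus> c b"
      using gcV[OF b] by (intro conjI gc(3)[OF b]) simp_all
  qed
  moreover have gV: "combine (map g bs) Us \<in> V" by (rule combine_in_V) (use gcV U in auto)
  moreover have cV: "combine (map c bs) Us \<in> V" by (rule combine_in_V) (use gcV U in auto)
  ultimately have "combine (map c bs) Us = x \<otimes> (\<ominus> combine (map g bs) Us)"
    using bs(3) x(3) minus_equality[of "combine (map c bs) Us" "x \<otimes> combine (map g bs) Us"]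
    by (simp add: r_minus a_comm)
  then have "\<exists>v\<in>V. combine (map c bs) Us = x \<otimes> v"
    using V_closed(3)[OF gV] by blast
  moreover have "set (map c bs) \<subseteq> T" "length (map c bs) = length Us" using gc bs(1) by auto
  ultimately have c0: "set (map c bs) \<subseteq> {\<zero>}" using fr unfolding free_mod_def by blast
  have "b \<in> M" if b: "b \<in> set bs" for b
  proof -
    have "c b = \<zero>" using c0 b by auto
    moreover have "x \<otimes> g b \<in> M" using M_mult(1)[OF x(1) gcV(1)[OF b]] .
    ultimately show ?thesis using gc(3)[OF b] M_carrier by simp
  qed
  then show False using bs(4) by blast
qed

text \<open>Finiteness of the quotient of the valuation ring by \<open>x\<close>, expressed without forming the
  quotient ring.\<close>

definition covers_mod :: "'a \<Rightarrow> 'a set \<Rightarrow> bool"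
  where "covers_mod x S \<longleftrightarrow> finite S \<and> S \<subseteq> V \<and> (\<forall>y\<in>V. \<exists>s\<in>S. \<exists>v\<in>V. y = s \<oplus> x \<otimes> v)"

text \<open>Take a list that is free modulo \<open>x\<close> and of maximal length. Any further element satisfies a
  relation with it in which its own coefficient is a unit, so it is determined modulo \<open>x\<close> by the
  finitely many possible coefficients.\<close>

lemma finite_cover_exists:
  assumes rs: "residue_system A x T" and A: "A \<subseteq> V" "rank_le A d"
  shows "\<exists>S. covers_mod x S"
proof -
  have x: "x \<in> M" "x \<noteq> \<zero>" "x \<in> carrier F" and T: "T \<subseteq> A" "finite T" "\<zero> \<in> T"
    and Tu: "\<And>r. r \<in> T \<Longrightarrow> r \<in> M \<Longrightarrow> r = \<zero>"
    using rs M_carrier unfolding residue_system_def by blast+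
  have nil: "free_mod x T []" by (simp add: free_mod_def)
  have "\<forall>Us. free_mod x T Us \<longrightarrow> length Us < Suc d" using free_mod_length[OF rs A] by (simp add: less_Suc_eq_le)
  then obtain Us where Us: "free_mod x T Us" and max: "\<And>Us'. free_mod x T Us' \<Longrightarrow> length Us' \<le> length Us"
    using ex_has_greatest_nat[of "free_mod x T", OF nil, of length "Suc d"] by blast
  have U: "set Us \<subseteq> V" using Us by (simp add: free_mod_def)
  define S where "S = (\<lambda>(c, cs). \<ominus> (inv c \<otimes> combine cs Us)) ` ((T - {\<zero>}) \<times> {cs. set cs \<subseteq> T \<and> length cs = length Us})"
  have "finite S" unfolding S_def using T(2) finite_lists_length_eq[OF T(2)] by blast
  moreover have invT: "inv c \<in> V" "c \<in> V" "c \<noteq> \<zero>" if "c \<in> T - {\<zero>}" for c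
  proof -
    show "c \<in> V" using that T A by auto
    then show "inv c \<in> V" using that Tu unit_inv(1)[of c] by blast
    show "c \<noteq> \<zero>" using that by simp
  qed
  have comb: "combine cs Us \<in> V" if "set cs \<subseteq> T" for cs
    by (rule combine_in_V[OF _ U]) (use that T A in auto)
  have "S \<subseteq> V"
  proof
    fix s assume "s \<in> S"
    then obtain c cs where c: "c \<in> T - {\<zero>}" "set cs \<subseteq> T" "s = \<ominus> (inv c \<otimes> combine cs Us)"
      unfolding S_def by auto
    then show "s \<in> V" using invT(1)[OF c(1)] comb[OF c(2)] by simp
  qed
  moreover have "\<exists>s\<in>S. \<exists>v\<in>V. y = s \<oplus> x \<otimes> v" if y: "y \<in> V" for y
  proof -
    have "\<not> free_mod x T (y # Us)" using max[of "y # Us"] by auto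
    then obtain cs v where cs: "set cs \<subseteq> T" "length cs = Suc (length Us)" "v \<in> V"
        "combine cs (y # Us) = x \<otimes> v" "\<not> set cs \<subseteq> {\<zero>}"
      using U y by (auto simp: free_mod_def)
    then obtain c cs' where cs': "cs = c # cs'" by (cases cs) auto
    have len: "length cs' = length Us" "set cs' \<subseteq> T" "c \<in> T" using cs cs' by auto
    have cV: "combine cs' Us \<in> V" using comb len by simp
    have cVF: "combine cs' Us \<in> carrier F" "v \<in> carrier F" "y \<in> carrier F" using cV cs(3) y by simp_all
    have eq: "c \<otimes> y \<oplus> combine cs' Us = x \<otimes> v" using cs(4) cs' by simp
    have "c \<noteq> \<zero>"
    proof
      assume c: "c = \<zero>"
      then have "combine cs' Us = x \<otimes> v" using eq cVF by simp
      then have "set cs' \<subseteq> {\<zero>}" using Us len cs(3) unfolding free_mod_def by blast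
      then show False using cs(5) cs' c by simp
    qed
    then have c: "c \<in> T - {\<zero>}" using len by simp
    note ic = invT[OF c]
    have icF: "inv c \<in> carrier F" "c \<in> carrier F" using ic by simp_all
    have "inv c \<otimes> (c \<otimes> y \<oplus> combine cs' Us) = (inv c \<otimes> c) \<otimes> y \<oplus> inv c \<otimes> combine cs' Us"
      using icF cVF by algebra
    then have "y \<oplus> inv c \<otimes> combine cs' Us = inv c \<otimes> (x \<otimes> v)"
      using eq ic(3) icF(2) cVF by simp
    then have "(y \<oplus> inv c \<otimes> combine cs' Us) \<oplus> \<ominus> (inv c \<otimes> combine cs' Us) =
        inv c \<otimes> (x \<otimes> v) \<oplus> \<ominus> (inv c \<otimes> combine cs' Us)" by simp
    moreover have "(y \<oplus> inv c \<otimes> combine cs' Us) \<oplus> \<ominus> (inv c \<otimes> combine cs' Us) = y"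
      using icF cVF by algebra
    moreover have "inv c \<otimes> (x \<otimes> v) \<oplus> \<ominus> (inv c \<otimes> combine cs' Us) =
        \<ominus> (inv c \<otimes> combine cs' Us) \<oplus> x \<otimes> (inv c \<otimes> v)"
      using icF cVF x(3) by algebra
    ultimately have "y = \<ominus> (inv c \<otimes> combine cs' Us) \<oplus> x \<otimes> (inv c \<otimes> v)" by simp
    moreover have "\<ominus> (inv c \<otimes> combine cs' Us) \<in> S"
      unfolding S_def using c len by (intro image_eqI[of _ _ "(c, cs')"]) auto
    moreover have "inv c \<otimes> v \<in> V" using ic(1) cs(3) by simp
    ultimately show ?thesis by blast
  qed
  ultimately show ?thesis unfolding covers_mod_def by blast
qed

text \<open>A nonzero multiple of \<open>y\<close> in \<open>A\<close> is a power of \<open>x\<close> times a unit, which bounds the powers of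
  \<open>x\<close> dividing \<open>y\<close>.\<close>

lemma no_infinite_divisibility:
  assumes rs: "residue_system A x T" and A: "subring A F" "A \<subseteq> V" "rank_le A d"
    and y: "y \<in> V" "y \<noteq> \<zero>"
  shows "\<exists>k::nat. \<forall>v\<in>V. y \<noteq> x [^] k \<otimes> v"
proof -
  have x: "x \<in> M" "x \<noteq> \<zero>" "x \<in> carrier F"
    and fac: "\<And>a. a \<in> A \<Longrightarrow> a \<noteq> \<zero> \<Longrightarrow> \<exists>k::nat. \<exists>u\<in>V - M. a = x [^] k \<otimes> u"
    using rs M_carrier unfolding residue_system_def by blast+
  obtain b w where b: "b \<in> A" "b \<noteq> \<zero>" "w \<in> V" "b = y \<otimes> w"
    using divides_const_term_in_V[OF A y] by blast
  obtain k :: nat and u where u: "u \<in> V - M" "b = x [^] k \<otimes> u" using fac b by blast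
  have "y \<noteq> x [^] Suc k \<otimes> v" if v: "v \<in> V" for v
  proof
    assume "y = x [^] Suc k \<otimes> v"
    then have "x [^] k \<otimes> u = (x [^] k \<otimes> x) \<otimes> v \<otimes> w" using u b by simp
    also have "\<dots> = x [^] k \<otimes> (x \<otimes> (v \<otimes> w))"
      using x(3) v b(3) nat_pow_closed[OF x(3), of k] by (simp add: m_assoc)
    finally have eq: "x [^] k \<otimes> u = x [^] k \<otimes> (x \<otimes> (v \<otimes> w))" .
    have "u = x \<otimes> (v \<otimes> w)"
      by (rule l_cancel_field[OF _ _ _ _ eq]) (use x(2,3) u(1) v b(3) in simp_all)
    moreover have "x \<otimes> (v \<otimes> w) \<in> M" using M_mult(1)[OF x(1)] v b(3) by simp
    ultimately show False using u by simp
  qed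
  then show ?thesis by blast
qed

text \<open>Besides generating the maximal ideal, a uniformizer is required to factor all nonzero ring
  elements; this is what makes the valuation integer-valued.\<close>

definition uniformizer :: "'a \<Rightarrow> bool"
  where "uniformizer t \<longleftrightarrow> t \<in> M \<and> t \<noteq> \<zero> \<and> (\<forall>y\<in>M. \<exists>v\<in>V. y = t \<otimes> v) \<and>
    (\<forall>y\<in>V. y \<noteq> \<zero> \<longrightarrow> (\<exists>k::nat. \<exists>u\<in>V - M. y = t [^] k \<otimes> u))"

text \<open>An ideal between \<open>x\<close> and the ring is determined by its members among the finitely many
  representatives \<open>S\<close>, so a principal ideal generated by a nonunit and containing \<open>x\<close> can be chosen
  with as many of them as possible. As ideals form a chain, it contains every nonunit. Two powers of its
  generator \<open>t\<close> have the same representative; their difference is a power of \<open>t\<close> times a unit, so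
  \<open>x\<close> divides a power of \<open>t\<close>. Hence a nonzero element divisible by all powers of \<open>t\<close> would be
  divisible by all powers of \<open>x\<close>.\<close>

lemma uniformizer_exists:
  assumes x: "x \<in> M" "x \<noteq> \<zero>" and S: "covers_mod x S"
    and sep: "\<And>y. y \<in> V \<Longrightarrow> y \<noteq> \<zero> \<Longrightarrow> \<exists>k::nat. \<forall>v\<in>V. y \<noteq> x [^] k \<otimes> v"
  shows "\<exists>t. uniformizer t"
proof -
  have xF: "x \<in> carrier F" using x M_carrier by simp
  have fS: "finite S" "S \<subseteq> V" "\<And>y. y \<in> V \<Longrightarrow> \<exists>s\<in>S. \<exists>v\<in>V. y = s \<oplus> x \<otimes> v"
    using S by (auto simp: covers_mod_def)
  define mul where "mul y = {y \<otimes> v | v. v \<in> V}" for y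
  have mulI: "v \<in> V \<Longrightarrow> y \<otimes> v \<in> mul y" for y v by (auto simp: mul_def)
  have mul_minus: "a \<ominus> b \<in> mul y" if h: "a \<in> mul y" "b \<in> mul y" "y \<in> carrier F" for a b y
  proof -
    obtain v w where v: "v \<in> V" "w \<in> V" "a = y \<otimes> v" "b = y \<otimes> w" using h unfolding mul_def by blast
    have "a \<ominus> b = y \<otimes> (v \<ominus> w)" using v h(3) V_carrier[of v] V_carrier[of w] by algebra
    then show ?thesis using mulI[of "v \<ominus> w" y] v by simp
  qed
  have mul_add: "a \<oplus> b \<in> mul y" if h: "a \<in> mul y" "b \<in> mul y" "y \<in> carrier F" for a b y
  proof -
    obtain v w where v: "v \<in> V" "w \<in> V" "a = y \<otimes> v" "b = y \<otimes> w" using h unfolding mul_def by blast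
    have "a \<oplus> b = y \<otimes> (v \<oplus> w)" using v h(3) by (simp add: r_distr)
    then show ?thesis using mulI[of "v \<oplus> w" y] v by simp
  qed
  have mul_trans: "a \<otimes> v \<in> mul y" if h: "a \<in> mul y" "v \<in> V" "y \<in> carrier F" for a v y
  proof -
    obtain w where w: "w \<in> V" "a = y \<otimes> w" using h unfolding mul_def by blast
    then have "a \<otimes> v = y \<otimes> (w \<otimes> v)" using h by (simp add: m_assoc)
    then show ?thesis using mulI[of "w \<otimes> v" y] w h by simp
  qed
  \<comment> \<open>the generators of proper principal ideals that contain \<open>x\<close>\<close>
  define Y where "Y = {y \<in> M. y \<noteq> \<zero> \<and> x \<in> mul y}"
  have xY: "x \<in> Y" using x xF mulI[of \<one> x] by (simp add: Y_def)
  have "\<forall>y. y \<in> Y \<longrightarrow> card (S \<inter> mul y) < Suc (card S)"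
    using fS(1) by (simp add: card_mono less_Suc_eq_le)
  then obtain t where t: "t \<in> Y" "\<And>y. y \<in> Y \<Longrightarrow> card (S \<inter> mul y) \<le> card (S \<inter> mul t)"
    using ex_has_greatest_nat[of "\<lambda>y. y \<in> Y", OF xY, of "\<lambda>y. card (S \<inter> mul y)" "Suc (card S)"] by blast
  have tM: "t \<in> M" "t \<noteq> \<zero>" "x \<in> mul t" "t \<in> carrier F" using t(1) M_carrier by (auto simp: Y_def)
  have principal: "\<exists>v\<in>V. y = t \<otimes> v" if y: "y \<in> M" for y
  proof (rule ccontr)
    assume no: "\<not> (\<exists>v\<in>V. y = t \<otimes> v)"
    have y0: "y \<noteq> \<zero>" using no tM(4) by (metis V_closed(1) r_null)
    have yF: "y \<in> carrier F" using y M_carrier by simp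
    obtain w where w: "w \<in> M" "t = y \<otimes> w" using divides_total[OF yF tM(4,2) y0] no by blast
    have ty: "t \<in> mul y" using w mulI[of w y] M_V by simp
    have sub: "mul t \<subseteq> mul y" using mul_trans[OF ty _ yF] by (auto simp: mul_def)
    then have "y \<in> Y" using y y0 tM by (auto simp: Y_def)
    then have "card (S \<inter> mul y) \<le> card (S \<inter> mul t)" using t(2) by simp
    moreover have "S \<inter> mul t \<subseteq> S \<inter> mul y" "finite (S \<inter> mul y)" using sub fS by auto
    ultimately have Seq: "S \<inter> mul t = S \<inter> mul y" by (metis card_seteq)
    obtain s v where s: "s \<in> S" "v \<in> V" "y = s \<oplus> x \<otimes> v" using fS(3) M_V[OF y] by blast
    have sF: "s \<in> carrier F" "v \<in> carrier F" using s fS by auto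
    have xv: "x \<otimes> v \<in> mul t" using mul_trans[OF tM(3) s(2) tM(4)] .
    have "y \<in> mul y" using mulI[of \<one> y] yF by simp
    then have "y \<ominus> x \<otimes> v \<in> mul y" using mul_minus[OF _ _ yF] xv sub by blast
    moreover have "y \<ominus> x \<otimes> v = s" using s(3) sF xF by algebra
    ultimately have "s \<in> mul t" using s(1) Seq by auto
    then have "y \<in> mul t" using mul_add[OF _ xv tM(4)] s(3) by simp
    then show False using no by (auto simp: mul_def)
  qed
  \<comment> \<open>Pigeonhole: two powers of \<open>t\<close> have the same representative modulo \<open>x\<close>.\<close>
  obtain m :: nat and z where z: "z \<in> V" "t [^] m = x \<otimes> z"
  proof -
    have "\<exists>s. s \<in> S \<and> (\<exists>v\<in>V. t [^] k = s \<oplus> x \<otimes> v)" for k :: nat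
      using fS(3)[of "t [^] k"] tM M_V by auto
    then obtain r where r: "\<And>k::nat. r k \<in> S \<and> (\<exists>v\<in>V. t [^] k = r k \<oplus> x \<otimes> v)" by metis
    have "\<not> inj r" using fS(1) r by (metis finite_subset image_subsetI infinite_UNIV_nat finite_imageD)
    then obtain i j where ij: "r i = r j" "i < j" unfolding inj_def by (metis linorder_neqE_nat)
    obtain v w where v: "v \<in> V" "t [^] i = r i \<oplus> x \<otimes> v" "w \<in> V" "t [^] j = r i \<oplus> x \<otimes> w"
      using r[of i] r[of j] ij by auto
    have F: "v \<in> carrier F" "w \<in> carrier F" "r i \<in> carrier F" using v r[of i] fS(2) by auto
    have diff: "t [^] i \<ominus> t [^] j = x \<otimes> (v \<ominus> w)" unfolding v(2,4) using F xF by algebra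
    have "t [^] j = t [^] i \<otimes> t [^] (j - i)" using ij(2) tM(4) by (simp add: nat_pow_mult)
    then have fac: "t [^] i \<otimes> (\<one> \<ominus> t [^] (j - i)) = x \<otimes> (v \<ominus> w)"
      using diff tM(4) nat_pow_closed[OF tM(4), of i] nat_pow_closed[OF tM(4), of "j - i"] by algebra
    obtain l where l: "j - i = Suc l" using ij(2) by (metis Suc_diff_Suc)
    have tj: "t [^] (j - i) \<in> M" unfolding l using M_mult(2)[OF tM(1), of "t [^] l"] tM(1) M_V by simp
    define u where "u = \<one> \<ominus> t [^] (j - i)"
    have uV: "u \<in> V" using tj M_V by (simp add: u_def)
    have "\<ominus> (t [^] (j - i)) \<oplus> \<one> \<notin> M" using add_notin_M[OF M_uminus[OF tj]] by simp
    then have uM: "u \<notin> M" using tM(4) unfolding u_def a_minus_def by (simp add: a_comm)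
    have uF: "u \<in> carrier F" "inv u \<in> V" "u \<noteq> \<zero>" using unit_inv[OF uV uM] uV by simp_all
    have "t [^] i = (t [^] i \<otimes> u) \<otimes> inv u" using uF tM(4) by (simp add: m_assoc)
    also have "\<dots> = x \<otimes> ((v \<ominus> w) \<otimes> inv u)" using fac uF F xF by (simp add: u_def[symmetric] m_assoc)
    finally show thesis using that[of "(v \<ominus> w) \<otimes> inv u" i] v uF by simp
  qed
  have factor: "\<exists>k::nat. \<exists>u\<in>V - M. y = t [^] k \<otimes> u" if y: "y \<in> V" "y \<noteq> \<zero>" for y
  proof -
    have ex: "\<exists>k::nat. \<not> (\<exists>v\<in>V. y = t [^] k \<otimes> v)"
    proof (rule ccontr)
      assume "\<not> ?thesis"
      then have all: "\<exists>v\<in>V. y = t [^] (k::nat) \<otimes> v" for k by blast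
      obtain k :: nat where k: "\<forall>v\<in>V. y \<noteq> x [^] k \<otimes> v" using sep[OF y] by blast
      obtain v where v: "v \<in> V" "y = t [^] (m * k) \<otimes> v" using all by blast
      have "t [^] (m * k) = x [^] k \<otimes> z [^] k"
        using z xF tM(4) nat_pow_distrib[of x z k] by (simp add: nat_pow_pow[symmetric])
      then have "y = x [^] k \<otimes> (z [^] k \<otimes> v)" using v z xF by (simp add: m_assoc)
      moreover have "z [^] k \<otimes> v \<in> V" using z v by simp
      ultimately show False using k by blast
    qed
    define k where "k = (LEAST k::nat. \<not> (\<exists>v\<in>V. y = t [^] k \<otimes> v))"
    have k: "\<not> (\<exists>v\<in>V. y = t [^] k \<otimes> v)" using LeastI_ex[OF ex] by (simp add: k_def)
    have "k \<noteq> 0"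
    proof
      assume "k = 0"
      then have "y = t [^] k \<otimes> y" using y(1) by simp
      then show False using k y(1) by blast
    qed
    then obtain l where l: "k = Suc l" by (cases k) auto
    have "\<exists>v\<in>V. y = t [^] l \<otimes> v"
      using not_less_Least[of l "\<lambda>k. \<not> (\<exists>v\<in>V. y = t [^] k \<otimes> v)"] l unfolding k_def by auto
    then obtain v where v: "v \<in> V" "y = t [^] l \<otimes> v" by blast
    have "v \<notin> M"
    proof
      assume "v \<in> M"
      then obtain w where w: "w \<in> V" "v = t \<otimes> w" using principal by blast
      then have "y = t [^] k \<otimes> w" using v l tM(4) by (simp add: m_assoc)
      then show False using k w by blast
    qed
    then show ?thesis using v by blast
  qed
  show ?thesis unfolding uniformizer_def using tM principal factor by blast
qed

end

section \<open>Places and discrete valuations\<close>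

context field
begin

lemma int_pow_units_of:
  assumes "z \<in> Units R"
  shows "z [^]\<^bsub>units_of R\<^esub> (m::int) = z [^] m"
proof -
  interpret U: group "units_of R" by (rule units_group)
  have "z [^]\<^bsub>units_of R\<^esub> nat (- m) \<in> carrier (units_of R)"
    using assms by (intro U.nat_pow_closed) (simp add: units_of_carrier)
  then have "z [^] nat (- m) \<in> Units R" using units_of_pow[OF assms] by (simp add: units_of_carrier)
  then show ?thesis using units_of_pow[OF assms] units_of_inv by (simp add: int_pow_def2 del: pow_nat)
qed

lemma field_int_pow:
  assumes "z \<in> carrier R" "z \<noteq> \<zero>"
  shows "z [^] (m::int) \<in> carrier R" "z [^] m \<noteq> \<zero>" "z [^] (m + k) = z [^] m \<otimes> z [^] k"
    "z [^] (1::int) = z" "z [^] (int l) = z [^] l"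
proof -
  interpret U: group "units_of R" by (rule units_group)
  have zU: "z \<in> Units R" using assms field_Units by simp
  then have z: "z \<in> carrier (units_of R)" by (simp add: units_of_carrier)
  have "z [^] m \<in> Units R"
    using U.int_pow_closed[OF z, of m] int_pow_units_of[OF zU] by (simp add: units_of_carrier)
  then show "z [^] m \<in> carrier R" "z [^] m \<noteq> \<zero>" using field_Units by simp_all
  show "z [^] (m + k) = z [^] m \<otimes> z [^] k"
    using U.int_pow_mult[OF z, of m k] int_pow_units_of[OF zU] by (simp add: units_of_mult)
  show "z [^] (1::int) = z" using U.int_pow_1[OF z] int_pow_units_of[OF zU] by simp
  show "z [^] (int l) = z [^] l" by (rule int_pow_int)
qed

lemma field_int_pow_distrib:
  assumes "y \<in> carrier R" "y \<noteq> \<zero>" "z \<in> carrier R" "z \<noteq> \<zero>"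
  shows "(y \<otimes> z) [^] (m::int) = y [^] m \<otimes> z [^] m"
proof -
  interpret U: comm_group "units_of R" by (rule units_comm_group)
  have "y \<in> Units R" "z \<in> Units R" "y \<otimes> z \<in> Units R" using assms field_Units by (simp_all add: integral_iff)
  then show ?thesis
    using U.int_pow_distrib[of y z m] int_pow_units_of by (simp add: units_of_mult units_of_carrier)
qed

end

context valuation_subring
begin

lemma unit_int_pow: "u \<in> V - M \<Longrightarrow> u [^] (m::int) \<in> V - M"
  using pow_notin_M[of u "nat (- m)"] pow_notin_M[of u "nat m"]
    unit_inv[of "u [^] nat (- m)"] unit_inv_notin_M[of "u [^] nat (- m)"]
  by (auto simp: int_pow_def2 simp del: pow_nat)

lemma uniformizerD:
  assumes "uniformizer t"
  shows "t \<in> M" "t \<noteq> \<zero>" "t \<in> carrier F" "t \<in> V"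
  using assms M_V V_carrier by (auto simp: uniformizer_def)

lemma uniformizer_factor:
  assumes t: "uniformizer t" and y: "y \<in> carrier F" "y \<noteq> \<zero>"
  shows "\<exists>m::int. \<exists>u\<in>V - M. y = t [^] m \<otimes> u"
proof -
  note tD = uniformizerD[OF t]
  show ?thesis
  proof (cases "y \<in> V")
    case True
    then obtain k :: nat and u where "u \<in> V - M" "y = t [^] k \<otimes> u"
      using t y by (auto simp: uniformizer_def)
    then show ?thesis using field_int_pow(5)[OF tD(3,2), of k] by metis
  next
    case False
    then have "inv y \<in> V" "inv y \<noteq> \<zero>" using total[OF y] y by simp_all
    then obtain k :: nat and u where u: "u \<in> V - M" "inv y = t [^] k \<otimes> u"
      using t by (auto simp: uniformizer_def)
    have uF: "u \<in> carrier F" "u \<noteq> \<zero>" using u(1) unit_inv(2)[of u] by auto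
    have "y = inv (t [^] k \<otimes> u)" using u(2) y by (metis nonzero_inv(5))
    also have "\<dots> = inv (t [^] k) \<otimes> inv u" using inv_mult_field uF tD by simp
    also have "inv (t [^] k) = t [^] (- int k)"
      by (simp add: int_pow_def2 del: pow_nat)
    finally show ?thesis using u(1) unit_inv(1)[of u] unit_inv_notin_M[of u] by blast
  qed
qed

lemma uniformizer_pow_in_V:
  assumes t: "uniformizer t" and u: "u \<in> V - M"
  shows "t [^] (m::int) \<otimes> u \<in> V \<longleftrightarrow> 0 \<le> m" "t [^] m \<otimes> u \<in> M \<longleftrightarrow> 1 \<le> m"
proof -
  note tD = uniformizerD[OF t]
  have uF: "u \<in> carrier F" using u by simp
  have nonneg: "t [^] m \<otimes> u \<in> V" if "0 \<le> m" for m :: int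
    using that tD u by (simp add: int_pow_def2 del: pow_nat)
  have pos: "t [^] m \<otimes> u \<in> M" if m: "1 \<le> m" for m :: int
  proof -
    have "t [^] m = t [^] (m - 1) \<otimes> t" using field_int_pow(3)[OF tD(3,2), of "m - 1" 1] tD by (simp add: field_int_pow(4))
    then have "t [^] m \<otimes> u = t \<otimes> (t [^] (m - 1) \<otimes> u)"
      using field_int_pow(1)[OF tD(3,2)] tD(3) uF by (simp add: m_ac)
    then show ?thesis using M_mult(1)[OF tD(1) nonneg[of "m - 1"]] m by simp
  qed
  have neg: "t [^] m \<otimes> u \<notin> V" if m: "m < 0" for m :: int
  proof
    assume V: "t [^] m \<otimes> u \<in> V"
    have "(t [^] m \<otimes> u) \<otimes> (t [^] (- m) \<otimes> u) = t [^] (m + - m) \<otimes> (u \<otimes> u)"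
      unfolding field_int_pow(3)[OF tD(3,2)]
      using field_int_pow(1)[OF tD(3,2), of m] field_int_pow(1)[OF tD(3,2), of "- m"] uF by algebra
    also have "\<dots> = u \<otimes> u" using uF by simp
    finally have "u \<otimes> u \<in> M" using M_mult(2)[OF pos[of "- m"] V] m by simp
    then show False using mult_notin_M[of u u] u by blast
  qed
  have zero: "t [^] (0::int) \<otimes> u \<notin> M" using u uF by simp
  show "t [^] m \<otimes> u \<in> V \<longleftrightarrow> 0 \<le> m" using nonneg[of m] neg[of m] by linarith
  show "t [^] m \<otimes> u \<in> M \<longleftrightarrow> 1 \<le> m"
  proof
    assume "t [^] m \<otimes> u \<in> M"
    then have "\<not> m < 0" "m \<noteq> 0" using neg[of m] zero M_V by auto
    then show "1 \<le> m" by simp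
  qed (rule pos)
qed

text \<open>Otherwise a positive power of \<open>t\<close> times a unit would be a unit.\<close>

lemma order_unique:
  assumes t: "uniformizer t" and u: "u \<in> V - M" "w \<in> V - M"
    and eq: "t [^] (m::int) \<otimes> u = t [^] (k::int) \<otimes> w"
  shows "m = k"
proof -
  note tD = uniformizerD[OF t]
  have *: "m \<le> k" if "t [^] (m::int) \<otimes> u = t [^] (k::int) \<otimes> w" "u \<in> V - M" "w \<in> V - M" for m k u w
  proof -
    have F: "u \<in> carrier F" "w \<in> carrier F" using that by simp_all
    note P = field_int_pow(1)[OF tD(3,2)]
    have "t [^] (- m) \<otimes> (t [^] m \<otimes> u) = t [^] (- m + m) \<otimes> u"
      unfolding field_int_pow(3)[OF tD(3,2)] using P F by (simp add: m_assoc)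
    moreover have "t [^] (- m) \<otimes> (t [^] k \<otimes> w) = t [^] (- m + k) \<otimes> w"
      unfolding field_int_pow(3)[OF tD(3,2)] using P F by (simp add: m_assoc)
    ultimately have "t [^] (- m + k) \<otimes> w = u" using that(1) F by simp
    then have "0 \<le> - m + k" using uniformizer_pow_in_V(1)[OF t that(3), of "- m + k"] that(2) by simp
    then show ?thesis by simp
  qed
  show ?thesis using *[OF eq u] *[OF eq[symmetric] u(2,1)] by simp
qed

end

locale finite_function_field = field F for F (structure) +
  fixes K :: "'a set"
  assumes function_field: "function_field F K" and finite_K: "finite K"
begin

lemma K_subfield: "subfield K F"
  using function_field by (simp add: function_field_def)

lemma valuation_ring_imp:
  assumes "valuation_ring F K V"
  shows "valuation_subring F V" "K \<subseteq> V"
  using assms field_axioms unfolding valuation_ring_def valuation_subring_def valuation_subring_axioms_def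
  by auto

text \<open>Apply the finiteness argument to \<open>A = K[s]\<close>, where \<open>s\<close> lies in the valuation ring and the
  function field is finite over \<open>K(s)\<close>.\<close>

lemma valuation_ring_discrete:
  assumes V: "valuation_ring F K V"
  shows "\<exists>t S. valuation_subring.uniformizer F V t \<and> finite S \<and> S \<subseteq> V \<and> (\<forall>y\<in>V. \<exists>s\<in>S. y \<ominus> s \<in> valuation_subring.M F V)"
proof -
  interpret valuation_subring F V by (rule valuation_ring_imp[OF V])
  have KV: "K \<subseteq> V" by (rule valuation_ring_imp[OF V])
  obtain z where z: "z \<in> carrier F" "finite_dimension (generate_field F (insert z K)) (carrier F)"
    using function_field unfolding function_field_def by blast
  obtain s where s: "s \<in> V" "finite_dimension (generate_field F (insert s K)) (carrier F)"
  proof (cases "z \<in> V")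
    case True
    then show thesis using that z by blast
  next
    case False
    then have nz: "z \<noteq> \<zero>" by auto
    have "insert z K \<subseteq> carrier F" using z(1) KV by auto
    then show thesis
      using that[of "inv z"] total[OF z(1) nz] False z(2) generate_field_inv_generator[OF _ nz] by simp
  qed
  define A where "A = (\<lambda>p. eval p s) ` carrier (K[X])"
  have sF: "s \<in> carrier F" using s by simp
  have A_simple: "A = simple_extension K s"
    using simple_extension_as_eval_img[OF subfieldE(3)[OF K_subfield] sF] A_def by simp
  have Asub: "subring A F"
    unfolding A_simple by (rule simple_extension_is_subring[OF subfieldE(1)[OF K_subfield] sF])
  have "insert s K \<subseteq> A"
    unfolding A_simple using simple_extension_incl[OF subfieldE(3)[OF K_subfield] sF]
      simple_extension_mem[OF subfieldE(1)[OF K_subfield] sF] by simp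
  then obtain d where d: "rank_le A d"
    using finite_dimension_imp_rank_le[OF Asub _ s(2)] by blast
  obtain x T where rs: "residue_system A x T" and AV: "A \<subseteq> V"
    using residue_system_exists[OF K_subfield finite_K KV s(1) A_def d] by blast
  obtain S where S: "covers_mod x S" using finite_cover_exists[OF rs AV d] by blast
  have x: "x \<in> M" "x \<noteq> \<zero>" using rs by (simp_all add: residue_system_def)
  obtain t where t: "uniformizer t"
    using uniformizer_exists[OF x S no_infinite_divisibility[OF rs Asub AV d]] by blast
  have "\<exists>s\<in>S. y \<ominus> s \<in> M" if y: "y \<in> V" for y
  proof -
    obtain s v where s: "s \<in> S" "v \<in> V" "y = s \<oplus> x \<otimes> v" using S y by (auto simp: covers_mod_def)
    then have "s \<in> carrier F" "x \<otimes> v \<in> carrier F"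
      using S M_carrier[OF x(1)] by (auto simp: covers_mod_def)
    then have "y \<ominus> s = x \<otimes> v" unfolding s(3) by algebra
    then have "y \<ominus> s \<in> M" using M_mult(1)[OF x(1) s(2)] by simp
    then show ?thesis using s(1) by blast
  qed
  then show ?thesis using t S by (auto simp: covers_mod_def)
qed

end

locale place = finite_function_field +
  fixes P :: "'a set"
  assumes place: "P \<in> places F K"
begin

definition V where "V = carrier (place_ring F K P)"

lemma place_ring_valuation:
  shows valuation_ring_V: "valuation_ring F K V" and maximalideal_P: "maximalideal P (F\<lparr>carrier := V\<rparr>)"
    and place_ring_eq: "place_ring F K P = F\<lparr>carrier := V\<rparr>"
proof -
  let ?Q = "\<lambda>V. valuation_ring F K V \<and> maximalideal P (F\<lparr>carrier := V\<rparr>)"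
  obtain W where W: "?Q W" using place by (auto simp: places_def)
  have "U = W" if "?Q U" for U
  proof -
    interpret U: valuation_subring F U using that valuation_ring_imp by blast
    interpret W: valuation_subring F W using W valuation_ring_imp by blast
    have "U.M = W.M" using U.maximalideal_eq_M[of P] W.maximalideal_eq_M[of P] that W by simp
    then show ?thesis using U.V_from_M W.V_from_M by simp
  qed
  then have "(THE V. ?Q V) = W" using W by (rule the_equality[rotated])
  then have eq: "place_ring F K P = F\<lparr>carrier := W\<rparr>" by (simp add: place_ring_def)
  then have "V = W" by (simp add: V_def)
  then show "valuation_ring F K V" "maximalideal P (F\<lparr>carrier := V\<rparr>)"
    "place_ring F K P = F\<lparr>carrier := V\<rparr>" using W eq by simp_all
qed

end

sublocale place \<subseteq> valuation_subring F V
  by (rule valuation_ring_imp[OF valuation_ring_V])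

context place
begin

lemma K_V: "K \<subseteq> V"
  by (rule valuation_ring_imp[OF valuation_ring_V])

lemma P_eq_M: "P = M"
  by (rule maximalideal_eq_M[OF maximalideal_P])

text \<open>Fixing one prime element turns conditions on valuations into memberships in the ring.\<close>

definition t where "t = (SOME t. uniformizer t)"

lemma uniformizer_t: "uniformizer t"
proof -
  have "\<exists>t. uniformizer t" using valuation_ring_discrete[OF valuation_ring_V] by blast
  then show ?thesis unfolding t_def by (rule someI_ex)
qed

lemmas tD = uniformizerD[OF uniformizer_t]
lemmas t_pow = field_int_pow[OF tD(3,2)]

text \<open>The prime elements are the associates of the chosen one, so valuations can be computed with \<open>t\<close>.\<close>

lemma prime_element_iff: "prime_element F K P s \<longleftrightarrow> (\<exists>v\<in>V - M. s = t \<otimes> v)"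
proof -
  have pe: "prime_element F K P s \<longleftrightarrow> s \<in> V \<and> M = {x \<otimes> s | x. x \<in> V}" for s
    by (simp add: prime_element_def place_ring_eq P_eq_M[symmetric] cgenideal_def)
  show ?thesis
  proof
    assume "prime_element F K P s"
    then have s: "s \<in> V" "M = {x \<otimes> s | x. x \<in> V}" using pe by auto
    have "\<one> \<otimes> s \<in> M" using s(2) V_closed(2) by blast
    then have "s \<in> M" using s by simp
    then obtain v where v: "v \<in> V" "s = t \<otimes> v" using uniformizer_t by (auto simp: uniformizer_def)
    obtain w where w: "w \<in> V" "t = w \<otimes> s" using tD(1) s(2) by blast
    have "t = t \<otimes> (w \<otimes> v)" using w(2) v tD(3) m_lcomm[of w t v] w(1) by simp
    then have eq: "t \<otimes> \<one> = t \<otimes> (w \<otimes> v)" using tD(3) by simp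
    have "\<one> = w \<otimes> v"
      by (rule l_cancel_field[OF tD(3,2) _ _ eq]) (use v(1) w(1) in simp_all)
    then have "v \<notin> M" using M_mult(2)[of v w] w(1) one_M by auto
    then show "\<exists>v\<in>V - M. s = t \<otimes> v" using v by blast
  next
    assume "\<exists>v\<in>V - M. s = t \<otimes> v"
    then obtain v where v: "v \<in> V" "v \<notin> M" "s = t \<otimes> v" by blast
    have "\<exists>x. y = x \<otimes> s \<and> x \<in> V" if y: "y \<in> M" for y
    proof -
      obtain w where w: "w \<in> V" "y = t \<otimes> w" using uniformizer_t y by (auto simp: uniformizer_def)
      have iv: "inv v \<in> V" "v \<noteq> \<zero>" using unit_inv v by blast+
      have "(w \<otimes> inv v) \<otimes> s = w \<otimes> t \<otimes> (inv v \<otimes> v)"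
        unfolding v(3) using V_carrier[OF w(1)] V_carrier[OF iv(1)] V_carrier[OF v(1)] tD(3) by algebra
      then have "(w \<otimes> inv v) \<otimes> s = y" using w v iv tD(3) by (simp add: m_comm)
      then show ?thesis using w iv by (intro exI[of _ "w \<otimes> inv v"]) simp
    qed
    moreover have "x \<otimes> s \<in> M" if "x \<in> V" for x
      using v M_mult(1)[OF tD(1), of v] M_mult(2)[OF _ that] by simp
    moreover have "s \<in> V" using v tD(4) by simp
    ultimately show "prime_element F K P s" using pe by blast
  qed
qed

lemma valuation_eq:
  assumes u: "u \<in> V - M" and y: "y = t [^] (m::int) \<otimes> u"
  shows "valuation F K P y = m"
  unfolding valuation_def place_ring_eq VR_Units
proof (rule the_equality)
  have "prime_element F K P t"
    unfolding prime_element_iff using tD(3) by (intro bexI[of _ \<one>]) auto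
  then show "\<exists>t u. prime_element F K P t \<and> u \<in> V - M \<and> y = t [^] m \<otimes> u"
    using u y by blast
next
  fix k :: int
  assume "\<exists>t u. prime_element F K P t \<and> u \<in> V - M \<and> y = t [^] k \<otimes> u"
  then obtain s w where s: "prime_element F K P s" "w \<in> V - M" "y = s [^] k \<otimes> w" by blast
  obtain v where v: "v \<in> V - M" "s = t \<otimes> v" using s(1) prime_element_iff by blast
  have vF: "v \<in> carrier F" "v \<noteq> \<zero>" using v(1) unit_inv(2)[of v] by auto
  have vk: "v [^] k \<in> V - M" by (rule unit_int_pow[OF v(1)])
  have "s [^] k = t [^] k \<otimes> v [^] k" unfolding v(2) by (rule field_int_pow_distrib[OF tD(3,2) vF])
  then have "y = t [^] k \<otimes> (v [^] k \<otimes> w)" using s vk t_pow(1) by (simp add: m_assoc)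
  moreover have "v [^] k \<otimes> w \<in> V - M" using vk s(2) mult_notin_M by simp
  ultimately show "k = m" using order_unique[OF uniformizer_t] u y by metis
qed

text \<open>Turns a lower bound on the valuation into a membership, which is additive and hence suits the
  study of Riemann-Roch spaces.\<close>

lemma valuation_ge_iff:
  assumes y: "y \<in> carrier F" "y \<noteq> \<zero>"
  shows "valuation F K P y \<ge> - a \<longleftrightarrow> y \<otimes> t [^] a \<in> V"
proof -
  obtain m :: int and u where u: "u \<in> V - M" "y = t [^] m \<otimes> u"
    using uniformizer_factor[OF uniformizer_t y] by blast
  have "y \<otimes> t [^] a = t [^] (m + a) \<otimes> u"
    using u t_pow(1)[of m] t_pow(1)[of a] t_pow(3)[of m a] V_carrier[of u] by (simp add: m_ac)
  then show ?thesis
    using valuation_eq[OF u] uniformizer_pow_in_V(1)[OF uniformizer_t u(1), of "m + a"] by auto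
qed

end

section \<open>Cardinalities and residue fields\<close>

lemma (in ring) bij_betw_combine:
  assumes "subfield K R" "independent K Us"
  shows "bij_betw (\<lambda>Ks. combine Ks Us) {Ks. set Ks \<subseteq> K \<and> length Ks = length Us} (Span K Us)"
proof (rule bij_betw_imageI)
  note U = independent_in_carrier[OF assms(2)]
  show "inj_on (\<lambda>Ks. combine Ks Us) {Ks. set Ks \<subseteq> K \<and> length Ks = length Us}"
  proof (rule inj_onI)
    fix as bs assume *: "as \<in> {Ks. set Ks \<subseteq> K \<and> length Ks = length Us}"
      "bs \<in> {Ks. set Ks \<subseteq> K \<and> length Ks = length Us}" "combine as Us = combine bs Us"
    then have "combine as Us \<in> Span K Us" using Span_mem_iff_length_version[OF assms(1) U] by blast
    from unique_decomposition[OF assms(1,2) this] show "as = bs" using * by auto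
  qed
  show "(\<lambda>Ks. combine Ks Us) ` {Ks. set Ks \<subseteq> K \<and> length Ks = length Us} = Span K Us"
    using Span_eq_combine_set_length_version[OF assms(1) U] by auto
qed

text \<open>Over a finite field dimensions can be read off from cardinalities.\<close>

lemma (in ring) finite_subspace:
  assumes K: "subfield K R" "finite K" and E: "subalgebra K E R" "finite E"
  shows "dimension (dim K E) K E" "card E = card K ^ dim K E"
proof -
  obtain xs where xs: "set xs = E" using finite_list[OF E(2)] by blast
  have xsR: "set xs \<subseteq> carrier R" using subalgebra_in_carrier[OF E(1)] xs by simp
  have "Span K xs = E"
    using subalgebra_Span_incl[OF K(1) E(1)] Span_base_incl[OF K(1) xsR] xs by blast
  then have "finite_dimension K E" using Span_finite_dimension[OF K(1) xsR] by simp
  then show dim: "dimension (dim K E) K E" using finite_dimensionE[OF K(1)] by (simp add: over_def)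
  then obtain Vs where Vs: "independent K Vs" "length Vs = dim K E" "Span K Vs = E"
    using exists_base[OF K(1)] by blast
  show "card E = card K ^ dim K E"
    using bij_betw_same_card[OF bij_betw_combine[OF K(1) Vs(1)]] card_lists_length_eq[OF K(2)] Vs by simp
qed

lemma card_le_fibers:
  assumes "finite Y" "f ` A \<subseteq> Y" "finite L"
    and "\<And>x. x \<in> A \<Longrightarrow> \<exists>h. inj_on h {z \<in> A. f z = f x} \<and> h ` {z \<in> A. f z = f x} \<subseteq> L"
  shows "finite A \<and> card A \<le> card L * card Y"
proof -
  have fib: "finite {z \<in> A. f z = y} \<and> card {z \<in> A. f z = y} \<le> card L" for y
  proof (cases "\<exists>x\<in>A. f x = y")
    case True
    then obtain x where x: "x \<in> A" "f x = y" by blast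
    then obtain h where "inj_on h {z \<in> A. f z = y}" "h ` {z \<in> A. f z = y} \<subseteq> L" using assms(4) by blast
    then show ?thesis using assms(3) by (meson card_inj_on_le inj_on_finite)
  next
    case False
    then have "{z \<in> A. f z = y} = {}" by blast
    then show ?thesis by (metis card.empty finite.emptyI le0)
  qed
  have A: "A = (\<Union>y\<in>Y. {z \<in> A. f z = y})" using assms(2) by blast
  have "finite (\<Union>y\<in>Y. {z \<in> A. f z = y})" using assms(1) fib by blast
  then have "finite A" using arg_cong[OF A, of finite] by simp
  moreover have "card A \<le> (\<Sum>y\<in>Y. card {z \<in> A. f z = y})"
    using card_UN_le[OF assms(1), of "\<lambda>y. {z \<in> A. f z = y}"] arg_cong[OF A, of card] by linarith
  moreover have "(\<Sum>y\<in>Y. card {z \<in> A. f z = y}) \<le> (\<Sum>y\<in>Y. card L)"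
    by (rule sum_mono) (use fib in blast)
  ultimately show ?thesis by (simp add: mult.commute)
qed

context place
begin

abbreviation res where "res \<equiv> residue F K P"
abbreviation RF where "RF \<equiv> residue_field F K P"

lemma RF_eq: "RF = VR Quot P"
  by (simp add: residue_field_def place_ring_eq)

lemma res_eq: "res = (\<lambda>f. P +>\<^bsub>VR\<^esub> f)"
  by (simp add: residue_def place_ring_eq fun_eq_iff)

lemma P_ideal: "ideal P VR"
  using maximalideal_P by (rule maximalideal.axioms)

lemma RF_field: "field RF"
  unfolding RF_eq by (rule maximalideal.quotient_is_field[OF maximalideal_P VR_cring])

lemma res_hom: "ring_hom_ring VR RF res"
  unfolding RF_eq res_eq by (rule ideal.rcos_ring_hom_ring[OF P_ideal])

lemma RF_carrier: "carrier RF = res ` V"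
  by (auto simp add: RF_eq res_eq FactRing_def A_RCOSETS_def' )

lemma res_eq_iff:
  assumes "a \<in> V" "b \<in> V"
  shows "res a = res b \<longleftrightarrow> a \<ominus> b \<in> M"
proof -
  interpret VR: cring VR by (rule VR_cring)
  show ?thesis
    using VR.quotient_eq_iff_same_a_r_cos[OF P_ideal, of a b] assms VR_minus[OF assms(2)]
    by (simp add: res_eq P_eq_M[symmetric])
qed

lemma finite_RF: "finite (carrier RF)"
proof -
  obtain S where S: "finite S" "S \<subseteq> V" "\<And>y. y \<in> V \<Longrightarrow> \<exists>s\<in>S. y \<ominus> s \<in> M"
    using valuation_ring_discrete[OF valuation_ring_V] by blast
  have "res ` V \<subseteq> res ` S"
  proof
    fix z assume "z \<in> res ` V"
    then obtain y where y: "y \<in> V" "z = res y" by blast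
    then obtain s where s: "s \<in> S" "y \<ominus> s \<in> M" using S(3) by blast
    then have "res y = res s" using res_eq_iff[OF y(1)] S(2) by blast
    then show "z \<in> res ` S" using s(1) y(2) by simp
  qed
  then show ?thesis unfolding RF_carrier using finite_surj[OF S(1)] by blast
qed

lemma K_subfield_VR: "subfield K VR"
proof -
  interpret VR: cring VR by (rule VR_cring)
  have "field (F\<lparr>carrier := K\<rparr>)" by (rule subfield_iff(2)[OF K_subfield])
  then show ?thesis using VR.subfield_iff(1)[of K] K_V by simp
qed

lemma res_K:
  shows "inj_on res K" "subfield (res ` K) RF"
proof -
  interpret H: ring_hom_ring VR RF res by (rule res_hom)
  interpret RF: field RF by (rule RF_field)
  show "inj_on res K" "subfield (res ` K) RF"
    using H.img_is_subfield[OF K_subfield_VR] RF.one_not_zero by simp_all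
qed

lemma card_RF: "card (carrier RF) = card K ^ place_degree F K P"
proof -
  interpret RF: field RF by (rule RF_field)
  have "subalgebra (res ` K) (carrier RF) RF"
    by (rule RF.carrier_is_subalgebra) (use K_V RF_carrier in blast)
  then have "card (carrier RF) = card (res ` K) ^ RF.dim (res ` K) (carrier RF)"
    using RF.finite_subspace(2)[OF res_K(2) finite_imageI[OF finite_K] _ finite_RF] by blast
  then show ?thesis by (simp add: place_degree_def card_image[OF res_K(1)])
qed

end

section \<open>Riemann-Roch spaces\<close>

context finite_function_field
begin

lemma placeI: "P \<in> places F K \<Longrightarrow> place F K P"
  by unfold_locales

text \<open>A description of the Riemann-Roch space by linear conditions; it treats the zero function and
  the others alike.\<close>

lemma RR_iff:
  "f \<in> RR F K A \<longleftrightarrow> f \<in> carrier F \<and>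
    (\<forall>P\<in>places F K. f \<otimes> place.t F K P [^] Poly_Mapping.lookup A P \<in> place.V F K P)"
proof (cases "f \<in> carrier F \<and> f \<noteq> \<zero>")
  case True
  then have "valuation F K P f \<ge> - Poly_Mapping.lookup A P \<longleftrightarrow>
      f \<otimes> place.t F K P [^] Poly_Mapping.lookup A P \<in> place.V F K P" if "P \<in> places F K" for P
    using place.valuation_ge_iff[OF placeI[OF that]] by blast
  then show ?thesis using True by (auto simp: RR_def)
next
  case False
  have "\<zero> \<otimes> place.t F K P [^] Poly_Mapping.lookup A P \<in> place.V F K P" if "P \<in> places F K" for P
  proof -
    interpret place F K P by (rule placeI[OF that])
    show ?thesis using t_pow(1) by simp
  qed
  then show ?thesis using False by (auto simp: RR_def)
qed

lemma RR_carrier: "f \<in> RR F K A \<Longrightarrow> f \<in> carrier F"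
  by (simp add: RR_iff)

lemma RR_subalgebra: "subalgebra K (RR F K A) F"
proof (intro subalgebra.intro subalgebra_axioms.intro add.subgroupI)
  show "RR F K A \<subseteq> carrier F" using RR_carrier by blast
  have "\<zero> \<in> RR F K A" by (simp add: RR_def)
  then show "RR F K A \<noteq> {}" by blast
next
  fix f g assume f: "f \<in> RR F K A" and g: "g \<in> RR F K A"
  have "(f \<oplus> g) \<otimes> place.t F K P [^] Poly_Mapping.lookup A P \<in> place.V F K P" if P: "P \<in> places F K" for P
  proof -
    interpret place F K P by (rule placeI[OF P])
    show ?thesis using f g P RR_iff t_pow(1) by (simp add: l_distr)
  qed
  then show "f \<oplus> g \<in> RR F K A" using f g RR_iff by simp
next
  fix f assume f: "f \<in> RR F K A"
  have "(\<ominus> f) \<otimes> place.t F K P [^] Poly_Mapping.lookup A P \<in> place.V F K P" if P: "P \<in> places F K" for P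
  proof -
    interpret place F K P by (rule placeI[OF P])
    show ?thesis using f P RR_iff t_pow(1) by (simp add: l_minus)
  qed
  then show "\<ominus> f \<in> RR F K A" using f RR_iff by simp
next
  fix c f assume c: "c \<in> K" and f: "f \<in> RR F K A"
  have cF: "c \<in> carrier F" using c subfieldE(3)[OF K_subfield] by blast
  have "(c \<otimes> f) \<otimes> place.t F K P [^] Poly_Mapping.lookup A P \<in> place.V F K P" if P: "P \<in> places F K" for P
  proof -
    interpret place F K P by (rule placeI[OF P])
    have "c \<in> V" using c K_V by blast
    then show ?thesis using f P RR_iff t_pow(1) cF by (simp add: m_assoc)
  qed
  then show "c \<otimes> f \<in> RR F K A" using f cF RR_iff by simp
qed

lemma RR_minus: "f \<in> RR F K A \<Longrightarrow> g \<in> RR F K A \<Longrightarrow> f \<ominus> g \<in> RR F K A"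
  using subalgebra.axioms(1)[OF RR_subalgebra, of A]
  by (metis a_minus_def add.subgroupE(3,4))

lemma RR_mono:
  assumes "\<And>P. Poly_Mapping.lookup A P \<le> Poly_Mapping.lookup B P"
  shows "RR F K A \<subseteq> RR F K B"
proof
  fix f assume f: "f \<in> RR F K A"
  have "f \<otimes> place.t F K P [^] Poly_Mapping.lookup B P \<in> place.V F K P" if P: "P \<in> places F K" for P
  proof -
    interpret place F K P by (rule placeI[OF P])
    let ?a = "Poly_Mapping.lookup A P" and ?b = "Poly_Mapping.lookup B P"
    have 1: "f \<otimes> t [^] ?a \<in> V" using f P RR_iff by blast
    have "t [^] (?b - ?a) \<otimes> \<one> \<in> V"
      using uniformizer_pow_in_V(1)[OF uniformizer_t, of \<one> "?b - ?a"] assms[of P] by simp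
    then have 2: "t [^] (?b - ?a) \<in> V" using t_pow(1) by simp
    have "t [^] ?b = t [^] ?a \<otimes> t [^] (?b - ?a)" using t_pow(3)[of ?a "?b - ?a"] by simp
    then have "f \<otimes> t [^] ?b = (f \<otimes> t [^] ?a) \<otimes> t [^] (?b - ?a)"
      using RR_carrier[OF f] t_pow(1) by (simp add: m_assoc)
    then show ?thesis using 1 2 by simp
  qed
  then show "f \<in> RR F K B" using f RR_iff by simp
qed

text \<open>The elements of the maximal ideal are multiples of \<open>t\<close>, and this factor can be cancelled.\<close>

lemma (in place) shift_in_M:
  assumes "f \<in> carrier F" "f \<otimes> t [^] (a + 1) \<in> M"
  shows "f \<otimes> t [^] (a::int) \<in> V"
proof -
  obtain v where v: "v \<in> V" "f \<otimes> t [^] (a + 1) = t \<otimes> v"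
    using assms(2) uniformizer_t by (auto simp: uniformizer_def)
  have "t \<otimes> (f \<otimes> t [^] a) = f \<otimes> t [^] (a + 1)"
    unfolding t_pow(3) t_pow(4) using assms(1) t_pow(1) tD(3) by (simp add: m_ac)
  then have eq: "t \<otimes> (f \<otimes> t [^] a) = t \<otimes> v" using v by simp
  have "f \<otimes> t [^] a = v"
    by (rule l_cancel_field[OF tD(3,2) _ _ eq]) (use assms(1) t_pow(1) v in simp_all)
  then show ?thesis using v by simp
qed

text \<open>Multiply \<open>f\<close> by the power of the prime element that makes all functions of the larger space
  integral at \<open>P\<close>, and take the residue. Functions with equal residues differ by an element of the smaller space, so the fibres of
  this map are no larger than that space, and its values lie in a field with \<open>card K ^ deg P\<close>
  elements.\<close>

lemma card_RR_step:
  assumes P: "P \<in> places F K" and fin: "finite (RR F K A)"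
  shows "finite (RR F K (A + frag_of P)) \<and>
    card (RR F K (A + frag_of P)) \<le> card (RR F K A) * card K ^ place_degree F K P"
proof -
  interpret place F K P by (rule placeI[OF P])
  let ?a = "Poly_Mapping.lookup A P" and ?B = "A + frag_of P"
  \<comment> \<open>the coefficient of \<open>f\<close> at the largest pole order that \<open>A + P\<close> admits\<close>
  let ?h = "\<lambda>f. res (f \<otimes> t [^] (?a + 1))"
  have lookup: "Poly_Mapping.lookup ?B R = Poly_Mapping.lookup A R + (if R = P then 1 else 0)" for R
    by (simp add: lookup_add)
  have inV: "f \<otimes> t [^] (?a + 1) \<in> V" if "f \<in> RR F K ?B" for f
  proof -
    have "f \<otimes> t [^] Poly_Mapping.lookup ?B P \<in> V" using that P RR_iff by blast
    then show ?thesis using lookup[of P] by simp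
  qed
  have diff: "f \<ominus> g \<in> RR F K A" if f: "f \<in> RR F K ?B" and g: "g \<in> RR F K ?B" and eq: "?h f = ?h g" for f g
  proof -
    have fg: "f \<ominus> g \<in> RR F K ?B" by (rule RR_minus[OF f g])
    have F: "f \<in> carrier F" "g \<in> carrier F" "t [^] (?a + 1) \<in> carrier F"
      using RR_carrier[OF f] RR_carrier[OF g] t_pow(1) by auto
    have "f \<otimes> t [^] (?a + 1) \<ominus> g \<otimes> t [^] (?a + 1) \<in> M"
      using res_eq_iff[OF inV[OF f] inV[OF g]] eq by blast
    moreover have "f \<otimes> t [^] (?a + 1) \<ominus> g \<otimes> t [^] (?a + 1) = (f \<ominus> g) \<otimes> t [^] (?a + 1)"
      using F by algebra
    ultimately have "(f \<ominus> g) \<otimes> t [^] ?a \<in> V" using shift_in_M[of "f \<ominus> g" ?a] F by simp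
    moreover have "(f \<ominus> g) \<otimes> place.t F K R [^] Poly_Mapping.lookup A R \<in> place.V F K R"
      if "R \<in> places F K" "R \<noteq> P" for R
    proof -
      have "(f \<ominus> g) \<otimes> place.t F K R [^] Poly_Mapping.lookup ?B R \<in> place.V F K R"
        using fg that(1) RR_iff by blast
      then show ?thesis using lookup[of R] that(2) by simp
    qed
    ultimately show ?thesis using RR_iff[of "f \<ominus> g" A] F by auto
  qed
  have "finite (RR F K ?B) \<and> card (RR F K ?B) \<le> card (RR F K A) * card (carrier RF)"
  proof (rule card_le_fibers[OF finite_RF _ fin])
    show "?h ` RR F K ?B \<subseteq> carrier RF" using inV RF_carrier by blast
  next
    fix f assume f: "f \<in> RR F K ?B"
    have "inj_on (\<lambda>g. g \<ominus> f) {z \<in> RR F K ?B. ?h z = ?h f}"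
    proof (rule inj_onI)
      fix x y assume "x \<in> {z \<in> RR F K ?B. ?h z = ?h f}" "y \<in> {z \<in> RR F K ?B. ?h z = ?h f}"
        and eq: "x \<ominus> f = y \<ominus> f"
      then have "x \<in> carrier F" "y \<in> carrier F" "\<ominus> f \<in> carrier F" using RR_carrier f by auto
      then show "x = y" using eq add.r_cancel unfolding a_minus_def by blast
    qed
    moreover have "(\<lambda>g. g \<ominus> f) ` {z \<in> RR F K ?B. ?h z = ?h f} \<subseteq> RR F K A" using diff f by blast
    ultimately show "\<exists>h. inj_on h {z \<in> RR F K ?B. ?h z = ?h f} \<and> h ` {z \<in> RR F K ?B. ?h z = ?h f} \<subseteq> RR F K A"
      by blast
  qed
  then show ?thesis using card_RF by simp
qed

lemma div_degree_superset:
  "finite S \<Longrightarrow> Poly_Mapping.keys A \<subseteq> S \<Longrightarrow>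
    div_degree F K A = (\<Sum>P\<in>S. Poly_Mapping.lookup A P * int (place_degree F K P))"
  unfolding div_degree_def by (rule sum.mono_neutral_left) (auto simp: in_keys_iff)

lemma div_degree_add: "div_degree F K (A + B) = div_degree F K A + div_degree F K B"
proof -
  let ?S = "Poly_Mapping.keys A \<union> Poly_Mapping.keys B"
  have "Poly_Mapping.keys (A + B) \<subseteq> ?S" by (rule keys_add)
  then show ?thesis
    using div_degree_superset[of ?S "A + B"] div_degree_superset[of ?S A] div_degree_superset[of ?S B]
    by (simp add: lookup_add distrib_right sum.distrib)
qed

lemma div_degree_frag_of: "div_degree F K (frag_of P) = int (place_degree F K P)"
  by (simp add: div_degree_def)

text \<open>An effective divisor is a sum of places, so the bound for one place can be iterated.\<close>

lemma card_RR_add_effective: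
  assumes "is_divisor F K E" "effective E" and fin: "finite (RR F K A)"
  shows "finite (RR F K (A + E)) \<and> 0 \<le> div_degree F K E \<and>
    card (RR F K (A + E)) \<le> card (RR F K A) * card K ^ nat (div_degree F K E)"
  using assms(1,2)
proof (induction "nat (\<Sum>P\<in>Poly_Mapping.keys E. Poly_Mapping.lookup E P)" arbitrary: E rule: less_induct)
  case less
  show ?case
  proof (cases "E = 0")
    case True
    then show ?thesis using fin by (simp add: div_degree_def)
  next
    case False
    then obtain P where P: "P \<in> Poly_Mapping.keys E" by (metis all_not_in_conv keys_eq_empty)
    let ?E = "E - frag_of P"
    have lookup: "Poly_Mapping.lookup ?E R = Poly_Mapping.lookup E R - (if R = P then 1 else 0)" for R
      by (simp add: lookup_minus)
    have pos: "Poly_Mapping.lookup E P \<ge> 1"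
      using P less.prems(2) by (metis effective_def in_keys_iff int_one_le_iff_zero_less order_le_less)
    have nonneg: "0 \<le> Poly_Mapping.lookup E R" "0 \<le> Poly_Mapping.lookup ?E R" for R
      using less.prems(2) lookup[of R] pos by (auto simp: effective_def)
    have keys: "Poly_Mapping.keys ?E \<subseteq> Poly_Mapping.keys E"
    proof
      fix R assume "R \<in> Poly_Mapping.keys ?E"
      then show "R \<in> Poly_Mapping.keys E" using lookup[of R] P by (cases "R = P") (auto simp: in_keys_iff)
    qed
    have "(\<Sum>R\<in>Poly_Mapping.keys ?E. Poly_Mapping.lookup ?E R) =
        (\<Sum>R\<in>Poly_Mapping.keys E. Poly_Mapping.lookup ?E R)"
      by (rule sum.mono_neutral_left) (use keys in \<open>auto simp: in_keys_iff\<close>)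
    also have "\<dots> = (\<Sum>R\<in>Poly_Mapping.keys E. Poly_Mapping.lookup E R) - 1"
      using P by (simp add: lookup sum_subtractf)
    finally have sum: "(\<Sum>R\<in>Poly_Mapping.keys ?E. Poly_Mapping.lookup ?E R) =
        (\<Sum>R\<in>Poly_Mapping.keys E. Poly_Mapping.lookup E R) - 1" .
    have "0 < (\<Sum>R\<in>Poly_Mapping.keys E. Poly_Mapping.lookup E R)"
      by (rule sum_pos2[OF _ P]) (use pos nonneg in auto)
    then have lt: "nat (\<Sum>R\<in>Poly_Mapping.keys ?E. Poly_Mapping.lookup ?E R) <
        nat (\<Sum>R\<in>Poly_Mapping.keys E. Poly_Mapping.lookup E R)" using sum by simp
    have "is_divisor F K ?E" using less.prems(1) keys by (auto simp: is_divisor_def)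
    moreover have "effective ?E" using nonneg by (simp add: effective_def)
    ultimately have IH: "finite (RR F K (A + ?E))" "0 \<le> div_degree F K ?E"
        "card (RR F K (A + ?E)) \<le> card (RR F K A) * card K ^ nat (div_degree F K ?E)"
      using less.hyps[OF lt] by blast+
    have PP: "P \<in> places F K" using less.prems(1) P by (auto simp: is_divisor_def)
    have eq: "A + ?E + frag_of P = A + E" by simp
    have deg: "div_degree F K E = div_degree F K ?E + int (place_degree F K P)"
      using div_degree_add[of ?E "frag_of P"] div_degree_frag_of[of P] by simp
    have step: "finite (RR F K (A + E))"
      "card (RR F K (A + E)) \<le> card (RR F K (A + ?E)) * card K ^ place_degree F K P"
      using card_RR_step[OF PP IH(1)] unfolding eq by blast+
    note step(2)
    also have "\<dots> \<le> card (RR F K A) * card K ^ nat (div_degree F K ?E) * card K ^ place_degree F K P"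
      using IH(3) by simp
    also have "\<dots> = card (RR F K A) * card K ^ nat (div_degree F K E)"
      using IH(2) by (simp add: deg nat_add_distrib power_add mult.assoc)
    finally show ?thesis using step(1) IH(2) deg by simp
  qed
qed

end

section \<open>Dimensions in the multiplication algorithm\<close>

context place
begin

lemma RR_subset_V:
  assumes "Poly_Mapping.lookup A P = 0"
  shows "RR F K A \<subseteq> V"
proof
  fix f assume f: "f \<in> RR F K A"
  then have "f \<otimes> t [^] Poly_Mapping.lookup A P \<in> V" using place RR_iff by blast
  then show "f \<in> V" using assms RR_carrier[OF f] by simp
qed

text \<open>A function in the maximal ideal has valuation at least one, that is, it vanishes at \<open>P\<close>.\<close>

lemma RR_Int_M:
  assumes "Poly_Mapping.lookup A P = 0" "f \<in> RR F K A" "f \<in> M"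
  shows "f \<in> RR F K (A - frag_of P)"
proof -
  have "f \<otimes> t [^] (-1 + 1 :: int) \<in> M" using assms(3) M_carrier[OF assms(3)] by simp
  then have "f \<otimes> t [^] (-1 :: int) \<in> V" using shift_in_M[of f "-1"] M_carrier[OF assms(3)] by blast
  then have P: "f \<otimes> t [^] Poly_Mapping.lookup (A - frag_of P) P \<in> V"
    using assms(1) by (simp add: lookup_minus)
  have "f \<otimes> place.t F K R [^] Poly_Mapping.lookup (A - frag_of P) R \<in> place.V F K R"
    if R: "R \<in> places F K" for R
  proof (cases "R = P")
    case False
    then have "Poly_Mapping.lookup (A - frag_of P) R = Poly_Mapping.lookup A R" by (simp add: lookup_minus)
    then show ?thesis using assms(2) R RR_iff by metis
  qed (use P in simp)
  then show ?thesis using RR_iff M_carrier[OF assms(3)] by blast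
qed

lemma eval_at_eq:
  assumes "c \<in> K" "res c = res f"
  shows "eval_at F K P f = c"
  unfolding eval_at_def
proof (rule the_equality)
  fix d assume "d \<in> K \<and> res d = res f"
  then show "d = c" using assms inj_onD[OF res_K(1)] by metis
qed (use assms in simp)

context
  assumes deg1: "place_degree F K P = 1"
begin

lemma res_K_carrier: "res ` K = carrier RF"
proof (rule card_subset_eq[OF finite_RF])
  show "res ` K \<subseteq> carrier RF" using K_V RF_carrier by blast
  show "card (res ` K) = card (carrier RF)" using card_RF deg1 card_image[OF res_K(1)] by simp
qed

lemma eval_at:
  assumes "f \<in> V"
  shows "eval_at F K P f \<in> K" "res (eval_at F K P f) = res f"
proof -
  obtain c where c: "c \<in> K" "res c = res f" using assms RF_carrier res_K_carrier by (metis imageE imageI)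
  then show "eval_at F K P f \<in> K" "res (eval_at F K P f) = res f" using eval_at_eq[OF c] by simp_all
qed

lemma eval_at_add:
  assumes "f \<in> V" "g \<in> V"
  shows "eval_at F K P (f \<oplus> g) = eval_at F K P f \<oplus> eval_at F K P g"
proof (rule eval_at_eq)
  interpret H: ring_hom_ring VR RF res by (rule res_hom)
  note f = eval_at[OF assms(1)] and g = eval_at[OF assms(2)]
  show "eval_at F K P f \<oplus> eval_at F K P g \<in> K"
    using subringE(7)[OF subfieldE(1)[OF K_subfield]] f g by blast
  have "eval_at F K P f \<in> V" "eval_at F K P g \<in> V" using f g K_V by blast+
  then show "res (eval_at F K P f \<oplus> eval_at F K P g) = res (f \<oplus> g)"
    using H.hom_add[of "eval_at F K P f" "eval_at F K P g"] H.hom_add[of f g] assms f g by simp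
qed

lemma eval_at_smult:
  assumes "c \<in> K" "f \<in> V"
  shows "eval_at F K P (c \<otimes> f) = c \<otimes> eval_at F K P f"
proof (rule eval_at_eq)
  interpret H: ring_hom_ring VR RF res by (rule res_hom)
  note f = eval_at[OF assms(2)]
  show "c \<otimes> eval_at F K P f \<in> K"
    using subringE(6)[OF subfieldE(1)[OF K_subfield]] f assms by blast
  have "eval_at F K P f \<in> V" "c \<in> V" using f assms K_V by blast+
  then show "res (c \<otimes> eval_at F K P f) = res (c \<otimes> f)"
    using H.hom_mult[of c "eval_at F K P f"] H.hom_mult[of c f] assms f by simp
qed

end

end

locale chudnovsky = finite_function_field +
  fixes n g :: nat and Q :: "'a set" and D :: "'a set \<Rightarrow>\<^sub>0 int" and Ps :: "'a set list"
  assumes genus: "has_genus F K g"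
    and Q: "Q \<in> places F K" "place_degree F K Q = n"
    and Ps: "set Ps \<subseteq> places F K" "\<forall>P\<in>set Ps. place_degree F K P = 1"
    and D: "is_divisor F K D" "Poly_Mapping.keys D \<inter> insert Q (set Ps) = {}" "effective D"
    and EvQ_surj: "residue F K Q ` RR F K D = carrier (residue_field F K Q)"
    and EvP_inj: "inj_on (eval_tuple F K Ps) (RR F K (frag_cmul 2 D))"
    and nonspecial: "nonspecial F K g (D - frag_of Q)" "div_degree F K (D - frag_of Q) = int g - 1"
    and length_Ps: "length Ps = RR_dim F K (frag_cmul 2 D)"

sublocale chudnovsky \<subseteq> Q: place F K Q
  by unfold_locales (rule Q)

context chudnovsky
begin

abbreviation L2 where "L2 \<equiv> RR F K (frag_cmul 2 D)"
abbreviation N where "N \<equiv> length Ps"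
abbreviation ev where "ev \<equiv> eval_tuple F K Ps"

lemma lookup_D: "Poly_Mapping.lookup D Q = 0" "P \<in> set Ps \<Longrightarrow> Poly_Mapping.lookup D P = 0"
  using D(2) by (auto simp: in_keys_iff)

lemma L2_subset_place: "P \<in> set Ps \<Longrightarrow> L2 \<subseteq> place.V F K P"
  using place.RR_subset_V[OF placeI, of P "frag_cmul 2 D"] lookup_D(2) Ps(1) by auto

lemma L2_subset_Q: "L2 \<subseteq> Q.V"
  using Q.RR_subset_V[of "frag_cmul 2 D"] lookup_D(1) by simp

lemma L2_carrier: "L2 \<subseteq> carrier F"
  using RR_carrier by blast

lemma eval_L2:
  assumes "i < N" "f \<in> L2"
  shows "eval_at F K (Ps ! i) f \<in> K"
proof -
  have P: "Ps ! i \<in> set Ps" using assms by simp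
  then interpret P: place F K "Ps ! i" using placeI Ps(1) by blast
  show ?thesis using P.eval_at(1)[of f] Ps(2) P L2_subset_place[OF P] assms(2) by blast
qed

lemma eval_L2_add:
  assumes "i < N" "f \<in> L2" "h \<in> L2"
  shows "eval_at F K (Ps ! i) (f \<oplus> h) = eval_at F K (Ps ! i) f \<oplus> eval_at F K (Ps ! i) h"
proof -
  have P: "Ps ! i \<in> set Ps" using assms by simp
  then interpret P: place F K "Ps ! i" using placeI Ps(1) by blast
  show ?thesis using P.eval_at_add[of f h] Ps(2) P L2_subset_place[OF P] assms by blast
qed

lemma eval_L2_smult:
  assumes "i < N" "c \<in> K" "f \<in> L2"
  shows "eval_at F K (Ps ! i) (c \<otimes> f) = c \<otimes> eval_at F K (Ps ! i) f"
proof -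
  have P: "Ps ! i \<in> set Ps" using assms by simp
  then interpret P: place F K "Ps ! i" using placeI Ps(1) by blast
  show ?thesis using P.eval_at_smult[of c f] Ps(2) P L2_subset_place[OF P] assms by blast
qed

lemma ev_in_lists: "ev ` L2 \<subseteq> {v. set v \<subseteq> K \<and> length v = N}"
  using eval_L2 by (force simp: eval_tuple_def in_set_conv_nth)

lemma finite_L2: "finite L2"
  using inj_on_finite[OF EvP_inj ev_in_lists] finite_lists_length_eq[OF finite_K] by blast

lemma RR_D_subset: "RR F K D \<subseteq> L2"
  by (rule RR_mono) (use D(3) in \<open>simp add: effective_def\<close>)

lemma finite_RR_D: "finite (RR F K D)"
  using finite_subset[OF RR_D_subset finite_L2] .

lemmas dim_RR = finite_subspace[OF K_subfield finite_K RR_subalgebra, folded RR_dim_def]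

lemma card_K_gt_1: "1 < card K"
proof -
  have "{\<zero>, \<one>} \<subseteq> K" using subringE(2,3)[OF subfieldE(1)[OF K_subfield]] by simp
  then have "card {\<zero>, \<one>} \<le> card K" by (rule card_mono[OF finite_K])
  then show ?thesis by simp
qed

text \<open>The injective map \<open>Ev\<^sub>P\<close> is surjective since both sides have \<open>card K ^ N\<close> elements.\<close>

lemma ev_bij: "bij_betw ev L2 {v. set v \<subseteq> K \<and> length v = N}"
proof -
  have "card (ev ` L2) = card {v. set v \<subseteq> K \<and> length v = N}"
    using card_image[OF EvP_inj] dim_RR(2)[OF finite_L2] card_lists_length_eq[OF finite_K] length_Ps by simp
  then have "ev ` L2 = {v. set v \<subseteq> K \<and> length v = N}"
    using card_subset_eq[OF finite_lists_length_eq[OF finite_K] ev_in_lists] by blast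
  then show ?thesis using EvP_inj by (simp add: bij_betw_def)
qed

text \<open>A non-special divisor of degree \<open>g - 1\<close> has dimension \<open>0\<close>.\<close>

lemma RR_D_minus_Q: "RR F K (D - frag_of Q) = {\<zero>}"
proof -
  have "RR F K (D - frag_of Q) \<subseteq> RR F K D" by (rule RR_mono) (simp add: lookup_minus)
  then have fin: "finite (RR F K (D - frag_of Q))" using finite_RR_D finite_subset by blast
  have "RR_dim F K (D - frag_of Q) = 0"
    using nonspecial by (simp add: nonspecial_def specialty_index_def)
  then have "dimension 0 K (RR F K (D - frag_of Q))" using dim_RR(1)[OF fin] by simp
  then show ?thesis by (rule dimension_zero[OF K_subfield])
qed

text \<open>Functions in \<open>L(D)\<close> with the same residue at \<open>Q\<close> differ by an element of
  \<open>L(D - Q)\<close>, which is zero.\<close>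

lemma bij_EvQ: "bij_betw Q.res (RR F K D) (carrier Q.RF)"
proof (rule bij_betw_imageI)
  show "inj_on Q.res (RR F K D)"
  proof (rule inj_onI)
    fix f h assume f: "f \<in> RR F K D" and h: "h \<in> RR F K D" and eq: "Q.res f = Q.res h"
    have "f \<ominus> h \<in> Q.M" using Q.res_eq_iff[of f h] f h eq RR_D_subset L2_subset_Q by blast
    then have "f \<ominus> h \<in> RR F K (D - frag_of Q)"
      using Q.RR_Int_M[OF lookup_D(1) RR_minus[OF f h]] by blast
    then have "f \<ominus> h = \<zero>" using RR_D_minus_Q by blast
    then show "f = h" using RR_carrier[OF f] RR_carrier[OF h] by simp
  qed
qed (rule EvQ_surj)

lemma RR_dim_D: "RR_dim F K D = n"
proof -
  have "card K ^ RR_dim F K D = card K ^ n"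
    using dim_RR(2)[OF finite_RR_D] bij_betw_same_card[OF bij_EvQ] Q.card_RF Q(2) by simp
  then show ?thesis using power_inject_exp[OF card_K_gt_1] by blast
qed

lemma two_D: "frag_cmul 2 D = D + D"
  using frag_cmul_distrib[of 1 1 D] by simp

text \<open>The degree of \<open>D\<close> is \<open>n + g - 1\<close>. The definition of the genus gives
  \<open>dim L(2D) \<ge> deg(2D) + 1 - g\<close>, and passing from \<open>L(D)\<close> to \<open>L(2D)\<close> raises the dimension by at
  most \<open>deg D\<close>. Both bounds equal \<open>2n + g - 1\<close>.\<close>

lemma RR_dim_2D: "int N = int n + (int n + int g - 1)"
proof -
  have "div_degree F K D = div_degree F K (D - frag_of Q) + div_degree F K (frag_of Q)"
    using div_degree_add[of "D - frag_of Q" "frag_of Q"] by simp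
  then have deg: "div_degree F K D = int n + int g - 1" using nonspecial(2) Q(2) div_degree_frag_of by simp
  have "is_divisor F K (frag_cmul 2 D)" using D(1) keys_cmul by (fastforce simp: is_divisor_def)
  then have lower: "div_degree F K (frag_cmul 2 D) - int (RR_dim F K (frag_cmul 2 D)) + 1 \<le> int g"
    using genus by (simp add: has_genus_def)
  have step: "0 \<le> div_degree F K D"
      "card (RR F K (D + D)) \<le> card (RR F K D) * card K ^ nat (div_degree F K D)"
    using card_RR_add_effective[OF D(1,3) finite_RR_D] by blast+
  then have "card K ^ N \<le> card K ^ (n + nat (div_degree F K D))"
    using dim_RR(2)[OF finite_RR_D] dim_RR(2)[OF finite_L2] length_Ps RR_dim_D two_D
    by (simp add: power_add)
  then have "N \<le> n + nat (div_degree F K D)" using power_increasing_iff[OF card_K_gt_1] by blast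
  then show ?thesis using lower deg step(1) length_Ps two_D div_degree_add[of D D] by simp
qed

lemma N_eq: "N = 2 * n + g - 1"
  using RR_dim_2D by linarith

lemma adapted_basis_exists: "\<exists>BD BDc. length BD = n \<and> length (BD @ BDc) = N \<and> adapted_basis F K D BD BDc"
proof -
  have d: "dimension n K (RR F K D)" "dimension N K L2"
    using dim_RR(1)[OF finite_RR_D] dim_RR(1)[OF finite_L2] RR_dim_D length_Ps by simp_all
  obtain A where A: "set A \<subseteq> carrier F" "independent K A" "length A = n" "Span K A = RR F K D"
    using exists_base[OF K_subfield d(1)] by blast
  have "set A \<subseteq> L2" using Span_base_incl[OF K_subfield A(1)] A(4) RR_D_subset by blast
  then obtain C where C: "length (C @ A) = N" "independent K (C @ A)" "Span K (C @ A) = L2"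
    using complete_base[OF K_subfield d(2) A(2)] by blast
  have CF: "set C \<subseteq> carrier F" using independent_in_carrier[OF C(2)] by simp
  have AC: "independent K (A @ C)"
    using independent_same_set[OF K_subfield, of "C @ A" "A @ C"] C(2) by auto
  have SAC: "Span K (A @ C) = L2"
    using Span_same_set[OF K_subfield, of "C @ A" "A @ C"] C(3) CF A(1) by auto
  have "is_complement F (RR F K D) (Span K C) L2"
    unfolding is_complement_def
    using independent_split(3)[OF K_subfield AC] Span_append_eq_set_add[OF K_subfield A(1) CF] A(4) SAC by simp
  moreover have "is_basis F K (Span K C) C"
    using independent_split(1)[OF K_subfield AC] by (simp add: is_basis_def)
  ultimately have "adapted_basis F K D A C"
    unfolding adapted_basis_def is_basis_def using A AC SAC by blast
  moreover have "length (A @ C) = N" using C(1) by simp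
  ultimately show ?thesis using A(3) by blast
qed

end

section \<open>Coordinates and linear functionals\<close>

lemma (in ring) combine_eq_finsum:
  assumes "length Ks = length Us" "set Ks \<subseteq> carrier R" "set Us \<subseteq> carrier R"
  shows "combine Ks Us = (\<Oplus>i\<in>{..<length Us}. Ks ! i \<otimes> Us ! i)"
  using assms
proof (induction Us arbitrary: Ks rule: rev_induct)
  case Nil
  then show ?case by simp
next
  case (snoc u Us)
  obtain Ls k where Ks: "Ks = Ls @ [k]" using snoc.prems(1) by (cases Ks rule: rev_cases) auto
  have c: "length Ls = length Us" "set Ls \<subseteq> carrier R" "k \<in> carrier R" "u \<in> carrier R" "set Us \<subseteq> carrier R"
    using snoc.prems Ks by auto
  have nth: "Ls ! i \<in> carrier R" "Us ! i \<in> carrier R" if "i < length Us" for i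
    using that c nth_mem[of i Ls] nth_mem[of i Us] by auto
  let ?f = "\<lambda>i. Ks ! i \<otimes> (Us @ [u]) ! i"
  have eq: "?f i = Ls ! i \<otimes> Us ! i" if "i < length Us" for i
    using that c(1) by (simp add: Ks nth_append)
  have last: "?f (length Us) = k \<otimes> u" using c(1) by (simp add: Ks nth_append)
  have "(\<Oplus>i\<in>{..<length (Us @ [u])}. ?f i) = ?f (length Us) \<oplus> (\<Oplus>i\<in>{..<length Us}. ?f i)"
    using finsum_insert[of "{..<length Us}" "length Us" ?f] eq nth last c by (simp add: lessThan_Suc Pi_def)
  also have "(\<Oplus>i\<in>{..<length Us}. ?f i) = (\<Oplus>i\<in>{..<length Us}. Ls ! i \<otimes> Us ! i)"
    by (rule finsum_cong') (use eq nth in auto)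
  also have "\<dots> = combine Ls Us" using snoc.IH[of Ls] c by simp
  also have "?f (length Us) \<oplus> combine Ls Us = combine Ls Us \<oplus> combine [k] [u]"
    using last c combine_in_carrier[OF c(2,5)] by (simp add: a_comm)
  also have "\<dots> = combine Ks (Us @ [u])"
    unfolding Ks by (rule combine_append) (use c in auto)
  finally show ?case by simp
qed

lemma (in ring) subalgebra_combine:
  assumes "subfield K R" "subalgebra K E R" "set cs \<subseteq> K" "set Us \<subseteq> E" "length cs = length Us"
  shows "combine cs Us \<in> E"
proof -
  have "set Us \<subseteq> carrier R" using assms(4) subalgebra_in_carrier[OF assms(2)] by blast
  then have "combine cs Us \<in> Span K Us"
    using Span_mem_iff_length_version[OF assms(1)] assms(3,5) by blast
  then show ?thesis using subalgebra_Span_incl[OF assms(1,2,4)] by blast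
qed

text \<open>The factors appear in the order of a matrix product: the row of values of the functional comes
  before the column of coefficients.\<close>

lemma (in cring) linear_functional_combine:
  assumes K: "subfield K R" and E: "subalgebra K E R"
    and \<phi>: "\<And>v. v \<in> E \<Longrightarrow> \<phi> v \<in> K" "\<And>v w. v \<in> E \<Longrightarrow> w \<in> E \<Longrightarrow> \<phi> (v \<oplus> w) = \<phi> v \<oplus> \<phi> w"
      "\<And>c v. c \<in> K \<Longrightarrow> v \<in> E \<Longrightarrow> \<phi> (c \<otimes> v) = c \<otimes> \<phi> v"
    and cs: "length cs = length Us" "set cs \<subseteq> K" "set Us \<subseteq> E"
  shows "\<phi> (combine cs Us) = (\<Oplus>i\<in>{..<length Us}. \<phi> (Us ! i) \<otimes> cs ! i)"
proof -
  note KR = subfieldE(3)[OF K]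
  note ER = subalgebra_in_carrier[OF E]
  have zK: "\<zero> \<in> K" using subringE(2)[OF subfieldE(1)[OF K]] .
  have zE: "\<zero> \<in> E" using subgroup.one_closed[OF subalgebra.axioms(1)[OF E]] by simp
  have z: "\<phi> \<zero> = \<zero>"
  proof -
    have "\<phi> (\<zero> \<otimes> \<zero>) = \<zero> \<otimes> \<phi> \<zero>" by (rule \<phi>(3)[OF zK zE])
    moreover have "\<phi> \<zero> \<in> carrier R" using \<phi>(1)[OF zE] KR by blast
    ultimately show ?thesis by simp
  qed
  have "\<phi> (combine cs Us) = combine cs (map \<phi> Us)"
    using cs
  proof (induction cs Us rule: list_induct2)
    case Nil
    then show ?case using z by simp
  next
    case (Cons c cs u Us)
    have "combine cs Us \<in> E" using subalgebra_combine[OF K E _ _ Cons.hyps] Cons.prems by simp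
    moreover have "c \<otimes> u \<in> E" using subalgebra.smult_closed[OF E] Cons.prems by simp
    ultimately show ?case using Cons \<phi> by simp
  qed
  also have "\<dots> = (\<Oplus>i\<in>{..<length Us}. cs ! i \<otimes> map \<phi> Us ! i)"
    using combine_eq_finsum[of cs "map \<phi> Us"] cs \<phi>(1) KR by fastforce
  also have "\<dots> = (\<Oplus>i\<in>{..<length Us}. \<phi> (Us ! i) \<otimes> cs ! i)"
  proof (rule finsum_cong'[OF refl])
    have mem: "\<phi> (Us ! i) \<in> carrier R" "cs ! i \<in> carrier R" if "i < length Us" for i
    proof -
      have "Us ! i \<in> set Us" "cs ! i \<in> set cs" using that cs(1) by simp_all
      then show "\<phi> (Us ! i) \<in> carrier R" "cs ! i \<in> carrier R" using \<phi>(1) cs(2,3) KR by blast+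
    qed
    then show "(\<lambda>i. \<phi> (Us ! i) \<otimes> cs ! i) \<in> {..<length Us} \<rightarrow> carrier R" by simp
    show "cs ! i \<otimes> map \<phi> Us ! i = \<phi> (Us ! i) \<otimes> cs ! i" if "i \<in> {..<length Us}" for i
      using that mem[of i] by (simp add: m_comm)
  qed
  finally show ?thesis .
qed

context ring_hom_ring
begin

context
  fixes K Us E
  assumes K: "subfield K R" and one_zero: "\<one>\<^bsub>S\<^esub> \<noteq> \<zero>\<^bsub>S\<^esub>" and basis: "is_basis S (h ` K) E Us"
begin

lemma basis_ind: "independent (h ` K) Us" "Span (h ` K) Us = E" "set Us \<subseteq> carrier S"
  using basis independent_in_carrier by (auto simp: is_basis_def)

text \<open>Coordinates with respect to the scalars \<open>h ` K\<close> correspond to coordinates in \<open>K\<close> because a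
  ring homomorphism into a nonzero ring is injective on a subfield.\<close>

lemma coordinates_ex1:
  assumes "v \<in> E"
  shows "\<exists>!cs. length cs = length Us \<and> set cs \<subseteq> K \<and> combine (map h cs) Us = v"
proof -
  note hK = img_is_subfield[OF K one_zero]
  obtain Ks where Ks: "set Ks \<subseteq> h ` K" "length Ks = length Us" "v = combine Ks Us"
    and uniq: "\<And>Ls. set Ls \<subseteq> h ` K \<Longrightarrow> length Ls = length Us \<Longrightarrow> v = combine Ls Us \<Longrightarrow> Ls = Ks"
    using unique_decomposition[OF hK(2) basis_ind(1), of v] assms basis_ind(2) by blast
  show ?thesis
  proof (rule ex1I[of _ "map (inv_into K h) Ks"])
    have "map h (map (inv_into K h) Ks) = Ks"
      using Ks(1) f_inv_into_f[of _ h K] by (auto simp: map_idI subset_iff)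
    moreover have "set (map (inv_into K h) Ks) \<subseteq> K"
      using Ks(1) inv_into_into[of _ h K] by auto
    ultimately show "length (map (inv_into K h) Ks) = length Us \<and> set (map (inv_into K h) Ks) \<subseteq> K \<and>
        combine (map h (map (inv_into K h) Ks)) Us = v"
      using Ks(2,3) by simp
  next
    fix cs assume cs: "length cs = length Us \<and> set cs \<subseteq> K \<and> combine (map h cs) Us = v"
    then have "map h cs = Ks" by (intro uniq) auto
    then have "map (inv_into K h) Ks = map (inv_into K h) (map h cs)" by simp
    also have "\<dots> = cs" using cs inv_into_f_f[OF hK(1)] by (auto simp: map_idI subset_iff)
    finally show "cs = map (inv_into K h) Ks" by simp
  qed
qed

lemma coordinates_spec:
  assumes "v \<in> E"
  shows "length (coordinates S K h Us v) = length Us" "set (coordinates S K h Us v) \<subseteq> K"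
    "combine (map h (coordinates S K h Us v)) Us = v"
  using theI'[OF coordinates_ex1[OF assms]] unfolding coordinates_def by blast+

lemma coordinates_eq:
  assumes "v \<in> E" "length cs = length Us" "set cs \<subseteq> K" "combine (map h cs) Us = v"
  shows "coordinates S K h Us v = cs"
  using coordinates_ex1[OF assms(1)] coordinates_spec[OF assms(1)] assms(2-) by blast

lemma coordinates_add:
  assumes "v \<in> E" "w \<in> E" "v \<oplus>\<^bsub>S\<^esub> w \<in> E"
  shows "coordinates S K h Us (v \<oplus>\<^bsub>S\<^esub> w) = map2 (\<oplus>\<^bsub>R\<^esub>) (coordinates S K h Us v) (coordinates S K h Us w)"
proof (rule coordinates_eq[OF assms(3)])
  note cv = coordinates_spec[OF assms(1)] and cw = coordinates_spec[OF assms(2)]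
  let ?a = "coordinates S K h Us v" and ?b = "coordinates S K h Us w"
  note KR = subfieldE(3)[OF K]
  show "length (map2 (\<oplus>\<^bsub>R\<^esub>) ?a ?b) = length Us" using cv cw by simp
  show "set (map2 (\<oplus>\<^bsub>R\<^esub>) ?a ?b) \<subseteq> K"
  proof
    fix z assume "z \<in> set (map2 (\<oplus>\<^bsub>R\<^esub>) ?a ?b)"
    then obtain x y where xy: "(x, y) \<in> set (zip ?a ?b)" "z = x \<oplus>\<^bsub>R\<^esub> y" by auto
    then have "x \<in> K" "y \<in> K" using cv(2) cw(2) set_zip_leftD[OF xy(1)] set_zip_rightD[OF xy(1)] by blast+
    then show "z \<in> K" using xy(2) subringE(7)[OF subfieldE(1)[OF K]] by blast
  qed
  have "map h (map2 (\<oplus>\<^bsub>R\<^esub>) ?a ?b) = map2 (\<oplus>\<^bsub>S\<^esub>) (map h ?a) (map h ?b)"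
  proof (rule nth_equalityI)
    fix i assume "i < length (map h (map2 (\<oplus>\<^bsub>R\<^esub>) ?a ?b))"
    then have i: "i < length ?a" "i < length ?b" by simp_all
    then have "?a ! i \<in> carrier R" "?b ! i \<in> carrier R"
      using cv(2) cw(2) KR nth_mem by (meson subsetD)+
    then show "map h (map2 (\<oplus>\<^bsub>R\<^esub>) ?a ?b) ! i = map2 (\<oplus>\<^bsub>S\<^esub>) (map h ?a) (map h ?b) ! i"
      using i by simp
  qed simp
  moreover have "set (map h ?a) \<subseteq> carrier S" "set (map h ?b) \<subseteq> carrier S"
    using cv(2) cw(2) KR by auto
  ultimately show "combine (map h (map2 (\<oplus>\<^bsub>R\<^esub>) ?a ?b)) Us = v \<oplus>\<^bsub>S\<^esub> w"
    using combine_add[of "map h ?a" Us "map h ?b"] cv cw basis_ind(3) by simp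
qed

lemma coordinates_smult:
  assumes "v \<in> E" "c \<in> K" "h c \<otimes>\<^bsub>S\<^esub> v \<in> E"
  shows "coordinates S K h Us (h c \<otimes>\<^bsub>S\<^esub> v) = map ((\<otimes>\<^bsub>R\<^esub>) c) (coordinates S K h Us v)"
proof (rule coordinates_eq[OF assms(3)])
  note cv = coordinates_spec[OF assms(1)]
  let ?a = "coordinates S K h Us v"
  note KR = subfieldE(3)[OF K]
  show "length (map ((\<otimes>\<^bsub>R\<^esub>) c) ?a) = length Us" using cv by simp
  show "set (map ((\<otimes>\<^bsub>R\<^esub>) c) ?a) \<subseteq> K"
    using cv(2) assms(2) subringE(6)[OF subfieldE(1)[OF K]] by auto
  have eq: "map h (map ((\<otimes>\<^bsub>R\<^esub>) c) ?a) = map ((\<otimes>\<^bsub>S\<^esub>) (h c)) (map h ?a)"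
  proof (rule nth_equalityI)
    fix i assume "i < length (map h (map ((\<otimes>\<^bsub>R\<^esub>) c) ?a))"
    then have i: "i < length ?a" by simp
    have "?a ! i \<in> carrier R" "c \<in> carrier R" using cv(2) KR assms(2) nth_mem[OF i] by blast+
    then show "map h (map ((\<otimes>\<^bsub>R\<^esub>) c) ?a) ! i = map ((\<otimes>\<^bsub>S\<^esub>) (h c)) (map h ?a) ! i"
      using i by simp
  qed simp
  have "set (map h ?a) \<subseteq> carrier S" "h c \<in> carrier S"
    using cv(2) KR assms(2) by auto
  then show "combine (map h (map ((\<otimes>\<^bsub>R\<^esub>) c) ?a)) Us = h c \<otimes>\<^bsub>S\<^esub> v"
    unfolding eq using combine_r_distr[OF _ basis_ind(3), of "map h ?a" "h c"] cv(3) by metis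
qed

end

end

lemma (in ring) identity_hom: "ring_hom_ring R R (\<lambda>c. c)"
  by (rule ring_hom_ringI) (auto intro: ring_axioms)

text \<open>Over a finite field \<open>K\<close>, the combinations of a spanning list whose length is the dimension map
  a finite set onto one of the same size, so they are unique.\<close>

lemma (in ring) spanning_list_independent:
  assumes K: "subfield K R" "finite K" and "set Us \<subseteq> carrier R"
    and "dimension (length Us) K (Span K Us)"
  shows "independent K Us"
proof (rule ccontr)
  assume "dependent K Us"
  then obtain Ks where Ks: "length Ks = length Us" "combine Ks Us = \<zero>" "set Ks \<subseteq> K" "set Ks \<noteq> {\<zero>}"
    using dependent_imp_non_trivial_combine[OF K(1) assms(3)] by metis
  let ?L = "{Ks. set Ks \<subseteq> K \<and> length Ks = length Us}"
  obtain Vs where Vs: "independent K Vs" "length Vs = length Us" "Span K Vs = Span K Us"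
    using exists_base[OF K(1) assms(4)] by blast
  have finL: "finite ?L" by (rule finite_lists_length_eq[OF K(2)])
  have img: "(\<lambda>Ks. combine Ks Us) ` ?L = Span K Us"
    using Span_eq_combine_set_length_version[OF K(1) assms(3)] by auto
  have "card ?L = card (Span K Us)"
    using bij_betw_same_card[OF bij_betw_combine[OF K(1) Vs(1)]] Vs(2,3) by simp
  then have "inj_on (\<lambda>Ks. combine Ks Us) ?L" using img finL by (intro eq_card_imp_inj_on) auto
  moreover have "replicate (length Us) \<zero> \<in> ?L" using subringE(2)[OF subfieldE(1)[OF K(1)]] by auto
  moreover have "combine (replicate (length Us) \<zero>) Us = \<zero>" by (rule combine_replicate[OF assms(3)])
  ultimately have eq: "Ks = replicate (length Us) \<zero>" using Ks inj_onD[of "\<lambda>Ks. combine Ks Us" ?L Ks] by simp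
  then have "Us = []" using Ks(4) by (cases Us) auto
  then show False using \<open>dependent K Us\<close> by simp
qed

lemma (in ring) finsum_swap:
  assumes "finite A" "finite B" "\<And>i j. i \<in> A \<Longrightarrow> j \<in> B \<Longrightarrow> f i j \<in> carrier R"
  shows "(\<Oplus>i\<in>A. \<Oplus>j\<in>B. f i j) = (\<Oplus>j\<in>B. \<Oplus>i\<in>A. f i j)"
  using assms(1,3)
proof (induction A rule: finite_induct)
  case empty
  then show ?case by simp
next
  case (insert a A)
  have 1: "(\<Oplus>i\<in>insert a A. \<Oplus>j\<in>B. f i j) = (\<Oplus>j\<in>B. f a j) \<oplus> (\<Oplus>i\<in>A. \<Oplus>j\<in>B. f i j)"
    using insert by (intro finsum_insert) (auto intro!: finsum_closed)
  have "(\<Oplus>j\<in>B. \<Oplus>i\<in>insert a A. f i j) = (\<Oplus>j\<in>B. f a j \<oplus> (\<Oplus>i\<in>A. f i j))"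
  proof (rule finsum_cong'[OF refl])
    show "(\<lambda>j. f a j \<oplus> (\<Oplus>i\<in>A. f i j)) \<in> B \<rightarrow> carrier R"
      using insert by (auto intro!: finsum_closed)
    show "(\<Oplus>i\<in>insert a A. f i j) = f a j \<oplus> (\<Oplus>i\<in>A. f i j)" if "j \<in> B" for j
      using insert that by (intro finsum_insert) auto
  qed
  also have "\<dots> = (\<Oplus>j\<in>B. f a j) \<oplus> (\<Oplus>j\<in>B. \<Oplus>i\<in>A. f i j)"
    using insert by (intro finsum_addf) (auto intro!: finsum_closed)
  finally show ?case using 1 insert by simp
qed

section \<open>Matrices of the multiplication algorithm\<close>

text \<open>Uniqueness of the right inverse enters as a hypothesis; for the evaluation matrix it comes from
  reading the columns of a right inverse as functions.\<close>

lemma m_inv_eqI: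
  fixes G (structure)
  assumes "y \<in> carrier G" "x \<otimes> y = \<one>" "y \<otimes> x = \<one>"
    and "\<And>z. z \<in> carrier G \<Longrightarrow> x \<otimes> z = \<one> \<Longrightarrow> z = y"
  shows "inv x = y"
  unfolding m_inv_def
proof (rule the_equality)
  show "y \<in> carrier G \<and> x \<otimes> y = \<one> \<and> y \<otimes> x = \<one>" using assms(1-3) by blast
  show "z = y" if "z \<in> carrier G \<and> x \<otimes> z = \<one> \<and> z \<otimes> x = \<one>" for z
    using that assms(4) by blast
qed

lemma mat_mult_index:
  "i < dim_row A \<Longrightarrow> j < dim_col B \<Longrightarrow>
    mat_mult R A B $$ (i, j) = (\<Oplus>\<^bsub>R\<^esub>k\<in>{..<dim_col A}. A $$ (i, k) \<otimes>\<^bsub>R\<^esub> B $$ (k, j))"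
  by (simp add: mat_mult_def)

context chudnovsky
begin

lemma dim_L2: "dimension N K L2"
  using dim_RR(1)[OF finite_L2] length_Ps by simp

lemma canonical_basis_nth:
  "j < N \<Longrightarrow> canonical_basis F N ! j = map (\<lambda>i. if i = j then \<one> else \<zero>) [0..<N]"
  by (simp add: canonical_basis_def)

lemma canonical_basis_K: "j < N \<Longrightarrow> canonical_basis F N ! j \<in> {v. set v \<subseteq> K \<and> length v = N}"
  using subringE(2,3)[OF subfieldE(1)[OF K_subfield]] by (auto simp: canonical_basis_nth)

lemma length_canonical_basis: "length (canonical_basis F N) = N"
  by (simp add: canonical_basis_def)

lemma K_carrier: "c \<in> K \<Longrightarrow> c \<in> carrier F"
  using subfieldE(3)[OF K_subfield] by blast

text \<open>The functions in \<open>L(2D)\<close> that take the value one at one of the places and vanish at the others;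
  they are the preimages of the canonical basis under \<open>Ev\<^sub>P\<close>.\<close>

definition dual_vec where "dual_vec j = inv_into L2 ev (canonical_basis F N ! j)"

lemma canonical_basis_img: "j < N \<Longrightarrow> canonical_basis F N ! j \<in> ev ` L2"
  using ev_bij canonical_basis_K by (simp add: bij_betw_def)

lemma dual_vec_L2: "j < N \<Longrightarrow> dual_vec j \<in> L2"
  unfolding dual_vec_def by (rule inv_into_into[OF canonical_basis_img])

lemma eval_dual_vec:
  assumes "i < N" "j < N"
  shows "eval_at F K (Ps ! i) (dual_vec j) = (if i = j then \<one> else \<zero>)"
proof -
  have "ev (dual_vec j) = canonical_basis F N ! j"
    unfolding dual_vec_def by (rule f_inv_into_f[OF canonical_basis_img[OF assms(2)]])
  then have "ev (dual_vec j) ! i = canonical_basis F N ! j ! i" by (rule arg_cong)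
  then show ?thesis using assms by (simp add: eval_tuple_def canonical_basis_nth)
qed

lemma L2_functional_combine:
  assumes "\<And>v. v \<in> L2 \<Longrightarrow> \<phi> v \<in> K" "\<And>v w. v \<in> L2 \<Longrightarrow> w \<in> L2 \<Longrightarrow> \<phi> (v \<oplus> w) = \<phi> v \<oplus> \<phi> w"
      "\<And>c v. c \<in> K \<Longrightarrow> v \<in> L2 \<Longrightarrow> \<phi> (c \<otimes> v) = c \<otimes> \<phi> v"
    and "length cs = length Us" "set cs \<subseteq> K" "set Us \<subseteq> L2"
  shows "\<phi> (combine cs Us) = (\<Oplus>i\<in>{..<length Us}. \<phi> (Us ! i) \<otimes> cs ! i)"
  by (rule linear_functional_combine[OF K_subfield RR_subalgebra]) (fact assms)+

lemma eval_combine: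
  assumes "i < N" "length cs = length Us" "set cs \<subseteq> K" "set Us \<subseteq> L2"
  shows "eval_at F K (Ps ! i) (combine cs Us) = (\<Oplus>k\<in>{..<length Us}. eval_at F K (Ps ! i) (Us ! k) \<otimes> cs ! k)"
  by (rule L2_functional_combine) (use assms eval_L2 eval_L2_add eval_L2_smult in auto)

lemma L2_add: "v \<in> L2 \<Longrightarrow> u \<in> L2 \<Longrightarrow> v \<oplus> u \<in> L2"
  using subalgebra.axioms(1)[OF RR_subalgebra, of "frag_cmul 2 D"] add.subgroupE(4) by blast

lemma L2_smult: "c \<in> K \<Longrightarrow> v \<in> L2 \<Longrightarrow> c \<otimes> v \<in> L2"
  using subalgebra.smult_closed[OF RR_subalgebra] by blast

text \<open>The \<open>i\<close>-th coordinate functional of the residue at \<open>Q\<close>; row \<open>i\<close> of the matrix \<open>C\<close>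
  consists of its values on the basis.\<close>

definition residue_coord :: "'a set list \<Rightarrow> nat \<Rightarrow> 'a \<Rightarrow> 'a"
  where "residue_coord BQ i f = coordinates Q.RF K Q.res BQ (Q.res f) ! i"

lemma residue_coord_linear:
  assumes BQ: "is_residue_basis F K Q BQ" and i: "i < length BQ"
  shows "v \<in> L2 \<Longrightarrow> residue_coord BQ i v \<in> K"
    and "v \<in> L2 \<Longrightarrow> u \<in> L2 \<Longrightarrow> residue_coord BQ i (v \<oplus> u) = residue_coord BQ i v \<oplus> residue_coord BQ i u"
    and "c \<in> K \<Longrightarrow> v \<in> L2 \<Longrightarrow> residue_coord BQ i (c \<otimes> v) = c \<otimes> residue_coord BQ i v"
proof -
  interpret RF: field Q.RF by (rule Q.RF_field)
  interpret H: ring_hom_ring Q.VR Q.RF Q.res by (rule Q.res_hom)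
  have basis: "is_basis Q.RF (Q.res ` K) (carrier Q.RF) BQ" using BQ by (simp add: is_residue_basis_def)
  note * = Q.K_subfield_VR RF.one_not_zero basis
  have L2V: "x \<in> Q.V" if "x \<in> L2" for x using that L2_subset_Q by blast
  have rc: "Q.res x \<in> carrier Q.RF" if "x \<in> L2" for x using L2V[OF that] Q.RF_carrier by blast
  note spec = H.coordinates_spec[OF *]
  show "residue_coord BQ i v \<in> K" if v: "v \<in> L2" for v
    using spec(1,2)[OF rc[OF v]] i nth_mem unfolding residue_coord_def by (metis subsetD)
  show "residue_coord BQ i (v \<oplus> u) = residue_coord BQ i v \<oplus> residue_coord BQ i u"
    if v: "v \<in> L2" and u: "u \<in> L2" for v u
  proof -
    have eq: "Q.res (v \<oplus> u) = Q.res v \<oplus>\<^bsub>Q.RF\<^esub> Q.res u" using H.hom_add[of v u] L2V v u by simp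
    have "Q.res v \<oplus>\<^bsub>Q.RF\<^esub> Q.res u \<in> carrier Q.RF" using rc[OF v] rc[OF u] by simp
    from H.coordinates_add[OF * rc[OF v] rc[OF u] this]
    show ?thesis unfolding residue_coord_def eq using i spec(1)[OF rc[OF v]] spec(1)[OF rc[OF u]] by simp
  qed
  show "residue_coord BQ i (c \<otimes> v) = c \<otimes> residue_coord BQ i v" if c: "c \<in> K" and v: "v \<in> L2" for c v
  proof -
    have cV: "c \<in> Q.V" using c Q.K_V by blast
    have eq: "Q.res (c \<otimes> v) = Q.res c \<otimes>\<^bsub>Q.RF\<^esub> Q.res v" using H.hom_mult[of c v] L2V v cV by simp
    have "Q.res c \<in> carrier Q.RF" using cV Q.RF_carrier by blast
    then have "Q.res c \<otimes>\<^bsub>Q.RF\<^esub> Q.res v \<in> carrier Q.RF" using rc[OF v] by (rule RF.m_closed)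
    from H.coordinates_smult[OF * rc[OF v] c this]
    show ?thesis unfolding residue_coord_def eq using i spec(1)[OF rc[OF v]] by simp
  qed
qed

context
  fixes B
  assumes B: "is_basis F K L2 B"
begin

abbreviation coord where "coord \<equiv> coordinates F K (\<lambda>c. c) B"

lemma B_props: "independent K B" "Span K B = L2" "set B \<subseteq> carrier F" "set B \<subseteq> L2" "length B = N"
proof -
  show ind: "independent K B" and span: "Span K B = L2" using B by (simp_all add: is_basis_def)
  show c: "set B \<subseteq> carrier F" using independent_in_carrier[OF ind] .
  show "set B \<subseteq> L2" using Span_base_incl[OF K_subfield c] span by simp
  show "length B = N" using dimension_is_inj[OF K_subfield dimensionI[OF K_subfield ind span] dim_L2] .
qed

lemma B_nth: "k < N \<Longrightarrow> B ! k \<in> L2"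
  using B_props(4,5) nth_mem[of k B] by auto

lemma coord:
  assumes "v \<in> L2"
  shows "length (coord v) = N" "set (coord v) \<subseteq> K" "combine (coord v) B = v"
    "length cs = N \<Longrightarrow> set cs \<subseteq> K \<Longrightarrow> combine cs B = v \<Longrightarrow> coord v = cs"
    "u \<in> L2 \<Longrightarrow> coord (v \<oplus> u) = map2 (\<oplus>) (coord v) (coord u)"
    "c \<in> K \<Longrightarrow> coord (c \<otimes> v) = map ((\<otimes>) c) (coord v)"
proof -
  interpret H: ring_hom_ring F F "\<lambda>c. c" by (rule identity_hom)
  have "is_basis F ((\<lambda>c. c) ` K) L2 B" using B by simp
  note * = K_subfield one_not_zero this
  show "length (coord v) = N" "set (coord v) \<subseteq> K" "combine (coord v) B = v"
    using H.coordinates_spec[OF * assms] B_props(5) by simp_all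
  show "length cs = N \<Longrightarrow> set cs \<subseteq> K \<Longrightarrow> combine cs B = v \<Longrightarrow> coord v = cs"
    using H.coordinates_eq[OF * assms, of cs] B_props(5) by simp
  show "u \<in> L2 \<Longrightarrow> coord (v \<oplus> u) = map2 (\<oplus>) (coord v) (coord u)"
    using H.coordinates_add[OF * assms] L2_add[OF assms] by blast
  show "c \<in> K \<Longrightarrow> coord (c \<otimes> v) = map ((\<otimes>) c) (coord v)"
    using H.coordinates_smult[OF * assms] L2_smult[OF _ assms] by blast
qed

lemma coord_nth_K: "v \<in> L2 \<Longrightarrow> k < N \<Longrightarrow> coord v ! k \<in> K"
  using coord(1,2)[of v] nth_mem[of k "coord v"] by auto

text \<open>The key to the independence of the basis: a row of values of a linear functional on the basis,
  multiplied by the column of coordinates of \<open>v\<close>, is the value at \<open>v\<close>, whatever the basis is.\<close>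

lemma functional_product:
  assumes "\<And>v. v \<in> L2 \<Longrightarrow> \<phi> v \<in> K" "\<And>v w. v \<in> L2 \<Longrightarrow> w \<in> L2 \<Longrightarrow> \<phi> (v \<oplus> w) = \<phi> v \<oplus> \<phi> w"
      "\<And>c v. c \<in> K \<Longrightarrow> v \<in> L2 \<Longrightarrow> \<phi> (c \<otimes> v) = c \<otimes> \<phi> v"
    and v: "v \<in> L2"
  shows "(\<Oplus>k\<in>{..<N}. \<phi> (B ! k) \<otimes> coord v ! k) = \<phi> v"
  using L2_functional_combine[of \<phi>, OF assms(1-3), of "coord v" B] coord(1-3)[OF v] B_props by simp

lemma T_mat_eq: "T_mat F K Ps B = mat N N (\<lambda>(i, k). eval_at F K (Ps ! i) (B ! k))"
  by (rule eq_matI) (auto simp: T_mat_def matrix_of_def eval_tuple_def B_props)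

lemma C_mat_eq: "C_mat F K Q BQ B = mat (length BQ) N (\<lambda>(i, k). residue_coord BQ i (B ! k))"
  by (rule eq_matI) (auto simp: C_mat_def matrix_of_def residue_coord_def B_props)

lemma EvP_inv_mat_eq: "EvP_inv_mat F K D Ps B = mat N N (\<lambda>(k, j). coord (dual_vec j) ! k)"
  by (rule eq_matI) (auto simp: EvP_inv_mat_def matrix_of_def dual_vec_def B_props length_canonical_basis)

lemma UA_mat_eq:
  assumes BQ: "is_residue_basis F K Q BQ"
  shows "UA_mat F K Q D Ps BQ B =
    mat N (length BQ) (\<lambda>(i, j). eval_at F K (Ps ! i) (inv_into (RR F K D) Q.res (BQ ! j)))"
proof (rule eq_matI)
  let ?R = "mat N (length BQ) (\<lambda>(i, j). eval_at F K (Ps ! i) (inv_into (RR F K D) Q.res (BQ ! j)))"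
  show "dim_row (UA_mat F K Q D Ps BQ B) = dim_row ?R" "dim_col (UA_mat F K Q D Ps BQ B) = dim_col ?R"
    by (simp_all add: UA_mat_def mat_mult_def T_mat_def EvQ_inv_mat_def matrix_of_def)
  fix i j assume "i < dim_row ?R" "j < dim_col ?R"
  then have i: "i < N" and j: "j < length BQ" by simp_all
  let ?v = "inv_into (RR F K D) Q.res (BQ ! j)"
  interpret RF: field Q.RF by (rule Q.RF_field)
  have "RF.independent (Q.res ` K) BQ" using BQ by (simp add: is_residue_basis_def is_basis_def)
  then have "BQ ! j \<in> carrier Q.RF" using RF.independent_in_carrier j nth_mem by blast
  then have "?v \<in> RR F K D" using EvQ_surj by (intro inv_into_into) simp
  then have v: "?v \<in> L2" using RR_D_subset by blast
  have EvQ: "EvQ_inv_mat F K Q D BQ B = mat N (length BQ) (\<lambda>(k, j). coord (inv_into (RR F K D) Q.res (BQ ! j)) ! k)"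
    by (rule eq_matI) (auto simp: EvQ_inv_mat_def matrix_of_def B_props)
  have "UA_mat F K Q D Ps BQ B $$ (i, j) =
      (\<Oplus>k\<in>{..<N}. T_mat F K Ps B $$ (i, k) \<otimes> EvQ_inv_mat F K Q D BQ B $$ (k, j))"
    unfolding UA_mat_def using i j by (subst mat_mult_index) (simp_all add: T_mat_eq EvQ)
  also have "\<dots> = (\<Oplus>k\<in>{..<N}. eval_at F K (Ps ! i) (B ! k) \<otimes> coord ?v ! k)"
  proof (rule finsum_cong'[OF refl])
    show "(\<lambda>k. eval_at F K (Ps ! i) (B ! k) \<otimes> coord ?v ! k) \<in> {..<N} \<rightarrow> carrier F"
      using eval_L2[OF i B_nth] coord_nth_K[OF v] K_carrier by blast
  qed (use i j in \<open>simp add: T_mat_eq EvQ\<close>)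
  also have "\<dots> = eval_at F K (Ps ! i) ?v"
    by (rule functional_product[OF _ _ _ v]) (use i eval_L2 eval_L2_add eval_L2_smult in auto)
  finally show "UA_mat F K Q D Ps BQ B $$ (i, j) = ?R $$ (i, j)" using i j by simp
qed

lemma UR_mat_eq:
  assumes BQ: "is_residue_basis F K Q BQ"
  shows "UR_mat F K Q D Ps BQ B = mat (length BQ) N (\<lambda>(i, j). residue_coord BQ i (dual_vec j))"
proof (rule eq_matI)
  let ?R = "mat (length BQ) N (\<lambda>(i, j). residue_coord BQ i (dual_vec j))"
  show "dim_row (UR_mat F K Q D Ps BQ B) = dim_row ?R" "dim_col (UR_mat F K Q D Ps BQ B) = dim_col ?R"
    by (simp_all add: UR_mat_def mat_mult_def C_mat_eq EvP_inv_mat_eq)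
  fix i j assume "i < dim_row ?R" "j < dim_col ?R"
  then have i: "i < length BQ" and j: "j < N" by simp_all
  note lin = residue_coord_linear[OF BQ i]
  have "UR_mat F K Q D Ps BQ B $$ (i, j) =
      (\<Oplus>k\<in>{..<N}. C_mat F K Q BQ B $$ (i, k) \<otimes> EvP_inv_mat F K D Ps B $$ (k, j))"
    unfolding UR_mat_def using i j by (subst mat_mult_index) (simp_all add: C_mat_eq EvP_inv_mat_eq)
  also have "\<dots> = (\<Oplus>k\<in>{..<N}. residue_coord BQ i (B ! k) \<otimes> coord (dual_vec j) ! k)"
  proof (rule finsum_cong'[OF refl])
    show "(\<lambda>k. residue_coord BQ i (B ! k) \<otimes> coord (dual_vec j) ! k) \<in> {..<N} \<rightarrow> carrier F"
      using lin(1)[OF B_nth] coord_nth_K[OF dual_vec_L2[OF j]] K_carrier by blast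
  qed (use i j in \<open>simp add: C_mat_eq EvP_inv_mat_eq\<close>)
  also have "\<dots> = residue_coord BQ i (dual_vec j)"
    by (rule functional_product[OF _ _ _ dual_vec_L2[OF j]]) (use lin in auto)
  finally show "UR_mat F K Q D Ps BQ B $$ (i, j) = ?R $$ (i, j)" using i j by simp
qed

abbreviation identity_mat where "identity_mat \<equiv> mat N N (\<lambda>(i, j). if i = j then \<one> else \<zero>)"
abbreviation T where "T \<equiv> T_mat F K Ps B"
abbreviation S where "S \<equiv> EvP_inv_mat F K D Ps B"

text \<open>Interpolation: a function in \<open>L(2D)\<close> is determined by its values at the places.\<close>

lemma combine_eval_dual_vec:
  assumes "v \<in> L2"
  shows "combine (ev v) (map dual_vec [0..<N]) = v"
proof -
  have ws: "set (map dual_vec [0..<N]) \<subseteq> L2" using dual_vec_L2 by auto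
  have evK: "length (ev v) = length (map dual_vec [0..<N])" "set (ev v) \<subseteq> K" using ev_in_lists assms by auto
  have L: "combine (ev v) (map dual_vec [0..<N]) \<in> L2"
    by (rule subalgebra_combine[OF K_subfield RR_subalgebra evK(2) ws evK(1)])
  have "ev (combine (ev v) (map dual_vec [0..<N])) = ev v"
  proof (rule nth_equalityI)
    fix i assume "i < length (ev (combine (ev v) (map dual_vec [0..<N])))"
    then have i: "i < N" by (simp add: eval_tuple_def)
    have evi: "ev v ! k \<in> carrier F" if "k < N" for k
    proof -
      have "ev v ! k \<in> set (ev v)" using that evK(1) by simp
      then show ?thesis using evK(2) K_carrier by blast
    qed
    have "eval_at F K (Ps ! i) (combine (ev v) (map dual_vec [0..<N])) =
        (\<Oplus>k\<in>{..<N}. eval_at F K (Ps ! i) (map dual_vec [0..<N] ! k) \<otimes> ev v ! k)"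
      using eval_combine[OF i evK ws] by simp
    also have "\<dots> = (\<Oplus>k\<in>{..<N}. if i = k then ev v ! k else \<zero>)"
      by (rule finsum_cong'[OF refl]) (use evi i eval_dual_vec in auto)
    also have "\<dots> = ev v ! i" by (rule finsum_singleton) (use i evi in auto)
    finally show "ev (combine (ev v) (map dual_vec [0..<N])) ! i = ev v ! i"
      using i by (simp add: eval_tuple_def)
  qed (simp add: eval_tuple_def)
  then show ?thesis using inj_onD[OF EvP_inj] L assms by blast
qed

lemma T_S: "mat_mult F T S = identity_mat"
proof (rule eq_matI)
  fix i j assume "i < dim_row identity_mat" "j < dim_col identity_mat"
  then have i: "i < N" and j: "j < N" by simp_all
  have "mat_mult F T S $$ (i, j) = (\<Oplus>k\<in>{..<N}. T $$ (i, k) \<otimes> S $$ (k, j))"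
    using i j by (subst mat_mult_index) (simp_all add: T_mat_eq EvP_inv_mat_eq)
  also have "\<dots> = (\<Oplus>k\<in>{..<N}. eval_at F K (Ps ! i) (B ! k) \<otimes> coord (dual_vec j) ! k)"
  proof (rule finsum_cong'[OF refl])
    show "(\<lambda>k. eval_at F K (Ps ! i) (B ! k) \<otimes> coord (dual_vec j) ! k) \<in> {..<N} \<rightarrow> carrier F"
      using eval_L2[OF i B_nth] coord_nth_K[OF dual_vec_L2[OF j]] K_carrier by blast
  qed (use i j in \<open>simp add: T_mat_eq EvP_inv_mat_eq\<close>)
  also have "\<dots> = eval_at F K (Ps ! i) (dual_vec j)"
    by (rule functional_product[OF _ _ _ dual_vec_L2[OF j]]) (use i eval_L2 eval_L2_add eval_L2_smult in auto)
  finally show "mat_mult F T S $$ (i, j) = identity_mat $$ (i, j)" using i j eval_dual_vec by simp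
qed (simp_all add: mat_mult_def T_mat_eq EvP_inv_mat_eq)

text \<open>The \<open>i\<close>-th coordinate functional is applied to the interpolation formula of the \<open>j\<close>-th
  basis vector.\<close>

lemma S_T: "mat_mult F S T = identity_mat"
proof (rule eq_matI)
  fix i j assume "i < dim_row identity_mat" "j < dim_col identity_mat"
  then have i: "i < N" and j: "j < N" by simp_all
  have ws: "set (map dual_vec [0..<N]) \<subseteq> L2" using dual_vec_L2 by auto
  have evK: "length (ev (B ! j)) = length (map dual_vec [0..<N])" "set (ev (B ! j)) \<subseteq> K"
    using ev_in_lists B_nth[OF j] by auto
  have "mat_mult F S T $$ (i, j) = (\<Oplus>k\<in>{..<N}. S $$ (i, k) \<otimes> T $$ (k, j))"
    using i j by (subst mat_mult_index) (simp_all add: T_mat_eq EvP_inv_mat_eq)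
  also have "\<dots> = (\<Oplus>k\<in>{..<N}. coord (map dual_vec [0..<N] ! k) ! i \<otimes> ev (B ! j) ! k)"
  proof (rule finsum_cong'[OF refl])
    have "coord (map dual_vec [0..<N] ! k) ! i \<in> carrier F" "ev (B ! j) ! k \<in> carrier F" if "k < N" for k
      using that coord_nth_K[OF dual_vec_L2[OF that] i] eval_L2[OF that B_nth[OF j]] K_carrier
      by (simp_all add: eval_tuple_def)
    then show "(\<lambda>k. coord (map dual_vec [0..<N] ! k) ! i \<otimes> ev (B ! j) ! k) \<in> {..<N} \<rightarrow> carrier F" by simp
  qed (use i j in \<open>simp add: T_mat_eq EvP_inv_mat_eq eval_tuple_def\<close>)
  also have "\<dots> = coord (combine (ev (B ! j)) (map dual_vec [0..<N])) ! i"
  proof -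
    have "coord (combine (ev (B ! j)) (map dual_vec [0..<N])) ! i =
        (\<Oplus>k\<in>{..<length (map dual_vec [0..<N])}. coord (map dual_vec [0..<N] ! k) ! i \<otimes> ev (B ! j) ! k)"
    proof (rule L2_functional_combine[OF _ _ _ evK ws])
      show "coord v ! i \<in> K" if "v \<in> L2" for v using coord_nth_K[OF that i] .
      show "coord (v \<oplus> u) ! i = coord v ! i \<oplus> coord u ! i" if "v \<in> L2" "u \<in> L2" for v u
        using coord(1)[OF that(1)] coord(1)[OF that(2)] coord(5)[OF that] i by simp
      show "coord (c \<otimes> v) ! i = c \<otimes> coord v ! i" if "c \<in> K" "v \<in> L2" for c v
        using coord(1)[OF that(2)] coord(6)[OF that(2,1)] i by simp
    qed
    then show ?thesis by simp
  qed
  also have "\<dots> = coord (B ! j) ! i" using combine_eval_dual_vec[OF B_nth[OF j]] by simp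
  also have "coord (B ! j) = map (\<lambda>k. if k = j then \<one> else \<zero>) [0..<N]"
  proof (rule coord(4)[OF B_nth[OF j]])
    let ?e = "map (\<lambda>k. if k = j then \<one> else \<zero>) [0..<N]"
    show "set ?e \<subseteq> K" using subringE(2,3)[OF subfieldE(1)[OF K_subfield]] by auto
    have Bk: "B ! k \<in> carrier F" if "k < N" for k using B_nth[OF that] L2_carrier by blast
    have "combine ?e B = (\<Oplus>k\<in>{..<N}. ?e ! k \<otimes> B ! k)"
      using combine_eq_finsum[of ?e B] B_props(3,5) by auto
    also have "\<dots> = (\<Oplus>k\<in>{..<N}. if j = k then B ! k else \<zero>)"
      by (rule finsum_cong'[OF refl]) (use Bk in auto)
    also have "\<dots> = B ! j" by (rule finsum_singleton) (use j Bk in auto)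
    finally show "combine ?e B = B ! j" .
  qed simp
  finally show "mat_mult F S T $$ (i, j) = identity_mat $$ (i, j)" using i j by simp
qed (simp_all add: mat_mult_def T_mat_eq EvP_inv_mat_eq)

lemma T_carrier: "T \<in> carrier (sq_mat_monoid F K N)"
  using eval_L2[OF _ B_nth] by (auto simp: sq_mat_monoid_def T_mat_eq dest!: elements_matD)

lemma S_carrier: "S \<in> carrier (sq_mat_monoid F K N)"
  using coord_nth_K[OF dual_vec_L2] by (auto simp: sq_mat_monoid_def EvP_inv_mat_eq dest!: elements_matD)

lemma T_GL: "T \<in> GL F K N"
  using T_carrier S_carrier T_S S_T unfolding GL_def Units_def by (auto simp: sq_mat_monoid_def)

text \<open>A column of a right inverse of \<open>T\<close> consists of the coordinates of a function with the values of
  a dual vector, so it is the corresponding column of \<open>S\<close>.\<close>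

lemma mat_inv_T: "mat_inv F K T = S"
proof -
  have dim: "dim_row T = N" by (simp add: T_mat_eq)
  show ?thesis unfolding mat_inv_def dim
  proof (rule m_inv_eqI)
    fix Y assume Y: "Y \<in> carrier (sq_mat_monoid F K N)"
      "T \<otimes>\<^bsub>sq_mat_monoid F K N\<^esub> Y = \<one>\<^bsub>sq_mat_monoid F K N\<^esub>"
    then have Yc: "Y \<in> carrier_mat N N" "elements_mat Y \<subseteq> K" and TY: "mat_mult F T Y = identity_mat"
      by (auto simp: sq_mat_monoid_def)
    have YK: "Y $$ (k, j) \<in> K" if "k < N" "j < N" for k j
      using that Yc elements_matI[OF Yc(1) that refl] by blast
    have col: "map (\<lambda>k. Y $$ (k, j)) [0..<N] = coord (dual_vec j)" if j: "j < N" for j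
    proof -
      let ?c = "map (\<lambda>k. Y $$ (k, j)) [0..<N]"
      have cK: "set ?c \<subseteq> K" "length ?c = length B" using YK j B_props(5) by auto
      have L: "combine ?c B \<in> L2"
        by (rule subalgebra_combine[OF K_subfield RR_subalgebra cK(1) B_props(4) cK(2)])
      have "ev (combine ?c B) = ev (dual_vec j)"
      proof (rule nth_equalityI)
        fix i assume "i < length (ev (combine ?c B))"
        then have i: "i < N" by (simp add: eval_tuple_def)
        have "eval_at F K (Ps ! i) (combine ?c B) = (\<Oplus>k\<in>{..<N}. eval_at F K (Ps ! i) (B ! k) \<otimes> ?c ! k)"
          using eval_combine[OF i cK(2,1) B_props(4)] B_props(5) by simp
        also have "\<dots> = (\<Oplus>k\<in>{..<N}. T $$ (i, k) \<otimes> Y $$ (k, j))"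
        proof (rule finsum_cong'[OF refl])
          show "(\<lambda>k. T $$ (i, k) \<otimes> Y $$ (k, j)) \<in> {..<N} \<rightarrow> carrier F"
            using eval_L2[OF i B_nth] YK[OF _ j] K_carrier i by (auto simp: T_mat_eq)
        qed (use i in \<open>simp add: T_mat_eq\<close>)
        also have "\<dots> = mat_mult F T Y $$ (i, j)"
          using i j Yc(1) by (subst mat_mult_index) (auto simp: T_mat_eq)
        also have "\<dots> = eval_at F K (Ps ! i) (dual_vec j)" using TY i j eval_dual_vec by simp
        finally show "ev (combine ?c B) ! i = ev (dual_vec j) ! i" using i by (simp add: eval_tuple_def)
      qed (simp add: eval_tuple_def)
      then have "combine ?c B = dual_vec j" using inj_onD[OF EvP_inj] L dual_vec_L2[OF j] by blast
      then show ?thesis using coord(4)[OF dual_vec_L2[OF j], of ?c] cK by simp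
    qed
    show "Y = S"
    proof (rule eq_matI)
      fix i j assume "i < dim_row S" "j < dim_col S"
      then have i: "i < N" and j: "j < N" by (simp_all add: EvP_inv_mat_eq)
      have "Y $$ (i, j) = map (\<lambda>k. Y $$ (k, j)) [0..<N] ! i" using i by simp
      also have "\<dots> = S $$ (i, j)" unfolding col[OF j] using i j by (simp add: EvP_inv_mat_eq)
      finally show "Y $$ (i, j) = S $$ (i, j)" .
    qed (use Yc(1) in \<open>auto simp: EvP_inv_mat_eq\<close>)
  qed (use S_carrier T_S S_T in \<open>auto simp: sq_mat_monoid_def\<close>)
qed

lemma CT_inv_eq: "CT_inv F K Q Ps BQ B = UR_mat F K Q D Ps BQ B"
  by (simp add: CT_inv_def UR_mat_def mat_inv_T)

text \<open>The inverse matrix expresses the old basis vectors as combinations of the new ones, so the new list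
  spans \<open>L(2D)\<close>, and its length is the dimension.\<close>

lemma act_basis_is_basis:
  assumes A: "A \<in> GL F K N"
  shows "is_basis F K L2 (act_basis F A B)"
proof -
  obtain A' where A': "A' \<in> carrier_mat N N" "elements_mat A' \<subseteq> K" "mat_mult F A A' = identity_mat"
    and Ac: "A \<in> carrier_mat N N" "elements_mat A \<subseteq> K"
    using A by (auto simp: GL_def Units_def sq_mat_monoid_def)
  have AK: "A $$ (k, j) \<in> K" if "k < N" "j < N" for k j
    using Ac(2) elements_matI[OF Ac(1) that refl] by blast
  have A'K: "A' $$ (k, j) \<in> K" if "k < N" "j < N" for k j
    using A'(2) elements_matI[OF A'(1) that refl] by blast
  have BF: "B ! k \<in> carrier F" if "k < N" for k using B_nth[OF that] L2_carrier by blast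
  let ?C = "act_basis F A B"
  have len: "length ?C = N" by (simp add: act_basis_def B_props(5))
  have nth: "?C ! j = (\<Oplus>i\<in>{..<N}. A $$ (i, j) \<otimes> B ! i)" if "j < N" for j
    using that by (simp add: act_basis_def B_props(5))
  have C_L2: "?C ! j \<in> L2" if j: "j < N" for j
  proof -
    let ?c = "map (\<lambda>i. A $$ (i, j)) [0..<N]"
    have c: "set ?c \<subseteq> K" "length ?c = length B" using AK j B_props(5) by auto
    have "combine ?c B = (\<Oplus>i\<in>{..<N}. ?c ! i \<otimes> B ! i)"
      using combine_eq_finsum[OF c(2) _ B_props(3)] c(1) K_carrier B_props(5) by auto
    also have "\<dots> = ?C ! j"
      unfolding nth[OF j] by (rule finsum_cong'[OF refl]) (use AK[OF _ j] K_carrier BF in auto)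
    finally show ?thesis
      using subalgebra_combine[OF K_subfield RR_subalgebra c(1) B_props(4) c(2)] by simp
  qed
  have CL: "set ?C \<subseteq> L2" using C_L2 len by (auto simp: in_set_conv_nth)
  then have CF: "set ?C \<subseteq> carrier F" using L2_carrier by blast
  have B_comb: "B ! j \<in> Span K ?C" if j: "j < N" for j
  proof -
    let ?c = "map (\<lambda>i. A' $$ (i, j)) [0..<N]"
    have c: "set ?c \<subseteq> K" "length ?c = length ?C" using A'K j len by auto
    have m: "A $$ (k, i) \<in> carrier F" "A' $$ (i, j) \<in> carrier F" if "k < N" "i < N" for k i
      using AK[OF that] A'K[OF that(2) j] K_carrier by blast+
    have "combine ?c ?C = (\<Oplus>i\<in>{..<N}. ?c ! i \<otimes> ?C ! i)"
      using combine_eq_finsum[OF c(2) _ CF] c(1) K_carrier len by auto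
    also have "\<dots> = (\<Oplus>i\<in>{..<N}. \<Oplus>k\<in>{..<N}. A' $$ (i, j) \<otimes> (A $$ (k, i) \<otimes> B ! k))"
    proof (rule finsum_cong'[OF refl])
      show "(\<lambda>i. \<Oplus>k\<in>{..<N}. A' $$ (i, j) \<otimes> (A $$ (k, i) \<otimes> B ! k)) \<in> {..<N} \<rightarrow> carrier F"
        using m BF by (auto intro!: finsum_closed)
      show "?c ! i \<otimes> ?C ! i = (\<Oplus>k\<in>{..<N}. A' $$ (i, j) \<otimes> (A $$ (k, i) \<otimes> B ! k))"
        if "i \<in> {..<N}" for i
        using that m BF by (simp add: nth finsum_rdistr Pi_def)
    qed
    also have "\<dots> = (\<Oplus>k\<in>{..<N}. \<Oplus>i\<in>{..<N}. A' $$ (i, j) \<otimes> (A $$ (k, i) \<otimes> B ! k))"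
      by (rule finsum_swap) (use m BF in auto)
    also have "\<dots> = (\<Oplus>k\<in>{..<N}. if j = k then B ! k else \<zero>)"
    proof (rule finsum_cong'[OF refl])
      fix k assume "k \<in> {..<N}"
      then have k: "k < N" by simp
      have "(\<Oplus>i\<in>{..<N}. A' $$ (i, j) \<otimes> (A $$ (k, i) \<otimes> B ! k)) =
          (\<Oplus>i\<in>{..<N}. (A $$ (k, i) \<otimes> A' $$ (i, j)) \<otimes> B ! k)"
        by (rule finsum_cong'[OF refl]) (use m[OF k] BF[OF k] in \<open>auto simp: m_ac\<close>)
      also have "\<dots> = (\<Oplus>i\<in>{..<N}. A $$ (k, i) \<otimes> A' $$ (i, j)) \<otimes> B ! k"
        using m[OF k] BF[OF k] by (simp add: finsum_ldistr Pi_def)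
      also have "(\<Oplus>i\<in>{..<N}. A $$ (k, i) \<otimes> A' $$ (i, j)) = mat_mult F A A' $$ (k, j)"
        using Ac(1) A'(1) k j by (subst mat_mult_index) auto
      also have "\<dots> \<otimes> B ! k = (if j = k then B ! k else \<zero>)" using A'(3) k j BF[OF k] by simp
      finally show "(\<Oplus>i\<in>{..<N}. A' $$ (i, j) \<otimes> (A $$ (k, i) \<otimes> B ! k)) = (if j = k then B ! k else \<zero>)" .
    qed (use BF in auto)
    also have "\<dots> = B ! j" by (rule finsum_singleton) (use j BF in auto)
    finally have "B ! j = combine ?c ?C" by simp
    then show ?thesis using Span_mem_iff_length_version[OF K_subfield CF] c by blast
  qed
  have "set B \<subseteq> Span K ?C" using B_comb B_props(5) by (auto simp: in_set_conv_nth)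
  then have "Span K B \<subseteq> Span K ?C"
    using subalgebra_Span_incl[OF K_subfield Span_is_subalgebra[OF K_subfield CF]] by blast
  moreover have "Span K ?C \<subseteq> L2" using subalgebra_Span_incl[OF K_subfield RR_subalgebra CL] .
  ultimately have span: "Span K ?C = L2" using B_props(2) by blast
  have "independent K ?C"
    by (rule spanning_list_independent[OF K_subfield finite_K CF]) (use span dim_L2 len in simp)
  then show ?thesis using span by (simp add: is_basis_def)
qed

end

text \<open>By the entrywise formulas above, none of these matrices depends on the basis of
  \<open>L(2D)\<close>.\<close>

lemma base_change_invariant:
  assumes "is_residue_basis F K Q BQ" "is_basis F K L2 B" "is_basis F K L2 B'"
  shows "chudnovsky_algorithm F K Q D Ps BQ B = chudnovsky_algorithm F K Q D Ps BQ B'"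
    and "CT_inv F K Q Ps BQ B = CT_inv F K Q Ps BQ B'"
  using assms by (simp_all add: chudnovsky_algorithm_def UA_mat_eq UR_mat_eq CT_inv_eq)

end

theorem proposition3p1:
  fixes F :: "('a, 'b) ring_scheme" and K :: "'a set" and q n g :: nat
    and Q :: "'a set" and D :: "'a set \<Rightarrow>\<^sub>0 int" and Ps :: "'a set list"
  assumes "primepow q" and "card K = q" and "n \<ge> 1"
    and "function_field F K" and "has_genus F K g"
    and "Q \<in> places F K" and "place_degree F K Q = n"
    and "distinct Ps" and "set Ps \<subseteq> places F K" and "\<forall>P\<in>set Ps. place_degree F K P = 1"
    and "is_divisor F K D" and "Poly_Mapping.keys D \<inter> insert Q (set Ps) = {}"
    and "residue F K Q ` RR F K D = carrier (residue_field F K Q)"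
    and "inj_on (eval_tuple F K Ps) (RR F K (frag_cmul 2 D))"
    and "effective D"
    and "nonspecial F K g (D - frag_of Q)" and "div_degree F K (D - frag_of Q) = int g - 1"
    and "length Ps = RR_dim F K (frag_cmul 2 D)"
  shows "RR_dim F K D = n \<and> RR_dim F K (frag_cmul 2 D) = 2 * n + g - 1 \<and>
    (\<exists>BD BDc. length BD = n \<and> length (BD @ BDc) = 2 * n + g - 1 \<and> adapted_basis F K D BD BDc) \<and>
    (\<forall>BQ BD BDc \<sigma>. is_residue_basis F K Q BQ \<longrightarrow> adapted_basis F K D BD BDc \<longrightarrow>
      \<sigma> \<in> GL F K (2 * n + g - 1) \<longrightarrow>
      (let B = BD @ BDc; \<sigma>B = act_basis F \<sigma> B in
        is_basis F K (RR F K (frag_cmul 2 D)) \<sigma>B \<and>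
        chudnovsky_algorithm F K Q D Ps BQ \<sigma>B = chudnovsky_algorithm F K Q D Ps BQ B \<and>
        T_mat F K Ps B \<in> GL F K (2 * n + g - 1) \<and>
        T_mat F K Ps \<sigma>B \<in> GL F K (2 * n + g - 1) \<and>
        N\<^sub>z F (CT_inv F K Q Ps BQ \<sigma>B) = N\<^sub>z F (CT_inv F K Q Ps BQ B) \<and>
        N\<^sub>1 F (CT_inv F K Q Ps BQ \<sigma>B) = N\<^sub>1 F (CT_inv F K Q Ps BQ B)))"
proof -
  have "0 < card K" using assms(1,2) primepow_gt_0_nat by simp
  then have "finite K" by (rule card_ge_0_finite)
  moreover have "field F" using assms(4) by (simp add: function_field_def)
  ultimately interpret chudnovsky F K n g Q D Ps
    using assms unfolding chudnovsky_def chudnovsky_axioms_def finite_function_field_def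
      finite_function_field_axioms_def by simp
  have main: "is_basis F K L2 (act_basis F \<sigma> (BD @ BDc)) \<and>
      chudnovsky_algorithm F K Q D Ps BQ (act_basis F \<sigma> (BD @ BDc)) = chudnovsky_algorithm F K Q D Ps BQ (BD @ BDc) \<and>
      T_mat F K Ps (BD @ BDc) \<in> GL F K (2 * n + g - 1) \<and>
      T_mat F K Ps (act_basis F \<sigma> (BD @ BDc)) \<in> GL F K (2 * n + g - 1) \<and>
      CT_inv F K Q Ps BQ (act_basis F \<sigma> (BD @ BDc)) = CT_inv F K Q Ps BQ (BD @ BDc)"
    if BQ: "is_residue_basis F K Q BQ" and "adapted_basis F K D BD BDc" and "\<sigma> \<in> GL F K (2 * n + g - 1)"
    for BQ BD BDc \<sigma>
  proof -
    have B: "is_basis F K L2 (BD @ BDc)" using that(2) by (simp add: adapted_basis_def)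
    have B': "is_basis F K L2 (act_basis F \<sigma> (BD @ BDc))"
      by (rule act_basis_is_basis[OF B]) (use that(3) N_eq in simp)
    show ?thesis
      using B' base_change_invariant[OF BQ B' B] T_GL[OF B] T_GL[OF B'] unfolding N_eq by blast
  qed
  show ?thesis
    unfolding Let_def using RR_dim_D N_eq length_Ps adapted_basis_exists main by auto
qed

end
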